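(* The $N$-player linear quadratic Nash game described in the context is asymptotically solvable (in the sense defined in the context) if and only if the ODE system $$\begin{cases}\dot\Lambda_1=\Lambda_1BHB^T\Lambda_1-\Lambda_1A-A^T\Lambda_1-Q,\\ \Lambda_1(T)=Q_f,\qquad R+B_1^T\Lambda_1(t)B_1>0\ \ \forall t\in[0,T],\end{cases}$$ $$\begin{cases}\dot\Lambda_2=-\Lambda_1G-\Lambda_2(A+G)-A^T\Lambda_2+\Lambda_1BHB^T\Lambda_2+\Lambda_2BHB^T\Lambda_1+\Lambda_2BHB^T\Lambda_2+Q\Gamma,\\ \Lambda_2(T)=-Q_f\Gamma_f,\end{cases}$$ where $H=(R+B_1^T\Lambda_1B_1)^{-1}$, has a solution $(\Lambda_1,\Lambda_2)$ on $[0,T]$, with $\Lambda_1(t)$ a symmetric $n\times n$ matrix and $\Lambda_2(t)\in\mathbb{R}^{n\times n}$.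
   Context: $\mathcal S^k$ denotes the real symmetric $k\times k$ matrices, $[x]_M^2=x^TMx$, $|\cdot|$ is the Euclidean norm, $\otimes$ the Kronecker product, $\mathbf 1_{k\times l}$ the all-ones matrix, $e^N_k$ the $k$th canonical basis vector of $\mathbb{R}^N$; for symmetric matrices $>0$ means positive definite and $M\ge M'$ means $M-M'$ is positive semidefinite. Model. Fix $T>0$ and constant matrices, independent of $N$: $A,G,\Gamma,\Gamma_f\in\mathbb{R}^{n\times n}$, $B,B_0,B_1\in\mathbb{R}^{n\times n_1}$, $Q,Q_f\in\mathcal S^n$, $R\in\mathcal S^{n_1}$ ($Q,Q_f,R$ possibly indefinite). For $1\le i\le N$, player $i$ has state $X_i(t)\in\mathbb{R}^n$ and control $u_i(t)\in\mathbb{R}^{n_1}$ with $$dX_i=(AX_i+Bu_i+GX^{(N)})dt+B_1u_i\,dW_i+B_0u^{(N)}dW_0,$$ $X^{(N)}=\frac1N\sum_iX_i$, $u^{(N)}=\frac1N\sum_iu_i$, where $W_0,W_1,\dots,W_N$ are independent one-dimensional standard Brownian motions, independent of the independent, square-integrable initial states. The cost of player $i$ is $$J_i=\mathbb{E}\Big[\int_0^T([X_i-\Gamma X^{(N)}]_Q^2+[u_i]_R^2)dt+[X_i(T)-\Gamma_fX^{(N)}(T)]_{Q_f}^2\Big].$$ Large matrices: $\mathbf A=\mathrm{diag}[A,\dots,A]+\mathbf 1_{N\times N}\otimes\frac GN\in\mathbb{R}^{Nn\times Nn}$, $\mathbf B_0=\mathbf 1_{N\times1}\otimes\frac{B_0}N$,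 $\widehat{\mathbf B}_k=e^N_k\otimes B$, $\mathbf B_k=e^N_k\otimes B_1$ for $1\le k\le N$ (all in $\mathbb{R}^{Nn\times n_1}$); $\mathbf K_i=[0,\dots,0,I_n,0,\dots,0]-\frac1N[\Gamma,\dots,\Gamma]\in\mathbb{R}^{n\times Nn}$ ($I_n$ in block position $i$), $\mathbf K_{if}$ is the same with $\Gamma_f$ in place of $\Gamma$; $\mathbf Q_i=\mathbf K_i^TQ\mathbf K_i$, $\mathbf Q_{if}=\mathbf K_{if}^TQ_f\mathbf K_{if}$. Riccati system of the game, for symmetric $\mathbf P_i(t)$, $1\le i\le N$: with $R_k:=R+\mathbf B_k^T\mathbf P_k\mathbf B_k$, $\mathbf L_k:=\mathbf B_0^T\mathbf P_k\mathbf B_0\mathbf M_0+\widehat{\mathbf B}_k^T\mathbf P_k$, $$\mathbf M_0:=-\Big[I+\sum_{k=1}^NR_k^{-1}\mathbf B_0^T\mathbf P_k\mathbf B_0\Big]^{-1}\sum_{k=1}^NR_k^{-1}\widehat{\mathbf B}_k^T\mathbf P_k,$$ $$-\dot{\mathbf P}_i=\mathbf P_i\mathbf A+\mathbf A^T\mathbf P_i+\mathbf Q_i-\mathbf P_i\widehat{\mathbf B}_iR_i^{-1}\widehat{\mathbf B}_i^T\mathbf P_i+\mathbf M_0^T\mathbf B_0^T\mathbf P_i\mathbf B_0R_i^{-1}\mathbf B_0^T\mathbf P_i\mathbf B_0\mathbf M_0-\mathbf P_i\sum_{k\ne i}\widehat{\mathbf B}_kR_k^{-1}\mathbf L_k-\sum_{k\ne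 i}\mathbf L_k^TR_k^{-1}\widehat{\mathbf B}_k^T\mathbf P_i+\sum_{k\ne i}\mathbf L_k^TR_k^{-1}\mathbf B_k^T\mathbf P_i\mathbf B_kR_k^{-1}\mathbf L_k+\mathbf M_0^T\mathbf B_0^T\mathbf P_i\mathbf B_0\mathbf M_0,\qquad \mathbf P_i(T)=\mathbf Q_{if},$$ subject to, for all $t\in[0,T]$ and all $i$: (i) $R+\mathbf B_i^T\mathbf P_i\mathbf B_i>0$; (ii) $R+\mathbf B_i^T\mathbf P_i\mathbf B_i+\mathbf B_0^T\mathbf P_i\mathbf B_0>0$; (iii) $I+\sum_{k=1}^N(R+\mathbf B_k^T\mathbf P_k\mathbf B_k)^{-1}\mathbf B_0^T\mathbf P_k\mathbf B_0$ is invertible. A solution means a solution satisfying (i)-(iii). If a solution exists, $\mathbf P_1$ has the $n\times n$ block form with $(1,1)$ block $\Pi_1^N$, blocks $(1,j)$, $j\ge2$, all equal to $\Pi_2^N$, blocks $(j,1)$, $j\ge2$, equal to $\Pi_2^{NT}$, diagonal blocks $(j,j)$, $j\ge2$, equal to $\Pi_3^N$, and all blocks $(j,l)$ with $2\le j\ne l$ equal to $\Pi_4^N$ (and $\mathbf P_i$ is obtained from $\mathbf P_1$ by interchanging block indices $1$ and $i$). Definition (asymptotic solvability). The game is asymptotically solvable if there exist $N_0>0$ and $c_0>0$ such that for all $N\ge N_0$ the Riccati system, subject to (i)-(iii), has a solution $(\mathbf P_1,\dots,\mathbf P_N)$ on $[0,T]$, and $$\sup_{N\ge N_0}\sup_{0\le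 t\le T}(|\Pi_1^N|+N|\Pi_2^N|+N^2|\Pi_3^N|+N^2|\Pi_4^N|)<\infty,$$ $R+\mathbf B_i^T\mathbf P_i\mathbf B_i\ge c_0I$ for all $t\in[0,T]$, $N\ge N_0$ (and all $i$), and $I+\sum_{k=1}^N(R+\mathbf B_k^T\mathbf P_k\mathbf B_k)^{-1}\mathbf B_0^T\mathbf P_k\mathbf B_0$ is invertible for all $t\in[0,T]$, $N\ge N_0$. *)

theory Defs
  imports "HOL-Analysis.Analysis" "HOL-Library.Function_Algebras"
begin

text \<open>
  The state dimension \<open>n\<close> and the control dimension \<open>n\<^sub>1\<close> are the cardinalities of the
  finite index types \<open>'n\<close> and \<open>'m\<close>. The number \<open>N\<close> of players is quantified over inside
  the definition of asymptotic solvability, so a matrix whose size depends on \<open>N\<close> is an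
  array of blocks indexed by natural numbers starting at 1: an \<open>Nn \<times> Nn\<close> matrix has
  \<open>n \<times> n\<close> blocks \<open>(j, l)\<close> with \<open>1 \<le> j, l \<le> N\<close>, an \<open>Nn \<times> n\<^sub>1\<close> matrix has \<open>n \<times> n\<^sub>1\<close> blocks
  \<open>(j, 1)\<close>, and so on. Entries outside the index range carry no meaning.
  Sums, differences and negation of block arrays are pointwise.
\<close>

type_synonym ('a, 'b) barray = "nat \<Rightarrow> nat \<Rightarrow> real^'b^'a"

text \<open>In \<open>X \<odot>\<^bsub>p\<^esub> Y\<close> the subscript is the number of block columns of \<open>X\<close> and of block
  rows of \<open>Y\<close>; below it is always \<open>N\<close> or \<open>1\<close>.\<close>

definition bmult :: "('a::finite, 'b::finite) barray \<Rightarrow> nat \<Rightarrow> ('b, 'c::finite) barray \<Rightarrow> ('a, 'c) barray"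
    ("_ \<odot>\<^bsub>_\<^esub>/ _" [70, 0, 71] 70)
  where "(X \<odot>\<^bsub>p\<^esub> Y) = (\<lambda>j l. \<Sum>k\<in>{1..p}. X j k ** Y k l)"

definition btranspose :: "('a::finite, 'b::finite) barray \<Rightarrow> ('b, 'a) barray"
  where "btranspose X = (\<lambda>j l. transpose (X l j))"

text \<open>The \<open>1 \<times> 1\<close> array with the single block \<open>S\<close>.\<close>

definition single :: "real^'b^'a \<Rightarrow> ('a::finite, 'b::finite) barray"
  where "single S = (\<lambda>_ _. S)"

text \<open>Kronecker product of a real matrix of variable size with a matrix of fixed size.\<close>

definition kron :: "(nat \<Rightarrow> nat \<Rightarrow> real) \<Rightarrow> real^'b^'a \<Rightarrow> ('a::finite, 'b::finite) barray"
  where "kron K S = (\<lambda>j l. K j l *\<^sub>R S)"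

definition all_ones :: "nat \<Rightarrow> nat \<Rightarrow> real"
  where "all_ones = (\<lambda>_ _. 1)"

definition basis_col :: "nat \<Rightarrow> nat \<Rightarrow> nat \<Rightarrow> real"
  where "basis_col k = (\<lambda>j _. if j = k then 1 else 0)"

definition bdiag :: "real^'a^'a \<Rightarrow> ('a::finite, 'a) barray"
  where "bdiag S = (\<lambda>j l. if j = l then S else 0)"

definition bsymmetric :: "nat \<Rightarrow> ('a::finite, 'a) barray \<Rightarrow> bool"
  where "bsymmetric N X \<longleftrightarrow> (\<forall>j\<in>{1..N}. \<forall>l\<in>{1..N}. btranspose X j l = X j l)"

definition symmetric_mat :: "real^'k^'k \<Rightarrow> bool"
  where "symmetric_mat M \<longleftrightarrow> transpose M = M"

definition pos_def :: "real^'k^'k \<Rightarrow> bool"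
  where "pos_def M \<longleftrightarrow> symmetric_mat M \<and> (\<forall>x. x \<noteq> 0 \<longrightarrow> 0 < x \<bullet> (M *v x))"

definition pos_semidef :: "real^'k^'k \<Rightarrow> bool"
  where "pos_semidef M \<longleftrightarrow> symmetric_mat M \<and> (\<forall>x. 0 \<le> x \<bullet> (M *v x))"

context
  fixes T :: real
    and A G \<Gamma> \<Gamma>\<^sub>f :: "real^'n^'n"
    and B B\<^sub>0 B\<^sub>1 :: "real^'m^'n"
    and Q Q\<^sub>f :: "real^'n^'n"
    and R :: "real^'m^'m"
begin

context
  fixes N :: nat
begin

definition bigA :: "('n, 'n) barray"
  where "bigA = bdiag A + kron all_ones ((1 / real N) *\<^sub>R G)"

definition bigB0 :: "('n, 'm) barray"
  where "bigB0 = kron all_ones ((1 / real N) *\<^sub>R B\<^sub>0)"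

definition bigBhat :: "nat \<Rightarrow> ('n, 'm) barray"
  where "bigBhat k = kron (basis_col k) B"

definition bigB :: "nat \<Rightarrow> ('n, 'm) barray"
  where "bigB k = kron (basis_col k) B\<^sub>1"

definition bigK :: "nat \<Rightarrow> ('n, 'n) barray"
  where "bigK i = (\<lambda>_ l. if l = i then mat 1 else 0) - kron all_ones ((1 / real N) *\<^sub>R \<Gamma>)"

definition bigKf :: "nat \<Rightarrow> ('n, 'n) barray"
  where "bigKf i = (\<lambda>_ l. if l = i then mat 1 else 0) - kron all_ones ((1 / real N) *\<^sub>R \<Gamma>\<^sub>f)"

definition bigQ :: "nat \<Rightarrow> ('n, 'n) barray"
  where "bigQ i = btranspose (bigK i) \<odot>\<^bsub>1\<^esub> single Q \<odot>\<^bsub>1\<^esub> bigK i"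

definition bigQf :: "nat \<Rightarrow> ('n, 'n) barray"
  where "bigQf i = btranspose (bigKf i) \<odot>\<^bsub>1\<^esub> single Q\<^sub>f \<odot>\<^bsub>1\<^esub> bigKf i"

text \<open>In the following, \<open>P k\<close> is the value of \<open>\<^bold>P\<^sub>k\<close> at one fixed time.\<close>

context
  fixes P :: "nat \<Rightarrow> ('n, 'n) barray"
begin

text \<open>The \<open>n\<^sub>1 \<times> n\<^sub>1\<close> matrices \<open>\<^bold>B\<^sub>0\<^sup>T \<^bold>P\<^sub>k \<^bold>B\<^sub>0\<close> and \<open>R\<^sub>k = R + \<^bold>B\<^sub>k\<^sup>T \<^bold>P\<^sub>k \<^bold>B\<^sub>k\<close>.\<close>

definition S0 :: "nat \<Rightarrow> real^'m^'m"
  where "S0 k = (btranspose bigB0 \<odot>\<^bsub>N\<^esub> P k \<odot>\<^bsub>N\<^esub> bigB0) 1 1"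

definition Rk :: "nat \<Rightarrow> real^'m^'m"
  where "Rk k = R + (btranspose (bigB k) \<odot>\<^bsub>N\<^esub> P k \<odot>\<^bsub>N\<^esub> bigB k) 1 1"

definition Rk_inv :: "nat \<Rightarrow> real^'m^'m"
  where "Rk_inv k = matrix_inv (Rk k)"

text \<open>The matrix whose invertibility is condition (iii) of the Riccati system.\<close>

definition coupling_mat :: "real^'m^'m"
  where "coupling_mat = mat 1 + (\<Sum>k\<in>{1..N}. Rk_inv k ** S0 k)"

definition M0 :: "('m, 'n) barray"
  where "M0 = - (single (matrix_inv coupling_mat)
                  \<odot>\<^bsub>1\<^esub> (\<Sum>k\<in>{1..N}. single (Rk_inv k) \<odot>\<^bsub>1\<^esub> btranspose (bigBhat k) \<odot>\<^bsub>N\<^esub> P k))"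

definition Lk :: "nat \<Rightarrow> ('m, 'n) barray"
  where "Lk k = btranspose bigB0 \<odot>\<^bsub>N\<^esub> P k \<odot>\<^bsub>N\<^esub> bigB0 \<odot>\<^bsub>1\<^esub> M0 + btranspose (bigBhat k) \<odot>\<^bsub>N\<^esub> P k"

text \<open>The right-hand side of the Riccati equation for \<open>- d\<^bold>P\<^sub>i/dt\<close>.\<close>

definition riccati_rhs :: "nat \<Rightarrow> ('n, 'n) barray"
  where "riccati_rhs i =
      P i \<odot>\<^bsub>N\<^esub> bigA + btranspose bigA \<odot>\<^bsub>N\<^esub> P i + bigQ i
    - P i \<odot>\<^bsub>N\<^esub> bigBhat i \<odot>\<^bsub>1\<^esub> single (Rk_inv i) \<odot>\<^bsub>1\<^esub> btranspose (bigBhat i) \<odot>\<^bsub>N\<^esub> P i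
    + btranspose M0 \<odot>\<^bsub>1\<^esub> btranspose bigB0 \<odot>\<^bsub>N\<^esub> P i \<odot>\<^bsub>N\<^esub> bigB0 \<odot>\<^bsub>1\<^esub> single (Rk_inv i)
        \<odot>\<^bsub>1\<^esub> btranspose bigB0 \<odot>\<^bsub>N\<^esub> P i \<odot>\<^bsub>N\<^esub> bigB0 \<odot>\<^bsub>1\<^esub> M0
    - P i \<odot>\<^bsub>N\<^esub> (\<Sum>k\<in>{1..N} - {i}. bigBhat k \<odot>\<^bsub>1\<^esub> single (Rk_inv k) \<odot>\<^bsub>1\<^esub> Lk k)
    - (\<Sum>k\<in>{1..N} - {i}. btranspose (Lk k) \<odot>\<^bsub>1\<^esub> single (Rk_inv k) \<odot>\<^bsub>1\<^esub> btranspose (bigBhat k)) \<odot>\<^bsub>N\<^esub> P i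
    + (\<Sum>k\<in>{1..N} - {i}. btranspose (Lk k) \<odot>\<^bsub>1\<^esub> single (Rk_inv k) \<odot>\<^bsub>1\<^esub> btranspose (bigB k)
        \<odot>\<^bsub>N\<^esub> P i \<odot>\<^bsub>N\<^esub> bigB k \<odot>\<^bsub>1\<^esub> single (Rk_inv k) \<odot>\<^bsub>1\<^esub> Lk k)
    + btranspose M0 \<odot>\<^bsub>1\<^esub> btranspose bigB0 \<odot>\<^bsub>N\<^esub> P i \<odot>\<^bsub>N\<^esub> bigB0 \<odot>\<^bsub>1\<^esub> M0"

end

text \<open>\<open>P i t\<close> is \<open>\<^bold>P\<^sub>i(t)\<close>. At the endpoints of \<open>[0, T]\<close> the derivative is one-sided.\<close>

definition riccati_solution :: "(nat \<Rightarrow> real \<Rightarrow> ('n, 'n) barray) \<Rightarrow> bool"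
  where "riccati_solution P \<longleftrightarrow>
    (\<forall>i\<in>{1..N}.
       (\<forall>t\<in>{0..T}. bsymmetric N (P i t)) \<and>
       (\<forall>t\<in>{0..T}. \<forall>j\<in>{1..N}. \<forall>l\<in>{1..N}.
          ((\<lambda>s. P i s j l) has_vector_derivative - riccati_rhs (\<lambda>k. P k t) i j l)
            (at t within {0..T})) \<and>
       (\<forall>j\<in>{1..N}. \<forall>l\<in>{1..N}. P i T j l = bigQf i j l)) \<and>
    (\<forall>t\<in>{0..T}.
       (\<forall>i\<in>{1..N}. pos_def (Rk (\<lambda>k. P k t) i)) \<and>
       (\<forall>i\<in>{1..N}. pos_def (Rk (\<lambda>k. P k t) i + S0 (\<lambda>k. P k t) i)) \<and>
       invertible (coupling_mat (\<lambda>k. P k t)))"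

end

text \<open>
  \<open>P N\<close> is the solution with \<open>N\<close> players. The matrices \<open>\<Pi>\<^sub>1\<^sup>N, \<Pi>\<^sub>2\<^sup>N, \<Pi>\<^sub>3\<^sup>N, \<Pi>\<^sub>4\<^sup>N\<close> are the
  blocks \<open>(1,1)\<close>, \<open>(1,2)\<close>, \<open>(2,2)\<close>, \<open>(2,3)\<close> of \<open>\<^bold>P\<^sub>1\<close>. For \<open>N < 3\<close> some of these lie outside
  the index range, where \<open>riccati_solution\<close> does not constrain \<open>P\<close>, so they may be taken
  to be 0 and the bound says nothing about absent blocks. \<open>norm\<close> is the Frobenius norm.
\<close>

definition asymptotically_solvable :: bool
  where "asymptotically_solvable \<longleftrightarrow>
    (\<exists>N\<^sub>0 > 0. \<exists>c\<^sub>0 > 0. \<exists>P :: nat \<Rightarrow> nat \<Rightarrow> real \<Rightarrow> ('n, 'n) barray.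
       (\<forall>N\<ge>N\<^sub>0. riccati_solution N (P N)) \<and>
       bdd_above {norm (P N 1 t 1 1) + real N * norm (P N 1 t 1 2)
                  + (real N)\<^sup>2 * norm (P N 1 t 2 2) + (real N)\<^sup>2 * norm (P N 1 t 2 3)
                  | N t. N \<ge> N\<^sub>0 \<and> t \<in> {0..T}} \<and>
       (\<forall>N\<ge>N\<^sub>0. \<forall>t\<in>{0..T}. \<forall>i\<in>{1..N}.
          pos_semidef (Rk N (\<lambda>k. P N k t) i - c\<^sub>0 *\<^sub>R mat 1)) \<and>
       (\<forall>N\<ge>N\<^sub>0. \<forall>t\<in>{0..T}. invertible (coupling_mat N (\<lambda>k. P N k t))))"

end

end

theory Submission
  imports Defs
begin

text \<open>
  The Riccati equations are equivariant under permutations of the players, and their solution is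
  unique. Hence, for at least three players, each \<open>\<^bold>P\<^sub>i\<close> is determined by the four blocks
  \<open>\<Pi>\<^sub>1, \<Pi>\<^sub>2, \<Pi>\<^sub>3, \<Pi>\<^sub>4\<close> of \<open>\<^bold>P\<^sub>1\<close> (\<open>riccati_solution_exchangeable\<close>), and the big system becomes a
  system for four \<open>n \<times> n\<close> matrices. Put \<open>e = 1/N\<close> and rescale to
  \<open>x = (\<Pi>\<^sub>1, N \<Pi>\<^sub>2, N\<^sup>2 \<Pi>\<^sub>3, N\<^sup>2 \<Pi>\<^sub>4)\<close>. All factors \<open>N\<close> then combine into nonnegative powers of \<open>e\<close>,
  and the system reads \<open>- x' = field e x\<close> (\<open>rhs_blift\<close>), where \<open>field e x\<close> is built by sums and
  products from \<open>e\<close>, from \<open>x\<close> and from two inverses: that of \<open>R + B\<^sub>1\<^sup>T \<Pi>\<^sub>1 B\<^sub>1\<close> and that of a matrix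
  \<open>I + O(e)\<close>. So \<open>field\<close> extends to \<open>e = 0\<close> and is Lipschitz in \<open>(e, x)\<close> jointly wherever \<open>x\<close> is
  bounded, \<open>R + B\<^sub>1\<^sup>T x\<^sub>1 B\<^sub>1\<close> is bounded below and \<open>e\<close> is small (\<open>field_bounded_lipschitz\<close>). At
  \<open>e = 0\<close> the first two components are the system for \<open>(\<Lambda>\<^sub>1, \<Lambda>\<^sub>2)\<close>, and the last two are affine in
  \<open>(x\<^sub>3, x\<^sub>4)\<close> when \<open>(x\<^sub>1, x\<^sub>2)\<close> is given.

  If the game is asymptotically solvable, the uniform bounds keep all rescaled solutions in one
  such region, Gronwall's inequality makes them a Cauchy sequence, uniformly in time, and the limit
  solves the system with \<open>e = 0\<close> (\<open>reduced_limit\<close>).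

  Conversely, a solution \<open>(\<Lambda>\<^sub>1, \<Lambda>\<^sub>2)\<close> extends to a solution \<open>\<Lambda>\<close> of the system with \<open>e = 0\<close>, since an
  affine equation has global solutions (\<open>limit_tail_exists\<close>). For small \<open>e\<close> the system with
  parameter \<open>e\<close> has a solution that stays in a fixed tube around \<open>\<Lambda>\<close> (\<open>reduced_persistence\<close>): solve a
  globally Lipschitz modification of the equation that agrees with it on the tube, and use Gronwall
  to see that its solution never leaves the tube. Filling in the blocks gives a solution of the
  Riccati system, with all the bounds that asymptotic solvability asks for (\<open>blift_solves\<close>).
\<close>

section \<open>Matrix multiplication as a bounded bilinear map\<close>

lemma bounded_bilinear_matrix_mult:
  "bounded_bilinear ((**) :: real^'b^'a \<Rightarrow> real^'c^'b \<Rightarrow> real^'c^'a)"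
proof -
  have "bilinear ((**) :: real^'b^'a \<Rightarrow> real^'c^'b \<Rightarrow> real^'c^'a)"
    by (auto simp: bilinear_def linear_iff matrix_add_ldistrib
        matrix_matrix_mult_def vec_eq_iff sum_distrib_left sum.distrib algebra_simps)
  then show ?thesis
    by (simp add: bilinear_conv_bounded_bilinear)
qed

lemma bounded_bilinear_matrix_vector_mult:
  "bounded_bilinear ((*v) :: real^'b^'a \<Rightarrow> real^'b \<Rightarrow> real^'a)"
proof -
  have "bilinear ((*v) :: real^'b^'a \<Rightarrow> real^'b \<Rightarrow> real^'a)"
    by (auto simp: bilinear_def linear_iff algebra_simps scaleR_matrix_vector_assoc
        matrix_scaleR_vector_ac)
  then show ?thesis
    by (simp add: bilinear_conv_bounded_bilinear)
qed

lemma bounded_linear_transpose: "bounded_linear (transpose :: real^'b^'a \<Rightarrow> real^'a^'b)"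
  by (simp add: linear_conv_bounded_linear[symmetric] linear_iff transpose_def vec_eq_iff)

interpretation mm: bounded_bilinear "(**) :: real^'b^'a \<Rightarrow> real^'c^'b \<Rightarrow> real^'c^'a"
  by (rule bounded_bilinear_matrix_mult)

interpretation mv: bounded_bilinear "(*v) :: real^'b^'a \<Rightarrow> real^'b \<Rightarrow> real^'a"
  by (rule bounded_bilinear_matrix_vector_mult)

lemmas mm_linear = mm.add_left mm.add_right mm.diff_left mm.diff_right mm.minus_left mm.minus_right
  mm.scaleR_left mm.scaleR_right mm.zero_left mm.zero_right

lemmas linear_transpose = bounded_linear.linear[OF bounded_linear_transpose]

lemmas transpose_simps = matrix_transpose_mul linear_add[OF linear_transpose]
  linear_diff[OF linear_transpose] linear_neg[OF linear_transpose]
  linear_scale[OF linear_transpose] linear_0[OF linear_transpose]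

lemma matrix_inv_inverse:
  fixes M :: "real^'m^'m"
  assumes "invertible M"
  shows "M ** matrix_inv M = mat 1" "matrix_inv M ** M = mat 1"
  using someI_ex[OF assms[unfolded invertible_def]] by (simp_all add: matrix_inv_def)

lemma invertible_bounded_below:
  fixes M :: "real^'m^'m"
  assumes "0 < c" "\<And>v. c * norm v \<le> norm (M *v v)"
  shows "invertible M"
proof -
  have "inj ((*v) M)"
  proof (rule injI)
    fix x y assume "M *v x = M *v y"
    then have "c * norm (x - y) \<le> 0" using assms(2)[of "x - y"] by (simp add: mv.diff_right)
    then show "x = y" using \<open>0 < c\<close> by (simp add: mult_le_0_iff)
  qed
  then show ?thesis
    by (simp add: invertible_left_inverse matrix_left_invertible_injective)
qed

text \<open>
  Column \<open>j\<close> of the inverse solves \<open>M v = axis j 1\<close>, so each column has norm at most \<open>1 / c\<close>.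
\<close>

lemma norm_matrix_inv_le:
  fixes M :: "real^'m^'m"
  assumes c: "0 < c" "\<And>v. c * norm v \<le> norm (M *v v)"
  shows "norm (matrix_inv M) \<le> (real CARD('m))\<^sup>2 / c"
proof -
  have inv: "invertible M" by (rule invertible_bounded_below[OF c])
  have entry: "\<bar>matrix_inv M $ i $ j\<bar> \<le> 1 / c" for i j
  proof -
    have "c * norm (matrix_inv M *v axis j 1) \<le> norm (M *v (matrix_inv M *v axis j 1))"
      by (rule c)
    also have "\<dots> = 1"
      by (simp add: matrix_vector_mul_assoc matrix_inv_inverse[OF inv])
    finally have "norm (column j (matrix_inv M)) \<le> 1 / c"
      using c(1) by (simp add: field_simps matrix_vector_mult_basis)
    moreover have "\<bar>matrix_inv M $ i $ j\<bar> \<le> norm (column j (matrix_inv M))"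
      using component_le_norm_cart[of "column j (matrix_inv M)" i] by (simp add: column_def)
    ultimately show ?thesis by linarith
  qed
  have "norm (matrix_inv M) \<le> (\<Sum>i\<in>UNIV. norm (matrix_inv M $ i))"
    by (simp add: norm_vec_def L2_set_le_sum)
  also have "\<dots> \<le> (\<Sum>i\<in>(UNIV::'m set). real CARD('m) * (1 / c))"
  proof (rule sum_mono)
    fix i
    have "norm (matrix_inv M $ i) \<le> (\<Sum>j\<in>UNIV. \<bar>matrix_inv M $ i $ j\<bar>)"
      by (rule norm_le_l1_cart)
    also have "\<dots> \<le> (\<Sum>j\<in>(UNIV::'m set). 1 / c)" by (intro sum_mono entry)
    finally show "norm (matrix_inv M $ i) \<le> real CARD('m) * (1 / c)" by simp
  qed
  finally show ?thesis by (simp add: power2_eq_square)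
qed

lemma matrix_inv_diff:
  fixes M M' :: "real^'m^'m"
  assumes "invertible M" "invertible M'"
  shows "matrix_inv M - matrix_inv M' = - (matrix_inv M ** (M - M') ** matrix_inv M')"
  using matrix_inv_inverse[OF assms(1)] matrix_inv_inverse[OF assms(2)]
  by (simp add: mm_linear matrix_mul_assoc[symmetric])

lemma transpose_matrix_inv:
  fixes M :: "real^'m^'m"
  assumes "invertible M"
  shows "transpose (matrix_inv M) = matrix_inv (transpose M)"
proof -
  have invT: "invertible (transpose M)" using assms by (rule transpose_invertible)
  have "transpose (matrix_inv M) ** transpose M = mat 1"
    by (simp add: matrix_transpose_mul[symmetric] matrix_inv_inverse[OF assms])
  then have "transpose (matrix_inv M) ** transpose M ** matrix_inv (transpose M)
      = matrix_inv (transpose M)" by simp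
  then show ?thesis
    by (simp add: matrix_mul_assoc[symmetric] matrix_inv_inverse[OF invT])
qed

section \<open>Functions that are bounded and Lipschitz\<close>

text \<open>
  The index set and the function \<open>d\<close> are arbitrary because three instances occur: \<open>d\<close> is the distance
  on pairs \<open>(e, x)\<close> for the reduced system, the sum of all block distances for the Riccati system,
  and \<open>norm (M s - M t)\<close> when continuity of \<open>t \<mapsto> (M t)\<^sup>-\<^sup>1\<close> is wanted. These functions are closed under
  sums and products, and under inversion of uniformly invertible matrices, so that the long
  expressions below need no estimates of their own.
\<close>

definition bounded_lipschitz ::
    "'i set \<Rightarrow> ('i \<Rightarrow> 'i \<Rightarrow> real) \<Rightarrow> ('i \<Rightarrow> 'e::real_normed_vector) \<Rightarrow> bool"
  where "bounded_lipschitz S d f \<longleftrightarrow>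
    (\<exists>K. \<forall>x\<in>S. norm (f x) \<le> K) \<and> (\<exists>L. \<forall>x\<in>S. \<forall>y\<in>S. norm (f x - f y) \<le> L * d x y)"

named_theorems blip "closure properties of bounded Lipschitz functions"

lemma blip_const [blip]: "bounded_lipschitz S d (\<lambda>_. c)"
  unfolding bounded_lipschitz_def
  by (intro conjI exI[of _ "norm c"] exI[of _ 0]) auto

lemma blip_add [blip]:
  assumes "bounded_lipschitz S d f" "bounded_lipschitz S d g"
  shows "bounded_lipschitz S d (\<lambda>x. f x + g x)"
proof -
  obtain Kf Lf where f: "\<forall>x\<in>S. norm (f x) \<le> Kf" "\<forall>x\<in>S. \<forall>y\<in>S. norm (f x - f y) \<le> Lf * d x y"
    using assms(1) unfolding bounded_lipschitz_def by blast
  obtain Kg Lg where g: "\<forall>x\<in>S. norm (g x) \<le> Kg" "\<forall>x\<in>S. \<forall>y\<in>S. norm (g x - g y) \<le> Lg * d x y"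
    using assms(2) unfolding bounded_lipschitz_def by blast
  have "\<forall>x\<in>S. norm (f x + g x) \<le> Kf + Kg"
    using f g by (auto intro!: norm_triangle_mono)
  moreover have "\<forall>x\<in>S. \<forall>y\<in>S. norm (f x + g x - (f y + g y)) \<le> (Lf + Lg) * d x y"
    using f(2) g(2) by (auto simp: distrib_right add_diff_add intro!: norm_triangle_mono)
  ultimately show ?thesis unfolding bounded_lipschitz_def by blast
qed

lemma blip_linear:
  assumes "bounded_linear h" "bounded_lipschitz S d f"
  shows "bounded_lipschitz S d (\<lambda>x. h (f x))"
proof -
  interpret h: bounded_linear h by fact
  obtain C where C: "\<And>x. norm (h x) \<le> norm x * C" "C \<ge> 0" using h.nonneg_bounded by blast
  obtain Kf Lf where f: "\<forall>x\<in>S. norm (f x) \<le> Kf" "\<forall>x\<in>S. \<forall>y\<in>S. norm (f x - f y) \<le> Lf * d x y"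
    using assms(2) unfolding bounded_lipschitz_def by blast
  have "\<forall>x\<in>S. norm (h (f x)) \<le> Kf * C"
    using f(1) C by (meson mult_right_mono order_trans)
  moreover have "norm (h (f x) - h (f y)) \<le> (Lf * C) * d x y" if "x \<in> S" "y \<in> S" for x y
  proof -
    have "norm (h (f x) - h (f y)) \<le> norm (f x - f y) * C"
      by (metis C(1) h.diff)
    also have "\<dots> \<le> Lf * d x y * C" using f(2) that C by (intro mult_right_mono) auto
    finally show ?thesis by (simp add: algebra_simps)
  qed
  ultimately show ?thesis unfolding bounded_lipschitz_def by blast
qed

lemma blip_bilinear:
  assumes "bounded_bilinear h" "bounded_lipschitz S d f" "bounded_lipschitz S d g"
  shows "bounded_lipschitz S d (\<lambda>x. h (f x) (g x))"
proof -
  interpret h: bounded_bilinear h by fact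
  obtain C where C: "\<And>x y. norm (h x y) \<le> norm x * norm y * C" "C \<ge> 0" using h.nonneg_bounded by blast
  obtain Kf Lf where f: "\<forall>x\<in>S. norm (f x) \<le> Kf" "\<forall>x\<in>S. \<forall>y\<in>S. norm (f x - f y) \<le> Lf * d x y"
    using assms(2) unfolding bounded_lipschitz_def by blast
  obtain Kg Lg where g: "\<forall>x\<in>S. norm (g x) \<le> Kg" "\<forall>x\<in>S. \<forall>y\<in>S. norm (g x - g y) \<le> Lg * d x y"
    using assms(3) unfolding bounded_lipschitz_def by blast
  have "norm (h (f x) (g x)) \<le> Kf * Kg * C" if "x \<in> S" for x
  proof -
    have "norm (f x) * norm (g x) \<le> Kf * Kg"
      using f(1) g(1) that order_trans[OF norm_ge_zero, of "f x" Kf] by (intro mult_mono) auto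
    then show ?thesis using C by (meson mult_right_mono order_trans)
  qed
  moreover have "norm (h (f x) (g x) - h (f y) (g y)) \<le> (Lf * Kg * C + Kf * Lg * C) * d x y"
    if xy: "x \<in> S" "y \<in> S" for x y
  proof -
    have "h (f x) (g x) - h (f y) (g y) = h (f x - f y) (g x) + h (f y) (g x - g y)"
      by (simp add: h.diff_left h.diff_right)
    then have "norm (h (f x) (g x) - h (f y) (g y))
        \<le> norm (f x - f y) * norm (g x) * C + norm (f y) * norm (g x - g y) * C"
      by (simp only:) (intro norm_triangle_mono C(1))
    also have "\<dots> \<le> (Lf * d x y) * Kg * C + Kf * (Lg * d x y) * C"
    proof -
      have *: "norm (f x - f y) \<le> Lf * d x y" "norm (g x) \<le> Kg" "norm (f y) \<le> Kf"
        "norm (g x - g y) \<le> Lg * d x y"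
        using f g xy by auto
      have "0 \<le> Lf * d x y" "0 \<le> Kf"
        using order_trans[OF norm_ge_zero *(1)] order_trans[OF norm_ge_zero *(3)] by auto
      with * \<open>C \<ge> 0\<close> show ?thesis by (intro add_mono mult_right_mono mult_mono) auto
    qed
    finally show ?thesis by (simp add: algebra_simps)
  qed
  ultimately show ?thesis unfolding bounded_lipschitz_def by blast
qed

lemmas blip_ops [blip] =
  blip_bilinear[OF bounded_bilinear_matrix_mult] blip_bilinear[OF bounded_bilinear_scaleR]
  blip_bilinear[OF bounded_bilinear_mult] blip_linear[OF bounded_linear_transpose]
  blip_linear[OF bounded_linear_fst] blip_linear[OF bounded_linear_snd]

lemma blip_minus [blip]: "bounded_lipschitz S d f \<Longrightarrow> bounded_lipschitz S d (\<lambda>x. - f x)"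
  by (rule blip_linear[OF bounded_linear_minus[OF bounded_linear_ident]])

lemma blip_diff [blip]:
  "bounded_lipschitz S d f \<Longrightarrow> bounded_lipschitz S d g \<Longrightarrow> bounded_lipschitz S d (\<lambda>x. f x - g x)"
  using blip_add[of S d f "\<lambda>x. - g x"] blip_minus[of S d g] by simp

lemma blip_sum [blip]:
  "(\<And>k. k \<in> I \<Longrightarrow> bounded_lipschitz S d (f k)) \<Longrightarrow> bounded_lipschitz S d (\<lambda>x. \<Sum>k\<in>I. f k x)"
  by (induction I rule: infinite_finite_induct) (auto intro: blip)

lemma blip_Pair [blip]:
  assumes "bounded_lipschitz S d f" "bounded_lipschitz S d g"
  shows "bounded_lipschitz S d (\<lambda>x. (f x, g x))"
proof -
  have "bounded_linear (\<lambda>a::'b. (a, 0::'c))" "bounded_linear (\<lambda>b::'c. (0::'b, b))"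
    by (intro bounded_linear_Pair bounded_linear_ident bounded_linear_zero)+
  from blip_add[OF blip_linear[OF this(1) assms(1)] blip_linear[OF this(2) assms(2)]]
  show ?thesis by simp
qed

text \<open>
  The estimate is the identity \<open>M\<^sup>-\<^sup>1 - M'\<^sup>-\<^sup>1 = - M\<^sup>-\<^sup>1 (M - M') M'\<^sup>-\<^sup>1\<close>.
\<close>

lemma blip_matrix_inv:
  fixes M :: "'i \<Rightarrow> real^'m^'m"
  assumes M: "bounded_lipschitz S d M"
    and c: "0 < c" "\<And>x v. x \<in> S \<Longrightarrow> c * norm v \<le> norm (M x *v v)"
  shows "bounded_lipschitz S d (\<lambda>x. matrix_inv (M x))"
proof -
  define K where "K = (real CARD('m))\<^sup>2 / c"
  obtain C where C: "\<And>(X::real^'m^'m) (Y::real^'m^'m). norm (X ** Y) \<le> norm X * norm Y * C" "C \<ge> 0"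
    using mm.nonneg_bounded by blast
  obtain L where L: "\<forall>x\<in>S. \<forall>y\<in>S. norm (M x - M y) \<le> L * d x y"
    using M unfolding bounded_lipschitz_def by blast
  have K: "norm (matrix_inv (M x)) \<le> K" if "x \<in> S" for x
    unfolding K_def using c that by (intro norm_matrix_inv_le) auto
  have inv: "invertible (M x)" if "x \<in> S" for x
    using c that by (intro invertible_bounded_below) auto
  have "norm (matrix_inv (M x) - matrix_inv (M y)) \<le> (K * L * C * K * C) * d x y"
    if xy: "x \<in> S" "y \<in> S" for x y
  proof -
    have "K \<ge> 0" using order_trans[OF norm_ge_zero K[OF xy(1)]] .
    have "norm (matrix_inv (M x) ** (M x - M y)) \<le> norm (matrix_inv (M x)) * norm (M x - M y) * C"
      by (rule C)
    also have "\<dots> \<le> K * (L * d x y) * C"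
      using K L xy \<open>C \<ge> 0\<close> \<open>K \<ge> 0\<close> by (intro mult_right_mono mult_mono) auto
    finally have *: "norm (matrix_inv (M x) ** (M x - M y)) \<le> K * (L * d x y) * C" .
    have "norm (matrix_inv (M x) - matrix_inv (M y))
        \<le> norm (matrix_inv (M x) ** (M x - M y)) * norm (matrix_inv (M y)) * C"
      using C(1) by (simp add: matrix_inv_diff[OF inv inv] xy)
    also have "\<dots> \<le> K * (L * d x y) * C * K * C"
      using K xy * order_trans[OF norm_ge_zero *] \<open>C \<ge> 0\<close>
      by (intro mult_right_mono mult_mono) auto
    finally show ?thesis by (simp add: algebra_simps)
  qed
  with K show ?thesis unfolding bounded_lipschitz_def by blast
qed

text \<open>
  The constant is the minimum of \<open>norm (M t *v v)\<close> over \<open>K\<close> times the unit sphere.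
\<close>

lemma bounded_below_on_compact:
  fixes M :: "'t::topological_space \<Rightarrow> real^'m^'m"
  assumes "compact K" "continuous_on K M" "\<And>t. t \<in> K \<Longrightarrow> invertible (M t)"
  shows "\<exists>c>0. \<forall>t\<in>K. \<forall>v. c * norm v \<le> norm (M t *v v)"
proof (cases "K = {}")
  case False
  let ?S = "sphere (0::real^'m) 1"
  have cont: "continuous_on (K \<times> ?S) (\<lambda>p. norm (M (fst p) *v snd p))"
    by (intro continuous_on_norm mv.continuous_on continuous_on_compose2[OF assms(2)] continuous_intros)
      auto
  have "axis undefined 1 \<in> ?S" by simp
  then have "K \<times> ?S \<noteq> {}" using False by blast
  then obtain t w where tw: "t \<in> K" "w \<in> ?S"
    and min: "\<And>s v. s \<in> K \<Longrightarrow> v \<in> ?S \<Longrightarrow> norm (M t *v w) \<le> norm (M s *v v)"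
    using continuous_attains_inf[OF compact_Times[OF assms(1) compact_sphere] _ cont] by fastforce
  have "w \<noteq> 0" using tw by auto
  then have "M t *v w \<noteq> 0"
    using assms(3)[OF tw(1)] by (metis invertible_def matrix_left_invertible_ker)
  moreover have "norm (M t *v w) * norm v \<le> norm (M s *v v)" if "s \<in> K" for s v
  proof (cases "v = 0")
    case False
    then have "norm (M t *v w) \<le> norm (M s *v ((1 / norm v) *\<^sub>R v))"
      using that by (intro min) auto
    also have "\<dots> = norm (M s *v v) / norm v" by (simp add: mv.scaleR_right)
    finally show ?thesis using False by (simp add: field_simps)
  qed simp
  ultimately show ?thesis by (intro exI[of _ "norm (M t *v w)"]) auto
qed (auto intro: exI[of _ 1])

lemma blip_matrix_inv_compact:
  fixes M :: "'t::topological_space \<Rightarrow> real^'m^'m"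
  assumes "compact K" "continuous_on K M" "\<And>t. t \<in> K \<Longrightarrow> invertible (M t)"
  shows "bounded_lipschitz K (\<lambda>s t. norm (M s - M t)) (\<lambda>t. matrix_inv (M t))"
proof -
  obtain c where c: "c > 0" "\<And>t v. t \<in> K \<Longrightarrow> c * norm v \<le> norm (M t *v v)"
    using bounded_below_on_compact[OF assms] by blast
  have "bounded (M ` K)" using assms by (intro compact_imp_bounded compact_continuous_image)
  then obtain B where "\<forall>t\<in>K. norm (M t) \<le> B" by (auto simp: bounded_iff)
  then have "bounded_lipschitz K (\<lambda>s t. norm (M s - M t)) M"
    unfolding bounded_lipschitz_def by (intro conjI exI[of _ B] exI[of _ 1]) auto
  then show ?thesis by (rule blip_matrix_inv[OF _ c])
qed

lemma continuous_on_matrix_inv: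
  fixes M :: "'t::topological_space \<Rightarrow> real^'m^'m"
  assumes "compact K" "continuous_on K M" "\<And>t. t \<in> K \<Longrightarrow> invertible (M t)"
  shows "continuous_on K (\<lambda>t. matrix_inv (M t))"
proof -
  obtain L where L: "\<And>s t. s \<in> K \<Longrightarrow> t \<in> K \<Longrightarrow>
      norm (matrix_inv (M s) - matrix_inv (M t)) \<le> L * norm (M s - M t)"
    using blip_matrix_inv_compact[OF assms] unfolding bounded_lipschitz_def by blast
  show ?thesis
    unfolding continuous_on_def
  proof
    fix t assume t: "t \<in> K"
    have "((\<lambda>s. L * norm (M s - M t)) \<longlongrightarrow> L * norm (M t - M t)) (at t within K)"
      using assms(2) t by (intro tendsto_intros) (simp add: continuous_on_def)
    then have "((\<lambda>s. L * norm (M s - M t)) \<longlongrightarrow> 0) (at t within K)" by simp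
    moreover have "\<forall>\<^sub>F s in at t within K. norm (matrix_inv (M s) - matrix_inv (M t)) \<le> L * norm (M s - M t)"
      using L t by (auto simp: eventually_at_filter)
    ultimately have "((\<lambda>s. matrix_inv (M s) - matrix_inv (M t)) \<longlongrightarrow> 0) (at t within K)"
      by (rule Lim_null_comparison[rotated])
    then show "((\<lambda>s. matrix_inv (M s)) \<longlongrightarrow> matrix_inv (M t)) (at t within K)"
      using LIM_zero_iff by blast
  qed
qed

section \<open>Gronwall estimates for terminal value problems\<close>

text \<open>
  The hypothesis says that \<open>(v s + d) * exp (K * s)\<close> is nondecreasing in \<open>s\<close>.
\<close>

lemma gronwall_scalar:
  fixes v :: "real \<Rightarrow> real"
  assumes v': "\<And>t. t \<in> {0..T} \<Longrightarrow> (v has_vector_derivative v' t) (at t within {0..T})"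
    and le: "\<And>t. t \<in> {0..T} \<Longrightarrow> - v' t \<le> K * (v t + d)"
    and t: "t \<in> {0..T}"
  shows "v t + d \<le> (v T + d) * exp (K * (T - t))"
proof -
  define g where "g s = (v s + d) * exp (K * s)" for s
  have g': "(g has_vector_derivative (v' s + K * (v s + d)) * exp (K * s)) (at s within {0..T})"
    if "s \<in> {0..T}" for s
  proof -
    have "(v has_field_derivative v' s) (at s within {0..T})"
      using v'[OF that] by (simp add: has_real_derivative_iff_has_vector_derivative)
    then have "(g has_field_derivative (v' s + K * (v s + d)) * exp (K * s)) (at s within {0..T})"
      unfolding g_def by (auto intro!: derivative_eq_intros simp: algebra_simps)
    then show ?thesis by (simp add: has_real_derivative_iff_has_vector_derivative)
  qed
  have "continuous_on {0..T} g"
    using g' by (rule continuous_on_vector_derivative)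
  then have "continuous_on {t..T} g" using t by (auto intro: continuous_on_subset)
  have "g t \<le> g T"
  proof (rule DERIV_nonneg_imp_increasing_open[where f = g and a = t and b = T])
    show "t \<le> T" using t by simp
    fix s assume s: "t < s" "s < T"
    have "0 \<le> (v' s + K * (v s + d)) * exp (K * s)" using le[of s] s t by auto
    moreover have "at s within {0..T} = at s" using s t by (intro at_within_interior) auto
    then have "DERIV g s :> (v' s + K * (v s + d)) * exp (K * s)"
      using g'[of s] s t by (simp add: has_real_derivative_iff_has_vector_derivative)
    ultimately show "\<exists>y. DERIV g s :> y \<and> y \<ge> 0" by blast
  qed fact
  then have "(v t + d) * exp (K * t) * exp (- (K * t)) \<le> (v T + d) * exp (K * T) * exp (- (K * t))"
    unfolding g_def by (intro mult_right_mono) auto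
  then show ?thesis
    by (simp add: mult.assoc exp_add[symmetric] right_diff_distrib)
qed

text \<open>
  Since the norm need not be differentiable at zeros of \<open>x\<close>, the scalar estimate is applied to
  \<open>(norm (x t))\<^sup>2\<close>; the cross term \<open>2 * norm (x t) * \<delta>\<close> is split into squares, which costs the \<open>+ 1\<close> in
  the exponent.
\<close>

lemma gronwall_norm:
  fixes x :: "real \<Rightarrow> 'e::real_inner"
  assumes x': "\<And>t. t \<in> {0..T} \<Longrightarrow> (x has_vector_derivative x' t) (at t within {0..T})"
    and le: "\<And>t. t \<in> {0..T} \<Longrightarrow> norm (x' t) \<le> L * norm (x t) + \<delta>"
    and L: "0 \<le> L" and t: "t \<in> {0..T}"
  shows "(norm (x t))\<^sup>2 \<le> ((norm (x T))\<^sup>2 + \<delta>\<^sup>2) * exp ((2 * L + 1) * T)"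
proof -
  have *: "- (2 * inner (x s) (x' s)) \<le> (2 * L + 1) * ((norm (x s))\<^sup>2 + \<delta>\<^sup>2)" if "s \<in> {0..T}" for s
  proof -
    have "- inner (x s) (x' s) \<le> norm (x s) * norm (x' s)"
      using norm_cauchy_schwarz[of "x s" "- x' s"] by simp
    also have "\<dots> \<le> norm (x s) * (L * norm (x s) + \<delta>)"
      using le[OF that] by (intro mult_left_mono) auto
    also have "\<dots> = L * (norm (x s))\<^sup>2 + norm (x s) * \<delta>" by (simp add: power2_eq_square algebra_simps)
    finally have "- (2 * inner (x s) (x' s)) \<le> 2 * L * (norm (x s))\<^sup>2 + 2 * norm (x s) * \<delta>" by simp
    also have "\<dots> \<le> 2 * L * (norm (x s))\<^sup>2 + ((norm (x s))\<^sup>2 + \<delta>\<^sup>2)"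
      using sum_squares_bound[of "norm (x s)" \<delta>] by simp
    also have "\<dots> \<le> (2 * L + 1) * ((norm (x s))\<^sup>2 + \<delta>\<^sup>2)"
      using L by (simp add: algebra_simps)
    finally show ?thesis .
  qed
  have "((\<lambda>s. inner (x s) (x s)) has_vector_derivative 2 * inner (x s) (x' s)) (at s within {0..T})"
    if "s \<in> {0..T}" for s
    using bounded_bilinear.has_vector_derivative[OF bounded_bilinear_inner x'[OF that] x'[OF that]]
    by (simp add: inner_commute)
  then have d: "((\<lambda>s. (norm (x s))\<^sup>2) has_vector_derivative 2 * inner (x s) (x' s)) (at s within {0..T})"
    if "s \<in> {0..T}" for s
    using that by (simp add: power2_norm_eq_inner)
  have "(norm (x t))\<^sup>2 + \<delta>\<^sup>2 \<le> ((norm (x T))\<^sup>2 + \<delta>\<^sup>2) * exp ((2 * L + 1) * (T - t))"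
    by (rule gronwall_scalar[OF d * t])
  also have "\<dots> \<le> ((norm (x T))\<^sup>2 + \<delta>\<^sup>2) * exp ((2 * L + 1) * T)"
    using t L by (intro mult_left_mono) auto
  finally show ?thesis using zero_le_power2[of \<delta>] by linarith
qed

text \<open>
  The state of the Riccati system is a family of blocks whose number depends on \<open>N\<close>, hence no element
  of a fixed normed space; uniqueness for it needs a Gronwall estimate for finite families.
\<close>

lemma gronwall_family_zero:
  fixes u :: "'a \<Rightarrow> real \<Rightarrow> 'e::real_inner"
  assumes I: "finite I"
    and u': "\<And>a t. a \<in> I \<Longrightarrow> t \<in> {0..T} \<Longrightarrow> (u a has_vector_derivative u' a t) (at t within {0..T})"
    and le: "\<And>a t. a \<in> I \<Longrightarrow> t \<in> {0..T} \<Longrightarrow> norm (u' a t) \<le> L * (\<Sum>b\<in>I. norm (u b t))"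
    and L: "0 \<le> L" and uT: "\<And>a. a \<in> I \<Longrightarrow> u a T = 0" and t: "t \<in> {0..T}" and a: "a \<in> I"
  shows "u a t = 0"
proof -
  define v where "v s = (\<Sum>a\<in>I. inner (u a s) (u a s))" for s
  define w where "w s = (\<Sum>a\<in>I. 2 * inner (u a s) (u' a s))" for s
  have d: "(v has_vector_derivative w s) (at s within {0..T})" if "s \<in> {0..T}" for s
    unfolding v_def w_def
  proof (rule has_vector_derivative_sum)
    fix b assume "b \<in> I"
    then show "((\<lambda>s. inner (u b s) (u b s)) has_vector_derivative 2 * inner (u b s) (u' b s)) (at s within {0..T})"
      using bounded_bilinear.has_vector_derivative[OF bounded_bilinear_inner u'[OF _ that] u'[OF _ that], of b b]
      by (simp add: inner_commute)
  qed
  have *: "- w s \<le> (2 * L * real (card I)) * (v s + 0)" if s: "s \<in> {0..T}" for s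
  proof -
    let ?\<Sigma> = "\<Sum>b\<in>I. norm (u b s)"
    have "- w s = (\<Sum>b\<in>I. - (2 * inner (u b s) (u' b s)))" by (simp add: w_def sum_negf)
    also have "\<dots> \<le> (\<Sum>b\<in>I. 2 * (norm (u b s) * (L * ?\<Sigma>)))"
    proof (rule sum_mono)
      fix b assume b: "b \<in> I"
      have "- inner (u b s) (u' b s) \<le> norm (u b s) * norm (u' b s)"
        using norm_cauchy_schwarz[of "u b s" "- u' b s"] by simp
      also have "\<dots> \<le> norm (u b s) * (L * ?\<Sigma>)" using le[OF b s] by (intro mult_left_mono) auto
      finally show "- (2 * inner (u b s) (u' b s)) \<le> 2 * (norm (u b s) * (L * ?\<Sigma>))" by linarith
    qed
    also have "\<dots> = 2 * L * ?\<Sigma>\<^sup>2"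
      by (simp add: power2_eq_square sum_distrib_left[symmetric] sum_distrib_right[symmetric] algebra_simps)
    also have "?\<Sigma>\<^sup>2 \<le> real (card I) * (\<Sum>b\<in>I. (norm (u b s))\<^sup>2)"
      using sum_squared_le_sum_of_squares[of "\<lambda>b. norm (u b s)" I] I by (simp add: mult.commute)
    finally show ?thesis
      using L by (simp add: v_def power2_norm_eq_inner mult.assoc mult_left_mono)
  qed
  have "v t + 0 \<le> (v T + 0) * exp ((2 * L * real (card I)) * (T - t))"
    by (rule gronwall_scalar[OF d * t])
  also have "v T = 0" by (simp add: v_def uT)
  finally have "v t \<le> 0" by simp
  moreover have "inner (u a t) (u a t) \<le> v t"
    unfolding v_def using I a by (intro member_le_sum) auto
  ultimately have "inner (u a t) (u a t) \<le> 0" by linarith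
  then show ?thesis using inner_ge_zero[of "u a t"] by (metis inner_eq_zero_iff order_antisym)
qed


section \<open>Global solutions of Lipschitz terminal value problems\<close>

text \<open>
  Picard iteration with the weighted unknown \<open>w t = exp (- K * (T - t)) * x t\<close>. For
  \<open>K = 2 * (\<bar>L\<bar> + 1)\<close> the integral operator contracts by the factor \<open>1/2\<close> in the sup norm on all of
  \<open>[0, T]\<close>, so that one application of Banach's theorem suffices and no solutions have to be glued.
\<close>

lemma lipschitz_terminal_value_problem:
  fixes h :: "real \<Rightarrow> 'e::banach \<Rightarrow> 'e"
  assumes T: "0 \<le> T"
    and cont: "continuous_on ({0..T} \<times> UNIV) (\<lambda>p. h (fst p) (snd p))"
    and lip: "\<And>t x y. t \<in> {0..T} \<Longrightarrow> norm (h t x - h t y) \<le> L * norm (x - y)"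
  shows "\<exists>x. (\<forall>t\<in>{0..T}. (x has_vector_derivative h t (x t)) (at t within {0..T})) \<and> x T = c"
proof -
  define K where "K = 2 * (\<bar>L\<bar> + 1)"
  have K: "K > 0" by (simp add: K_def)
  define W :: "(real \<Rightarrow>\<^sub>C 'e) \<Rightarrow> real \<Rightarrow> 'e"
    where "W w s = h s (exp (K * (T - s)) *\<^sub>R w s)" for w s
  define \<Psi> where "\<Psi> w t = exp (- K * (T - t)) *\<^sub>R (c - (integral {0..T} (W w) - integral {0..t} (W w)))"
    for w t
  have contW: "continuous_on {0..T} (W w)" for w
    unfolding W_def
    by (rule continuous_on_compose2[OF cont, of _ "\<lambda>s. (s, exp (K * (T - s)) *\<^sub>R w s)", simplified])
      (intro continuous_intros, auto)
  have derI: "((\<lambda>t. integral {0..t} (W w)) has_vector_derivative W w t) (at t within {0..T})"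
    if "t \<in> {0..T}" for w t
    using contW that by (rule integral_has_vector_derivative)
  have cont\<Psi>: "continuous_on (cbox 0 T) (\<Psi> w)" for w
    unfolding \<Psi>_def using continuous_on_vector_derivative[OF derI]
    by (intro continuous_intros) auto
  \<comment> \<open>Bounded continuous functions live on the whole line, so values outside \<open>[0, T]\<close> are clamped.\<close>
  have "\<exists>g :: real \<Rightarrow>\<^sub>C 'e. \<forall>t. g t = \<Psi> w (clamp 0 T t)" for w
    using continuous_on_cbox_bcontfunE[OF cont\<Psi>] by metis
  then obtain F :: "(real \<Rightarrow>\<^sub>C 'e) \<Rightarrow> (real \<Rightarrow>\<^sub>C 'e)" where F: "\<And>w t. F w t = \<Psi> w (clamp 0 T t)"
    by metis
  have est: "norm (\<Psi> w t - \<Psi> w' t) \<le> 1/2 * dist w w'" if t: "t \<in> {0..T}" for w w' t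
  proof -
    have sub: "{t..T} \<subseteq> {0..T}" using t by auto
    have int: "W u integrable_on {0..T}" "W u integrable_on {t..T}" for u
      using contW continuous_on_subset[OF contW sub] by (auto intro: integrable_continuous_real)
    have split: "integral {0..T} (W u) - integral {0..t} (W u) = integral {t..T} (W u)" for u
      using Henstock_Kurzweil_Integration.integral_combine[of 0 t T "W u"] int(1) t by (auto simp: algebra_simps)
    define E where "E s = (\<bar>L\<bar> + 1) * dist w w' * exp (K * (T - s))" for s
    define e where "e s = - (1/2 * dist w w' * exp (K * (T - s)))" for s
    have hasE: "(E has_integral (e T - e t)) {t..T}"
    proof (rule fundamental_theorem_of_calculus)
      show "t \<le> T" using t by simp
      fix s
      have "(e has_field_derivative E s) (at s within {t..T})"
        unfolding e_def E_def K_def by (auto intro!: derivative_eq_intros simp: field_simps)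
      then show "(e has_vector_derivative E s) (at s within {t..T})"
        by (simp add: has_real_derivative_iff_has_vector_derivative)
    qed
    have pt: "norm (W w' s - W w s) \<le> E s" if s: "s \<in> {t..T}" for s
    proof -
      have "norm (W w' s - W w s)
          \<le> L * norm (exp (K * (T - s)) *\<^sub>R w' s - exp (K * (T - s)) *\<^sub>R w s)"
        unfolding W_def using s t by (intro lip) auto
      also have "\<dots> = L * (exp (K * (T - s)) * dist (w s) (w' s))"
        by (simp add: scaleR_diff_right[symmetric] dist_norm norm_minus_commute)
      also have "\<dots> \<le> (\<bar>L\<bar> + 1) * (exp (K * (T - s)) * dist w w')"
        by (intro mult_mono) (auto intro: dist_bounded)
      finally show ?thesis by (simp add: E_def algebra_simps)
    qed
    have "norm (integral {t..T} (\<lambda>s. W w' s - W w s)) \<le> integral {t..T} E"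
      using int hasE pt by (intro integral_norm_bound_integral integrable_diff) auto
    also have "\<dots> = e T - e t" using hasE by (rule integral_unique)
    also have "\<dots> \<le> 1/2 * dist w w' * exp (K * (T - t))" by (simp add: e_def)
    finally have *: "norm (integral {t..T} (\<lambda>s. W w' s - W w s)) \<le> 1/2 * dist w w' * exp (K * (T - t))" .
    have "\<Psi> w t - \<Psi> w' t = exp (- K * (T - t)) *\<^sub>R integral {t..T} (\<lambda>s. W w' s - W w s)"
      unfolding \<Psi>_def split using int
      by (simp add: scaleR_diff_right[symmetric] Henstock_Kurzweil_Integration.integral_diff)
    then have "norm (\<Psi> w t - \<Psi> w' t) \<le> exp (- K * (T - t)) * (1/2 * dist w w' * exp (K * (T - t)))"
      using * by simp
    also have "\<dots> = 1/2 * dist w w'"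
      by (simp add: exp_minus)
    finally show ?thesis .
  qed
  have "dist (F w) (F w') \<le> 1/2 * dist w w'" for w w'
  proof (rule dist_bound)
    fix t
    have "clamp 0 T t \<in> {0..T}"
      using clamp_in_interval[of 0 T t] T by simp
    then show "dist (F w t) (F w' t) \<le> 1/2 * dist w w'"
      unfolding F dist_norm by (rule est[unfolded dist_norm])
  qed
  then obtain w where w: "F w = w"
    using banach_fix_type[of "1/2" F] by auto
  define x where "x t = c - (integral {0..T} (W w) - integral {0..t} (W w))" for t
  have wx: "exp (K * (T - t)) *\<^sub>R w t = x t" if t: "t \<in> {0..T}" for t
  proof -
    have "w t = \<Psi> w t" using F[of w t] w t by (simp add: clamp_cancel_cbox)
    then show ?thesis unfolding \<Psi>_def x_def by (simp add: exp_minus)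
  qed
  have "(x has_vector_derivative h t (x t)) (at t within {0..T})" if t: "t \<in> {0..T}" for t
  proof -
    have "(x has_vector_derivative 0 - (0 - W w t)) (at t within {0..T})"
      unfolding x_def by (intro has_vector_derivative_diff has_vector_derivative_const derI t)
    then show ?thesis using wx[OF t] by (simp add: W_def)
  qed
  moreover have "x T = c" by (simp add: x_def)
  ultimately show ?thesis by blast
qed

text \<open>
  The linear parts are bounded on \<open>[0, T]\<close> times the unit ball by compactness, and by homogeneity such
  a bound is a Lipschitz constant on the whole space.
\<close>

lemma affine_terminal_value_problem:
  fixes h :: "real \<Rightarrow> 'e::euclidean_space \<Rightarrow> 'e"
  assumes T: "0 \<le> T"
    and cont: "continuous_on ({0..T} \<times> UNIV) (\<lambda>p. h (fst p) (snd p))"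
    and lin: "\<And>t. t \<in> {0..T} \<Longrightarrow> linear (\<lambda>x. h t x - h t 0)"
  shows "\<exists>x. (\<forall>t\<in>{0..T}. (x has_vector_derivative h t (x t)) (at t within {0..T})) \<and> x T = c"
proof -
  let ?g = "\<lambda>p. h (fst p) (snd p) - h (fst p) 0"
  have "continuous_on ({0..T} \<times> cball 0 1) ?g"
    by (intro continuous_on_diff continuous_on_subset[OF cont]
        continuous_on_compose2[OF cont, of _ "\<lambda>p. (fst p, 0)", simplified] continuous_intros) auto
  then have "bounded (?g ` ({0..T} \<times> cball 0 1))"
    by (intro compact_imp_bounded compact_continuous_image compact_Times compact_Icc compact_cball)
  then obtain L where "\<forall>y \<in> ?g ` ({0..T} \<times> cball 0 1). norm y \<le> L"
    unfolding bounded_iff by (elim exE)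
  then have L: "norm (h t x - h t 0) \<le> L" if "t \<in> {0..T}" "norm x \<le> 1" for t x
    using that by force
  have "norm (h t x - h t y) \<le> L * norm (x - y)" if t: "t \<in> {0..T}" for t x y
  proof (cases "x = y")
    case False
    let ?l = "\<lambda>x. h t x - h t 0"
    have "norm (x - y) *\<^sub>R ?l ((1 / norm (x - y)) *\<^sub>R (x - y)) = ?l (norm (x - y) *\<^sub>R ((1 / norm (x - y)) *\<^sub>R (x - y)))"
      by (rule linear_scale[OF lin[OF t], symmetric])
    also have "\<dots> = ?l (x - y)" using False by simp
    also have "\<dots> = ?l x - ?l y" by (rule linear_diff[OF lin[OF t]])
    finally have "h t x - h t y = norm (x - y) *\<^sub>R ?l ((1 / norm (x - y)) *\<^sub>R (x - y))" by simp
    then have "norm (h t x - h t y) = norm (x - y) * norm (?l ((1 / norm (x - y)) *\<^sub>R (x - y)))"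
      by (simp only: norm_scaleR abs_norm_cancel)
    also have "\<dots> \<le> norm (x - y) * L"
      using False by (intro mult_left_mono L t) auto
    finally show ?thesis by (simp add: mult.commute)
  qed simp
  then show ?thesis by (rule lipschitz_terminal_value_problem[OF T cont])
qed

section \<open>The Riccati equation block by block\<close>

lemma bmult_assoc: "X \<odot>\<^bsub>p\<^esub> (Y \<odot>\<^bsub>q\<^esub> Z) = X \<odot>\<^bsub>p\<^esub> Y \<odot>\<^bsub>q\<^esub> Z"
  unfolding bmult_def
  by (intro ext, simp add: mm.sum_left mm.sum_right matrix_mul_assoc) (rule sum.swap)

lemma sum_barray_apply: "(\<Sum>k\<in>I. f k :: ('a::finite, 'b::finite) barray) j l = (\<Sum>k\<in>I. f k j l)"
  by (induction I rule: infinite_finite_induct) auto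

lemma bmult_1: "(X \<odot>\<^bsub>1\<^esub> Y) j l = X j 1 ** Y 1 l"
  by (simp add: bmult_def)

lemma bmult_sum_right: "(X \<odot>\<^bsub>p\<^esub> (\<Sum>k\<in>I. Y k)) j l = (\<Sum>k\<in>I. (X \<odot>\<^bsub>p\<^esub> Y k) j l)"
  by (simp add: bmult_def sum_barray_apply mm.sum_right) (rule sum.swap)

lemma bmult_sum_left: "((\<Sum>k\<in>I. Y k) \<odot>\<^bsub>p\<^esub> X) j l = (\<Sum>k\<in>I. (Y k \<odot>\<^bsub>p\<^esub> X) j l)"
  by (simp add: bmult_def sum_barray_apply mm.sum_left) (rule sum.swap)

lemma transpose_basis_col_bmult:
  assumes "k \<in> {1..N}"
  shows "(btranspose (kron (basis_col k) S) \<odot>\<^bsub>N\<^esub> X) j l = transpose S ** X k l"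
proof -
  have "(btranspose (kron (basis_col k) S) \<odot>\<^bsub>N\<^esub> X) j l
      = (\<Sum>h\<in>{1..N}. if h = k then transpose S ** X k l else 0)"
    unfolding bmult_def btranspose_def kron_def basis_col_def
    by (intro sum.cong refl) (auto simp: transpose_simps mm_linear)
  also have "\<dots> = transpose S ** X k l" using assms by simp
  finally show ?thesis .
qed

lemma bmult_basis_col_bmult:
  assumes "k \<in> {1..N}"
  shows "(X \<odot>\<^bsub>N\<^esub> (kron (basis_col k) S \<odot>\<^bsub>1\<^esub> Y)) j l = X j k ** S ** Y 1 l"
proof -
  have "(X \<odot>\<^bsub>N\<^esub> (kron (basis_col k) S \<odot>\<^bsub>1\<^esub> Y)) j l
      = (\<Sum>h\<in>{1..N}. if h = k then X j k ** S ** Y 1 l else 0)"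
    unfolding bmult_def[of X] bmult_1 kron_def basis_col_def
    by (intro sum.cong refl) (auto simp: mm_linear matrix_mul_assoc)
  also have "\<dots> = X j k ** S ** Y 1 l" using assms by simp
  finally show ?thesis .
qed

lemma bmult_basis_col:
  assumes "k \<in> {1..N}"
  shows "(X \<odot>\<^bsub>N\<^esub> kron (basis_col k) S) j l = X j k ** S"
proof -
  have "(X \<odot>\<^bsub>N\<^esub> kron (basis_col k) S) j l = (\<Sum>h\<in>{1..N}. if h = k then X j k ** S else 0)"
    unfolding bmult_def kron_def basis_col_def
    by (intro sum.cong refl) (auto simp: mm_linear)
  also have "\<dots> = X j k ** S" using assms by simp
  finally show ?thesis .
qed

text \<open>
  In the notation of the informal system, at a fixed time: \<open>Sig N P k\<close> is \<open>\<^bold>B\<^sub>0\<^sup>T \<^bold>P\<^sub>k \<^bold>B\<^sub>0\<close>,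
  \<open>Wgt N P k\<close> is \<open>R\<^sub>k\<close> with inverse \<open>Hk N P k\<close>, \<open>Cpl N P\<close> is the matrix of condition (iii),
  \<open>Mean N P\<close> is \<open>\<^bold>M\<^sub>0\<close> and \<open>Resp N P k\<close> is \<open>\<^bold>L\<^sub>k\<close>.
\<close>

locale lq_game =
  fixes T :: real
    and A G \<Gamma> \<Gamma>\<^sub>f :: "real^'n^'n"
    and B B\<^sub>0 B\<^sub>1 :: "real^'m^'n"
    and Q Q\<^sub>f :: "real^'n^'n"
    and R :: "real^'m^'m"
  assumes T_pos: "0 < T"
    and Q_sym: "transpose Q = Q" and Qf_sym: "transpose Q\<^sub>f = Q\<^sub>f" and R_sym: "transpose R = R"
begin

abbreviation "Sig \<equiv> S0 B\<^sub>0"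
abbreviation "Wgt \<equiv> Rk B\<^sub>1 R"
abbreviation "Hk \<equiv> Rk_inv B\<^sub>1 R"
abbreviation "Cpl \<equiv> coupling_mat B\<^sub>0 B\<^sub>1 R"
abbreviation "Mean \<equiv> M0 B B\<^sub>0 B\<^sub>1 R"
abbreviation "Resp \<equiv> Lk B B\<^sub>0 B\<^sub>1 R"
abbreviation "rhs \<equiv> riccati_rhs A G \<Gamma> B B\<^sub>0 B\<^sub>1 Q R"
abbreviation "solves \<equiv> riccati_solution T A G \<Gamma> \<Gamma>\<^sub>f B B\<^sub>0 B\<^sub>1 Q Q\<^sub>f R"
abbreviation "Qc \<equiv> bigQ \<Gamma> Q"
abbreviation "Qfc \<equiv> bigQf \<Gamma>\<^sub>f Q\<^sub>f"

abbreviation "right_sum N P i j l \<equiv>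
  (\<Sum>k\<in>{1..N} - {i}. P i j k ** B ** Hk N P k ** Resp N P k 1 l)"
abbreviation "left_sum N P i j l \<equiv>
  (\<Sum>k\<in>{1..N} - {i}. transpose (Resp N P k 1 j) ** Hk N P k ** transpose B ** P i k l)"
abbreviation "noise_sum N P i j l \<equiv>
  (\<Sum>k\<in>{1..N} - {i}. transpose (Resp N P k 1 j) ** Hk N P k ** transpose B\<^sub>1 ** P i k k ** B\<^sub>1
    ** Hk N P k ** Resp N P k 1 l)"

lemma S0_bmult:
  "(btranspose (bigB0 B\<^sub>0 N) \<odot>\<^bsub>N\<^esub> (X \<odot>\<^bsub>N\<^esub> bigB0 B\<^sub>0 N)) j l
    = (1 / (real N)\<^sup>2) *\<^sub>R (transpose B\<^sub>0 ** (\<Sum>h\<in>{1..N}. \<Sum>k\<in>{1..N}. X h k) ** B\<^sub>0)"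
  by (simp add: bmult_def btranspose_def bigB0_def kron_def all_ones_def transpose_simps mm_linear
      mm.sum_left mm.sum_right scaleR_sum_right[symmetric] matrix_mul_assoc power2_eq_square)

lemma S0_eq:
  "Sig N P k = (1 / (real N)\<^sup>2) *\<^sub>R (transpose B\<^sub>0 ** (\<Sum>h\<in>{1..N}. \<Sum>l\<in>{1..N}. P k h l) ** B\<^sub>0)"
  unfolding S0_def by (simp only: bmult_assoc[symmetric] S0_bmult)

lemma Rk_eq: "k \<in> {1..N} \<Longrightarrow> Wgt N P k = R + transpose B\<^sub>1 ** P k k k ** B\<^sub>1"
  unfolding Rk_def bigB_def
  by (simp only: bmult_assoc[symmetric] transpose_basis_col_bmult bmult_basis_col matrix_mul_assoc)

lemma M0_eq:
  "Mean N P j l = - (matrix_inv (Cpl N P) ** (\<Sum>k\<in>{1..N}. Hk N P k ** transpose B ** P k k l))"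
  unfolding M0_def bigBhat_def
  by (simp only: bmult_assoc[symmetric] bmult_1 single_def fun_Compl_def sum_barray_apply uminus_apply)
    (simp add: bmult_assoc[symmetric] bmult_1 transpose_basis_col_bmult matrix_mul_assoc)

lemma bigB0_Pbmult:
  "(btranspose (bigB0 B\<^sub>0 N) \<odot>\<^bsub>N\<^esub> (P k \<odot>\<^bsub>N\<^esub> (bigB0 B\<^sub>0 N \<odot>\<^bsub>1\<^esub> X))) j l = Sig N P k ** X 1 l"
proof -
  have "btranspose (bigB0 B\<^sub>0 N) \<odot>\<^bsub>N\<^esub> (P k \<odot>\<^bsub>N\<^esub> (bigB0 B\<^sub>0 N \<odot>\<^bsub>1\<^esub> X))
      = (btranspose (bigB0 B\<^sub>0 N) \<odot>\<^bsub>N\<^esub> (P k \<odot>\<^bsub>N\<^esub> bigB0 B\<^sub>0 N)) \<odot>\<^bsub>1\<^esub> X"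
    by (simp only: bmult_assoc)
  then show ?thesis by (simp only: bmult_1 S0_bmult S0_eq)
qed

lemma Lk_eq:
  assumes "k \<in> {1..N}"
  shows "Resp N P k j l = Sig N P k ** Mean N P 1 l + transpose B ** P k k l"
  unfolding Lk_def plus_fun_apply bmult_assoc[symmetric] bigB0_Pbmult
  unfolding bigBhat_def transpose_basis_col_bmult[OF assms] ..

lemma bigA_bmult:
  assumes "j \<in> {1..N}" "l \<in> {1..N}"
  shows "(X \<odot>\<^bsub>N\<^esub> bigA A G N) j l = X j l ** A + (1 / real N) *\<^sub>R ((\<Sum>k\<in>{1..N}. X j k) ** G)"
    and "(btranspose (bigA A G N) \<odot>\<^bsub>N\<^esub> X) j l
      = transpose A ** X j l + (1 / real N) *\<^sub>R (transpose G ** (\<Sum>k\<in>{1..N}. X k l))"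
proof -
  have "(X \<odot>\<^bsub>N\<^esub> bigA A G N) j l
      = (\<Sum>k\<in>{1..N}. (if k = l then X j l ** A else 0) + (1 / real N) *\<^sub>R (X j k ** G))"
    unfolding bmult_def bigA_def bdiag_def kron_def all_ones_def
    by (intro sum.cong refl) (auto simp: mm_linear)
  then show "(X \<odot>\<^bsub>N\<^esub> bigA A G N) j l = X j l ** A + (1 / real N) *\<^sub>R ((\<Sum>k\<in>{1..N}. X j k) ** G)"
    using assms by (simp add: sum.distrib scaleR_sum_right mm.sum_left)
  have "(btranspose (bigA A G N) \<odot>\<^bsub>N\<^esub> X) j l
      = (\<Sum>k\<in>{1..N}. (if k = j then transpose A ** X j l else 0) + (1 / real N) *\<^sub>R (transpose G ** X k l))"
    unfolding bmult_def btranspose_def bigA_def bdiag_def kron_def all_ones_def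
    by (intro sum.cong refl) (auto simp: mm_linear transpose_simps)
  then show "(btranspose (bigA A G N) \<odot>\<^bsub>N\<^esub> X) j l
      = transpose A ** X j l + (1 / real N) *\<^sub>R (transpose G ** (\<Sum>k\<in>{1..N}. X k l))"
    using assms by (simp add: sum.distrib scaleR_sum_right mm.sum_right)
qed

lemma bigQ_eq: "Qc N i j l = transpose ((if j = i then mat 1 else 0) - (1 / real N) *\<^sub>R \<Gamma>) ** Q
    ** ((if l = i then mat 1 else 0) - (1 / real N) *\<^sub>R \<Gamma>)"
  by (simp only: bigQ_def bmult_1 btranspose_def single_def bigK_def kron_def all_ones_def minus_apply scaleR_one)

lemma bigQf_eq: "Qfc N i j l = transpose ((if j = i then mat 1 else 0) - (1 / real N) *\<^sub>R \<Gamma>\<^sub>f) ** Q\<^sub>f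
    ** ((if l = i then mat 1 else 0) - (1 / real N) *\<^sub>R \<Gamma>\<^sub>f)"
  by (simp only: bigQf_def bmult_1 btranspose_def single_def bigKf_def kron_def all_ones_def minus_apply scaleR_one)

text \<open>
  Multiplying by \<open>\<^bold>B\<^sub>k\<close> or its variant with \<open>B\<close> selects one block, and multiplying by \<open>\<^bold>B\<^sub>0\<close> or by the
  \<open>G\<close>-part of \<open>\<^bold>A\<close> adds up all blocks. Everything that follows about the Riccati equation uses only
  this formula: it shows the equivariance under permutations of the indices, and it can be evaluated
  on block matrices with few distinct blocks.
\<close>

lemma riccati_rhs_eq:
  assumes i: "i \<in> {1..N}" and j: "j \<in> {1..N}" and l: "l \<in> {1..N}"
  shows "rhs N P i j l =
      P i j l ** A + (1 / real N) *\<^sub>R ((\<Sum>k\<in>{1..N}. P i j k) ** G)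
    + (transpose A ** P i j l + (1 / real N) *\<^sub>R (transpose G ** (\<Sum>k\<in>{1..N}. P i k l)))
    + Qc N i j l
    - P i j i ** B ** Hk N P i ** transpose B ** P i i l
    + transpose (Mean N P 1 j) ** Sig N P i ** Hk N P i ** Sig N P i ** Mean N P 1 l
    - right_sum N P i j l
    - left_sum N P i j l
    + noise_sum N P i j l
    + transpose (Mean N P 1 j) ** Sig N P i ** Mean N P 1 l"
proof -
  have t4: "(P i \<odot>\<^bsub>N\<^esub> bigBhat B i \<odot>\<^bsub>1\<^esub> single (Hk N P i) \<odot>\<^bsub>1\<^esub> btranspose (bigBhat B i) \<odot>\<^bsub>N\<^esub> P i) j l
      = P i j i ** B ** Hk N P i ** transpose B ** P i i l"
    unfolding bigBhat_def
    by (simp only: bmult_assoc[symmetric] bmult_basis_col_bmult[OF i] bmult_1 single_def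
        transpose_basis_col_bmult[OF i] matrix_mul_assoc)
  have t5: "(btranspose (Mean N P) \<odot>\<^bsub>1\<^esub> btranspose (bigB0 B\<^sub>0 N) \<odot>\<^bsub>N\<^esub> P i \<odot>\<^bsub>N\<^esub> bigB0 B\<^sub>0 N
        \<odot>\<^bsub>1\<^esub> single (Hk N P i) \<odot>\<^bsub>1\<^esub> btranspose (bigB0 B\<^sub>0 N) \<odot>\<^bsub>N\<^esub> P i \<odot>\<^bsub>N\<^esub> bigB0 B\<^sub>0 N \<odot>\<^bsub>1\<^esub> Mean N P) j l
      = transpose (Mean N P 1 j) ** Sig N P i ** Hk N P i ** Sig N P i ** Mean N P 1 l"
    unfolding bmult_assoc[symmetric]
    unfolding bmult_1 bigB0_Pbmult btranspose_def[of "Mean N P"] single_def matrix_mul_assoc ..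
  have t9: "(btranspose (Mean N P) \<odot>\<^bsub>1\<^esub> btranspose (bigB0 B\<^sub>0 N) \<odot>\<^bsub>N\<^esub> P i \<odot>\<^bsub>N\<^esub> bigB0 B\<^sub>0 N \<odot>\<^bsub>1\<^esub> Mean N P) j l
      = transpose (Mean N P 1 j) ** Sig N P i ** Mean N P 1 l"
    unfolding bmult_assoc[symmetric]
    unfolding bmult_1 bigB0_Pbmult btranspose_def[of "Mean N P"] matrix_mul_assoc ..
  have t6: "(P i \<odot>\<^bsub>N\<^esub> (\<Sum>k\<in>{1..N} - {i}. bigBhat B k \<odot>\<^bsub>1\<^esub> single (Hk N P k) \<odot>\<^bsub>1\<^esub> Resp N P k)) j l
      = right_sum N P i j l"
    unfolding bmult_sum_right
    by (intro sum.cong refl)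
      (simp only: bigBhat_def bmult_assoc[symmetric] bmult_basis_col_bmult bmult_1 single_def
        matrix_mul_assoc Diff_iff)
  have t7: "((\<Sum>k\<in>{1..N} - {i}. btranspose (Resp N P k) \<odot>\<^bsub>1\<^esub> single (Hk N P k) \<odot>\<^bsub>1\<^esub> btranspose (bigBhat B k))
        \<odot>\<^bsub>N\<^esub> P i) j l
      = left_sum N P i j l"
    unfolding bmult_sum_left
    by (intro sum.cong refl)
      (simp only: bigBhat_def bmult_assoc[symmetric] transpose_basis_col_bmult bmult_1 single_def
        matrix_mul_assoc Diff_iff btranspose_def[of "Resp N P k" for k])
  have t8: "(\<Sum>k\<in>{1..N} - {i}. btranspose (Resp N P k) \<odot>\<^bsub>1\<^esub> single (Hk N P k) \<odot>\<^bsub>1\<^esub> btranspose (bigB B\<^sub>1 k)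
        \<odot>\<^bsub>N\<^esub> P i \<odot>\<^bsub>N\<^esub> bigB B\<^sub>1 k \<odot>\<^bsub>1\<^esub> single (Hk N P k) \<odot>\<^bsub>1\<^esub> Resp N P k) j l
      = noise_sum N P i j l"
    unfolding sum_barray_apply
    by (intro sum.cong refl)
      (simp only: bigB_def bmult_assoc[symmetric] transpose_basis_col_bmult bmult_basis_col_bmult
        bmult_1 single_def matrix_mul_assoc Diff_iff btranspose_def[of "Resp N P k" for k])
  show ?thesis
    unfolding riccati_rhs_def plus_fun_apply minus_apply t4 t5 t6 t7 t8 t9 bigA_bmult[OF j l] ..
qed

end

section \<open>The reduced system\<close>

text \<open>
  The form that symmetry, and invariance under the permutations of the players that fix \<open>i\<close>, impose on \<open>\<^bold>P\<^sub>i\<close>.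
\<close>

definition exchangeable ::
    "real^'n^'n \<Rightarrow> real^'n^'n \<Rightarrow> real^'n^'n \<Rightarrow> real^'n^'n \<Rightarrow> nat \<Rightarrow> ('n::finite, 'n) barray"
  where "exchangeable p1 p2 p3 p4 i = (\<lambda>j l.
    if j = i then (if l = i then p1 else p2)
    else if l = i then transpose p2 else if j = l then p3 else p4)"

lemma sum_one_exception:
  fixes f :: "'k \<Rightarrow> 'v::real_vector"
  assumes "finite I" "a \<in> I" "\<And>k. k \<in> I - {a} \<Longrightarrow> f k = c"
  shows "sum f I = f a + (real (card I) - 1) *\<^sub>R c"
proof -
  have "sum f I = f a + sum f (I - {a})" using assms by (intro sum.remove) auto
  also have "sum f (I - {a}) = (\<Sum>k\<in>I - {a}. c)" using assms by (intro sum.cong) auto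
  also have "\<dots> = real (card I - 1) *\<^sub>R c"
    using assms by (simp add: sum_constant_scaleR)
  also have "real (card I - 1) = real (card I) - 1"
    using assms card_gt_0_iff[of I] by (auto simp: of_nat_diff)
  finally show ?thesis .
qed

lemma sum_two_exceptions:
  fixes f :: "'k \<Rightarrow> 'v::real_vector"
  assumes "finite I" "a \<in> I" "b \<in> I" "a \<noteq> b" "\<And>k. k \<in> I - {a, b} \<Longrightarrow> f k = c"
  shows "sum f I = f a + f b + (real (card I) - 2) *\<^sub>R c"
proof -
  have "card I \<ge> 1" using assms card_gt_0_iff[of I] by (auto simp: Suc_le_eq)
  moreover have "sum f I = f a + sum f (I - {a})" using assms by (intro sum.remove) auto
  moreover have "sum f (I - {a}) = f b + (real (card (I - {a})) - 1) *\<^sub>R c"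
    using assms by (intro sum_one_exception) auto
  ultimately show ?thesis using assms by (simp add: of_nat_diff add.assoc)
qed

context lq_game
begin

text \<open>
  In the following, \<open>e\<close> stands for \<open>1/N\<close> and \<open>x1, x2, x3, x4\<close> for the rescaled blocks
  \<open>\<Pi>\<^sub>1, N \<Pi>\<^sub>2, N\<^sup>2 \<Pi>\<^sub>3, N\<^sup>2 \<Pi>\<^sub>4\<close>. The definitions also make sense for \<open>e = 0\<close>. In terms of the Riccati system,
  \<open>own_row\<close> is the sum of the blocks in row \<open>i\<close> of \<open>\<^bold>P\<^sub>i\<close> and \<open>e *\<^sub>R other_row\<close> that in any other row; also
  \<open>\<^bold>B\<^sub>0\<^sup>T \<^bold>P\<^sub>k \<^bold>B\<^sub>0 = e\<^sup>2 *\<^sub>R noise0\<close>; every block of \<open>\<^bold>M\<^sub>0\<close> is \<open>mean_fb\<close>; block \<open>l\<close> of \<open>\<^bold>L\<^sub>k\<close> is \<open>resp1\<close> if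
  \<open>k = l\<close> and \<open>e *\<^sub>R resp2\<close> otherwise; and \<open>e\<^sup>2 *\<^sub>R noise1\<close> is the matrix between \<open>\<^bold>L\<^sub>k\<^sup>T\<close> and \<open>\<^bold>L\<^sub>k\<close> in the
  last sum over \<open>k \<noteq> i\<close>.
\<close>

definition wgt :: "real^'n^'n \<Rightarrow> real^'m^'m"
  where "wgt x1 = R + transpose B\<^sub>1 ** x1 ** B\<^sub>1"

definition gain :: "real^'n^'n \<Rightarrow> real^'m^'m"
  where "gain x1 = matrix_inv (wgt x1)"

context
  fixes e :: real and x1 x2 x3 x4 :: "real^'n^'n"
begin

definition own_row :: "real^'n^'n"
  where "own_row = x1 + (1 - e) *\<^sub>R x2"

definition other_row :: "real^'n^'n"
  where "other_row = transpose x2 + e *\<^sub>R x3 + (1 - 2 * e) *\<^sub>R x4"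

definition noise0 :: "real^'m^'m"
  where "noise0 = transpose B\<^sub>0 ** (own_row + (1 - e) *\<^sub>R other_row) ** B\<^sub>0"

definition cpl :: "real^'m^'m"
  where "cpl = mat 1 + e *\<^sub>R (gain x1 ** noise0)"

definition mean_fb :: "real^'n^'m"
  where "mean_fb = - (matrix_inv cpl ** (gain x1 ** transpose B ** own_row))"

definition resp1 :: "real^'n^'m"
  where "resp1 = e\<^sup>2 *\<^sub>R (noise0 ** mean_fb) + transpose B ** x1"

definition resp2 :: "real^'n^'m"
  where "resp2 = e *\<^sub>R (noise0 ** mean_fb) + transpose B ** x2"

definition noise1 :: "real^'m^'m"
  where "noise1 = gain x1 ** transpose B\<^sub>1 ** x3 ** B\<^sub>1 ** gain x1"

definition mean_cost :: "real^'n^'n"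
  where "mean_cost = transpose mean_fb ** noise0 ** mean_fb"

definition mean_cost' :: "real^'n^'n"
  where "mean_cost' = transpose mean_fb ** noise0 ** gain x1 ** noise0 ** mean_fb"

text \<open>
  \<open>F1\<close>, \<open>e *\<^sub>R F2\<close>, \<open>e\<^sup>2 *\<^sub>R F3\<close> and \<open>e\<^sup>2 *\<^sub>R F4\<close> are the blocks \<open>(1,1)\<close>, \<open>(1,2)\<close>, \<open>(2,2)\<close> and \<open>(2,3)\<close> of the
  right-hand side for \<open>\<^bold>P\<^sub>1\<close>, with the summands in the order of the Riccati equation. Dividing out
  these powers of \<open>e\<close> leaves no negative power, which is the reason for the scaling.
\<close>

definition F1 :: "real^'n^'n"
  where "F1 =
      x1 ** A + e *\<^sub>R (own_row ** G) + (transpose A ** x1 + e *\<^sub>R (transpose G ** transpose own_row))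
    + transpose (mat 1 - e *\<^sub>R \<Gamma>) ** Q ** (mat 1 - e *\<^sub>R \<Gamma>)
    - x1 ** B ** gain x1 ** transpose B ** x1
    + e ^ 4 *\<^sub>R mean_cost'
    - (e * (1 - e)) *\<^sub>R (x2 ** B ** gain x1 ** resp2)
    - (e * (1 - e)) *\<^sub>R (transpose resp2 ** gain x1 ** transpose B ** transpose x2)
    + (e ^ 3 * (1 - e)) *\<^sub>R (transpose resp2 ** noise1 ** resp2)
    + e\<^sup>2 *\<^sub>R mean_cost"

definition F2 :: "real^'n^'n"
  where "F2 =
      x2 ** A + own_row ** G + (transpose A ** x2 + e *\<^sub>R (transpose G ** transpose other_row))
    + - (transpose (mat 1 - e *\<^sub>R \<Gamma>) ** Q ** \<Gamma>)
    - x1 ** B ** gain x1 ** transpose B ** x2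
    + e ^ 3 *\<^sub>R mean_cost'
    - x2 ** B ** gain x1 ** (resp1 + (1 - 2 * e) *\<^sub>R resp2)
    - e *\<^sub>R (transpose resp2 ** gain x1 ** transpose B ** (e *\<^sub>R x3 + (1 - 2 * e) *\<^sub>R x4))
    + e\<^sup>2 *\<^sub>R (transpose resp2 ** noise1 ** (resp1 + (1 - 2 * e) *\<^sub>R resp2))
    + e *\<^sub>R mean_cost"

definition F3 :: "real^'n^'n"
  where "F3 =
      x3 ** A + other_row ** G + (transpose A ** x3 + transpose G ** transpose other_row)
    + transpose \<Gamma> ** Q ** \<Gamma>
    - transpose x2 ** B ** gain x1 ** transpose B ** x2
    + e\<^sup>2 *\<^sub>R mean_cost'
    - (x3 ** B ** gain x1 ** resp1 + (1 - 2 * e) *\<^sub>R (x4 ** B ** gain x1 ** resp2))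
    - (transpose resp1 ** gain x1 ** transpose B ** x3
        + (1 - 2 * e) *\<^sub>R (transpose resp2 ** gain x1 ** transpose B ** x4))
    + (transpose resp1 ** noise1 ** resp1
        + (e * (1 - 2 * e)) *\<^sub>R (transpose resp2 ** noise1 ** resp2))
    + mean_cost"

definition F4 :: "real^'n^'n"
  where "F4 =
      x4 ** A + other_row ** G + (transpose A ** x4 + transpose G ** transpose other_row)
    + transpose \<Gamma> ** Q ** \<Gamma>
    - transpose x2 ** B ** gain x1 ** transpose B ** x2
    + e\<^sup>2 *\<^sub>R mean_cost'
    - (e *\<^sub>R (x3 ** B ** gain x1 ** resp2) + x4 ** B ** gain x1 ** resp1
        + (1 - 3 * e) *\<^sub>R (x4 ** B ** gain x1 ** resp2))
    - (transpose resp1 ** gain x1 ** transpose B ** x4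
        + e *\<^sub>R (transpose resp2 ** gain x1 ** transpose B ** x3)
        + (1 - 3 * e) *\<^sub>R (transpose resp2 ** gain x1 ** transpose B ** x4))
    + (e *\<^sub>R (transpose resp1 ** noise1 ** resp2)
        + e *\<^sub>R (transpose resp2 ** noise1 ** resp1)
        + (e * (1 - 3 * e)) *\<^sub>R (transpose resp2 ** noise1 ** resp2))
    + mean_cost"

definition lift :: "nat \<Rightarrow> ('n, 'n) barray"
  where "lift = exchangeable x1 (e *\<^sub>R x2) (e\<^sup>2 *\<^sub>R x3) (e\<^sup>2 *\<^sub>R x4)"

lemma lift_blocks:
  "lift i i i = x1" "l \<noteq> i \<Longrightarrow> lift i i l = e *\<^sub>R x2" "l \<noteq> i \<Longrightarrow> lift i l i = e *\<^sub>R transpose x2"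
  "l \<noteq> i \<Longrightarrow> lift i l l = e\<^sup>2 *\<^sub>R x3"
  "j \<noteq> i \<Longrightarrow> l \<noteq> i \<Longrightarrow> j \<noteq> l \<Longrightarrow> lift i j l = e\<^sup>2 *\<^sub>R x4"
  by (simp_all add: lift_def exchangeable_def transpose_simps)

context
  fixes N :: nat
  assumes N: "3 \<le> N" and e: "e = 1 / real N"
    and sym: "transpose x1 = x1" "transpose x3 = x3" "transpose x4 = x4"
begin

lemma eN: "real N * e = 1" "(real N - c) * e = 1 - c * e"
  using N by (simp_all add: e diff_divide_distrib)

lemma lift_sym: "transpose (lift i j l) = lift i l j"
  by (simp add: lift_def exchangeable_def transpose_simps sym)

lemma lift_own_row:
  assumes "i \<in> {1..N}"
  shows "(\<Sum>k\<in>{1..N}. lift i i k) = own_row"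
proof -
  have "(\<Sum>k\<in>{1..N}. lift i i k) = lift i i i + (real (card {1..N}) - 1) *\<^sub>R (e *\<^sub>R x2)"
    using assms by (intro sum_one_exception) (auto simp: lift_blocks)
  then show ?thesis by (simp add: lift_blocks own_row_def eN)
qed

lemma lift_other_row:
  assumes "i \<in> {1..N}" "j \<in> {1..N}" "i \<noteq> j"
  shows "(\<Sum>k\<in>{1..N}. lift i j k) = e *\<^sub>R other_row"
proof -
  have "(\<Sum>k\<in>{1..N}. lift i j k) = lift i j i + lift i j j + (real (card {1..N}) - 2) *\<^sub>R (e\<^sup>2 *\<^sub>R x4)"
    using assms by (intro sum_two_exceptions) (auto simp: lift_blocks)
  moreover have "(real N - 2) * e\<^sup>2 = e * (1 - 2 * e)"
    by (simp add: eN(2)[symmetric] power2_eq_square)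
  ultimately show ?thesis
    using assms by (simp add: lift_blocks other_row_def scaleR_add_right power2_eq_square)
qed

lemma lift_col: "(\<Sum>k\<in>{1..N}. lift i k j) = transpose (\<Sum>k\<in>{1..N}. lift i j k)"
  by (simp add: linear_sum[OF linear_transpose] lift_sym)

lemma lift_S0:
  assumes "k \<in> {1..N}"
  shows "Sig N lift k = e\<^sup>2 *\<^sub>R noise0"
proof -
  have "(\<Sum>h\<in>{1..N}. \<Sum>l\<in>{1..N}. lift k h l) = (\<Sum>l\<in>{1..N}. lift k k l) + (real (card {1..N}) - 1) *\<^sub>R (e *\<^sub>R other_row)"
    using assms by (intro sum_one_exception[of _ _ "\<lambda>h. \<Sum>l\<in>{1..N}. lift k h l"]) (auto simp: lift_other_row simp del: One_nat_def)
  also have "\<dots> = own_row + (1 - e) *\<^sub>R other_row"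
    using assms by (simp add: lift_own_row eN del: One_nat_def)
  finally have "(\<Sum>h\<in>{1..N}. \<Sum>l\<in>{1..N}. lift k h l) = own_row + (1 - e) *\<^sub>R other_row" .
  moreover have "1 / (real N)\<^sup>2 = e\<^sup>2" by (simp add: e power_one_over)
  ultimately show ?thesis by (simp only: S0_eq noise0_def)
qed

lemma lift_Rk: "k \<in> {1..N} \<Longrightarrow> Wgt N lift k = wgt x1"
  by (simp add: Rk_eq wgt_def lift_blocks)

lemma lift_Rk_inv: "k \<in> {1..N} \<Longrightarrow> Hk N lift k = gain x1"
  by (simp add: Rk_inv_def gain_def lift_Rk)

lemma lift_coupling: "Cpl N lift = cpl"
proof -
  have "(\<Sum>k\<in>{1..N}. Hk N lift k ** Sig N lift k) = (\<Sum>k\<in>{1..N}. e\<^sup>2 *\<^sub>R (gain x1 ** noise0))"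
    by (intro sum.cong refl) (simp add: lift_Rk_inv lift_S0 mm_linear)
  also have "\<dots> = (real N * e\<^sup>2) *\<^sub>R (gain x1 ** noise0)"
    by (simp only: sum_constant_scaleR card_atLeastAtMost) simp
  also have "real N * e\<^sup>2 = e" using eN(1) by (simp add: power2_eq_square mult.assoc[symmetric])
  finally show ?thesis by (simp only: coupling_mat_def cpl_def)
qed

lemma lift_M0:
  assumes "l \<in> {1..N}"
  shows "Mean N lift j l = mean_fb"
proof -
  let ?f = "\<lambda>k. Hk N lift k ** transpose B ** lift k k l"
  have "(\<Sum>k\<in>{1..N}. ?f k) = ?f l + (real (card {1..N}) - 1) *\<^sub>R (e *\<^sub>R (gain x1 ** transpose B ** x2))"
    using assms by (intro sum_one_exception) (auto simp: lift_blocks lift_Rk_inv mm_linear)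
  also have "\<dots> = gain x1 ** transpose B ** own_row"
    using assms by (simp add: lift_Rk_inv lift_blocks eN own_row_def mm_linear)
  finally show ?thesis by (simp only: M0_eq lift_coupling mean_fb_def)
qed

lemma lift_Lk:
  assumes "k \<in> {1..N}" "l \<in> {1..N}"
  shows "Resp N lift k 1 l = (if k = l then resp1 else e *\<^sub>R resp2)"
  using assms
  by (simp add: Lk_eq lift_S0 lift_M0 lift_blocks resp1_def resp2_def mm_linear scaleR_add_right
      power2_eq_square del: One_nat_def)

lemmas lift_simps = lift_Lk lift_Rk_inv lift_S0 lift_M0 lift_blocks mm_linear

lemma card_others: "i \<in> {1..N} \<Longrightarrow> real (card ({1..N} - {i})) = real N - 1"
  using N by (simp add: of_nat_diff)

lemma sum_others0:
  fixes f :: "nat \<Rightarrow> 'v::real_vector"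
  assumes "i \<in> {1..N}" "\<And>k. k \<in> {1..N} \<Longrightarrow> k \<noteq> i \<Longrightarrow> f k = c"
  shows "(\<Sum>k\<in>{1..N} - {i}. f k) = (real N - 1) *\<^sub>R c"
proof -
  have "(\<Sum>k\<in>{1..N} - {i}. f k) = (\<Sum>k\<in>{1..N} - {i}. c)" using assms by (intro sum.cong) auto
  then show ?thesis using card_others[OF assms(1)] by (simp only: sum_constant_scaleR)
qed

lemma sum_others1:
  fixes f :: "nat \<Rightarrow> 'v::real_vector"
  assumes "i \<in> {1..N}" "l \<in> {1..N}" "l \<noteq> i"
    and "\<And>k. k \<in> {1..N} \<Longrightarrow> k \<noteq> i \<Longrightarrow> k \<noteq> l \<Longrightarrow> f k = c"
  shows "(\<Sum>k\<in>{1..N} - {i}. f k) = f l + (real N - 2) *\<^sub>R c"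
proof -
  have "(\<Sum>k\<in>{1..N} - {i}. f k) = f l + (real (card ({1..N} - {i})) - 1) *\<^sub>R c"
    using assms by (intro sum_one_exception) auto
  then show ?thesis unfolding card_others[OF assms(1)] by simp
qed

lemma sum_others2:
  fixes f :: "nat \<Rightarrow> 'v::real_vector"
  assumes "i \<in> {1..N}" "j \<in> {1..N}" "l \<in> {1..N}" "j \<noteq> i" "l \<noteq> i" "j \<noteq> l"
    and "\<And>k. k \<in> {1..N} \<Longrightarrow> k \<noteq> i \<Longrightarrow> k \<noteq> j \<Longrightarrow> k \<noteq> l \<Longrightarrow> f k = c"
  shows "(\<Sum>k\<in>{1..N} - {i}. f k) = f j + f l + (real N - 3) *\<^sub>R c"
proof -
  have "(\<Sum>k\<in>{1..N} - {i}. f k) = f j + f l + (real (card ({1..N} - {i})) - 2) *\<^sub>R c"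
    using assms by (intro sum_two_exceptions) auto
  then show ?thesis unfolding card_others[OF assms(1)] by simp
qed

text \<open>
  A sum over the other players has \<open>N - 1\<close> summands, of which up to two are exceptional. Each factor
  \<open>N - c\<close> meets a factor \<open>e\<close> and disappears by these rules.
\<close>

lemma e_pow: "(real N - c) * e = 1 - c * e" "(real N - c) * (e * z) = (1 - c * e) * z"
   "e * (real N - c) = 1 - c * e" "e * ((real N - c) * z) = (1 - c * e) * z"
  using eN(2)[of c] by (simp_all add: mult.assoc[symmetric] mult.commute[of e])

lemmas lift_calc = lift_simps e_pow scaleR_add_right transpose_simps noise1_def matrix_mul_assoc
  power2_eq_square power3_eq_cube mult_ac

lemma rhs_lift_11:
  assumes i: "i \<in> {1..N}"
  shows "rhs N lift i i i = F1"
proof -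
  have 6: "right_sum N lift i i i
      = (e * (1 - e)) *\<^sub>R (x2 ** B ** gain x1 ** resp2)"
    by (subst sum_others0[OF i, of _ "(e * e) *\<^sub>R (x2 ** B ** gain x1 ** resp2)"])
      (use i in \<open>simp_all add: lift_calc del: One_nat_def\<close>)
  have 7: "left_sum N lift i i i
      = (e * (1 - e)) *\<^sub>R (transpose resp2 ** gain x1 ** transpose B ** transpose x2)"
    by (subst sum_others0[OF i, of _ "(e * e) *\<^sub>R (transpose resp2 ** gain x1 ** transpose B ** transpose x2)"])
      (use i in \<open>simp_all add: lift_calc del: One_nat_def\<close>)
  have 8: "noise_sum N lift i i i
      = (e ^ 3 * (1 - e)) *\<^sub>R (transpose resp2 ** noise1 ** resp2)"
    by (subst sum_others0[OF i, of _ "(e * e * (e * e)) *\<^sub>R (transpose resp2 ** noise1 ** resp2)"])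
      (use i in \<open>simp_all add: lift_calc del: One_nat_def\<close>)
  show ?thesis
    unfolding riccati_rhs_eq[OF i i i] F1_def 6 7 8 lift_col lift_own_row[OF i] bigQ_eq e[symmetric]
    using i by (simp add: lift_simps mean_cost_def mean_cost'_def matrix_mul_assoc power2_eq_square
        power4_eq_xxxx mult_ac del: One_nat_def)
qed

lemma rhs_lift_12:
  assumes i: "i \<in> {1..N}" and l: "l \<in> {1..N}" "l \<noteq> i"
  shows "rhs N lift i i l = e *\<^sub>R F2"
proof -
  have 6: "right_sum N lift i i l
      = e *\<^sub>R (x2 ** B ** gain x1 ** (resp1 + (1 - 2 * e) *\<^sub>R resp2))"
    by (subst sum_others1[OF i l, of _ "(e * e) *\<^sub>R (x2 ** B ** gain x1 ** resp2)"])
      (use i l in \<open>simp_all add: lift_calc del: One_nat_def\<close>)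
  have 7: "left_sum N lift i i l
      = e *\<^sub>R (e *\<^sub>R (transpose resp2 ** gain x1 ** transpose B ** (e *\<^sub>R x3 + (1 - 2 * e) *\<^sub>R x4)))"
    by (subst sum_others1[OF i l, of _ "(e * (e * e)) *\<^sub>R (transpose resp2 ** gain x1 ** transpose B ** x4)"])
      (use i l in \<open>simp_all add: lift_calc del: One_nat_def\<close>)
  have 8: "noise_sum N lift i i l
      = e *\<^sub>R (e\<^sup>2 *\<^sub>R (transpose resp2 ** noise1 ** (resp1 + (1 - 2 * e) *\<^sub>R resp2)))"
    by (subst sum_others1[OF i l, of _ "(e * (e * (e * e))) *\<^sub>R (transpose resp2 ** noise1 ** resp2)"])
      (use i l in \<open>simp_all add: lift_calc del: One_nat_def\<close>)
  show ?thesis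
    unfolding riccati_rhs_eq[OF i i l(1)] F2_def 6 7 8 lift_col lift_own_row[OF i]
      lift_other_row[OF i l(1) l(2)[symmetric]] bigQ_eq e[symmetric]
    using i l by (simp add: lift_simps mean_cost_def mean_cost'_def matrix_mul_assoc power2_eq_square
        power3_eq_cube mult_ac scaleR_add_right scaleR_diff_right transpose_simps del: One_nat_def)
qed

lemma rhs_lift_22:
  assumes i: "i \<in> {1..N}" and l: "l \<in> {1..N}" "l \<noteq> i"
  shows "rhs N lift i l l = e\<^sup>2 *\<^sub>R F3"
proof -
  have 6: "right_sum N lift i l l
      = e\<^sup>2 *\<^sub>R (x3 ** B ** gain x1 ** resp1 + (1 - 2 * e) *\<^sub>R (x4 ** B ** gain x1 ** resp2))"
    by (subst sum_others1[OF i l, of _ "(e * (e * e)) *\<^sub>R (x4 ** B ** gain x1 ** resp2)"])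
      (use i l in \<open>simp_all add: lift_calc del: One_nat_def\<close>)
  have 7: "left_sum N lift i l l
      = e\<^sup>2 *\<^sub>R (transpose resp1 ** gain x1 ** transpose B ** x3
        + (1 - 2 * e) *\<^sub>R (transpose resp2 ** gain x1 ** transpose B ** x4))"
    by (subst sum_others1[OF i l, of _ "(e * (e * e)) *\<^sub>R (transpose resp2 ** gain x1 ** transpose B ** x4)"])
      (use i l in \<open>simp_all add: lift_calc del: One_nat_def\<close>)
  have 8: "noise_sum N lift i l l
      = e\<^sup>2 *\<^sub>R (transpose resp1 ** noise1 ** resp1
        + (e * (1 - 2 * e)) *\<^sub>R (transpose resp2 ** noise1 ** resp2))"
    by (subst sum_others1[OF i l, of _ "(e * (e * (e * e))) *\<^sub>R (transpose resp2 ** noise1 ** resp2)"])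
      (use i l in \<open>simp_all add: lift_calc del: One_nat_def\<close>)
  show ?thesis
    unfolding riccati_rhs_eq[OF i l(1) l(1)] F3_def 6 7 8 lift_col
      lift_other_row[OF i l(1) l(2)[symmetric]] bigQ_eq e[symmetric]
    using i l by (simp add: lift_simps mean_cost_def mean_cost'_def matrix_mul_assoc power2_eq_square
        mult_ac scaleR_add_right scaleR_diff_right transpose_simps del: One_nat_def)
qed

lemma rhs_lift_23:
  assumes i: "i \<in> {1..N}" and jl: "j \<in> {1..N}" "l \<in> {1..N}" "j \<noteq> i" "l \<noteq> i" "j \<noteq> l"
  shows "rhs N lift i j l = e\<^sup>2 *\<^sub>R F4"
proof -
  have 6: "right_sum N lift i j l
      = e\<^sup>2 *\<^sub>R (e *\<^sub>R (x3 ** B ** gain x1 ** resp2) + x4 ** B ** gain x1 ** resp1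
        + (1 - 3 * e) *\<^sub>R (x4 ** B ** gain x1 ** resp2))"
    by (subst sum_others2[OF i jl, of _ "(e * (e * e)) *\<^sub>R (x4 ** B ** gain x1 ** resp2)"])
      (use i jl in \<open>simp_all add: lift_calc del: One_nat_def\<close>)
  have 7: "left_sum N lift i j l
      = e\<^sup>2 *\<^sub>R (transpose resp1 ** gain x1 ** transpose B ** x4
        + e *\<^sub>R (transpose resp2 ** gain x1 ** transpose B ** x3)
        + (1 - 3 * e) *\<^sub>R (transpose resp2 ** gain x1 ** transpose B ** x4))"
    by (subst sum_others2[OF i jl, of _ "(e * (e * e)) *\<^sub>R (transpose resp2 ** gain x1 ** transpose B ** x4)"])
      (use i jl in \<open>simp_all add: lift_calc del: One_nat_def\<close>)
  have 8: "noise_sum N lift i j l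
      = e\<^sup>2 *\<^sub>R (e *\<^sub>R (transpose resp1 ** noise1 ** resp2)
        + e *\<^sub>R (transpose resp2 ** noise1 ** resp1)
        + (e * (1 - 3 * e)) *\<^sub>R (transpose resp2 ** noise1 ** resp2))"
    by (subst sum_others2[OF i jl, of _ "(e * (e * (e * e))) *\<^sub>R (transpose resp2 ** noise1 ** resp2)"])
      (use i jl in \<open>simp_all add: lift_calc del: One_nat_def\<close>)
  show ?thesis
    unfolding riccati_rhs_eq[OF i jl(1,2)] F4_def 6 7 8 lift_col
      lift_other_row[OF i jl(1) jl(3)[symmetric]] lift_other_row[OF i jl(2) jl(4)[symmetric]] bigQ_eq e[symmetric]
    using i jl by (simp add: lift_simps mean_cost_def mean_cost'_def matrix_mul_assoc power2_eq_square
        mult_ac scaleR_add_right scaleR_diff_right transpose_simps del: One_nat_def)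
qed

end

end

end

section \<open>Uniqueness and exchangeability\<close>

lemma pos_def_invertible:
  fixes M :: "real^'k^'k"
  assumes "pos_def M"
  shows "invertible M"
proof -
  have "M *v v = 0 \<longrightarrow> v = 0" for v
    using assms unfolding pos_def_def by (metis inner_zero_right less_irrefl)
  then show ?thesis by (simp add: invertible_left_inverse matrix_left_invertible_ker)
qed

lemma bounded_below_Un:
  fixes M :: "'i \<Rightarrow> real^'k^'k"
  assumes "\<exists>c>0. \<forall>x\<in>X. \<forall>v. c * norm v \<le> norm (M x *v v)" "\<exists>c>0. \<forall>x\<in>Y. \<forall>v. c * norm v \<le> norm (M x *v v)"
  shows "\<exists>c>0. \<forall>x\<in>X \<union> Y. \<forall>v. c * norm v \<le> norm (M x *v v)"
proof -
  obtain c c' where c: "c > 0" "\<forall>x\<in>X. \<forall>v. c * norm v \<le> norm (M x *v v)"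
    "c' > 0" "\<forall>x\<in>Y. \<forall>v. c' * norm v \<le> norm (M x *v v)"
    using assms by blast
  have "min c c' * norm v \<le> c * norm v" "min c c' * norm v \<le> c' * norm v" for v :: "real^'k"
    by (simp_all add: mult_right_mono)
  then have "\<forall>x\<in>X \<union> Y. \<forall>v. min c c' * norm v \<le> norm (M x *v v)"
    using c by (blast intro: order_trans)
  then show ?thesis using c by (intro exI[of _ "min c c'"]) auto
qed

text \<open>
  Three transpositions, each of which moves one of the indices into place and fixes those placed before.
\<close>

lemma permutation_to_123:
  fixes i j l :: nat
  assumes "i \<in> {1..N}" "j \<in> {1..N}" "l \<in> {1..N}" "i \<noteq> j" "i \<noteq> l" "j \<noteq> l"
  shows "\<exists>\<sigma>. \<sigma> permutes {1..N} \<and> \<sigma> i = 1 \<and> \<sigma> j = 2 \<and> \<sigma> l = 3"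
proof -
  have N: "3 \<le> N"
  proof -
    have "card {i, j, l} \<le> card {1..N}" using assms by (intro card_mono) auto
    then show ?thesis using assms by simp
  qed
  define a where "a = Transposition.transpose i 1"
  define b where "b = Transposition.transpose (a j) 2"
  define c where "c = Transposition.transpose (b (a l)) 3"
  have pa: "a permutes {1..N}" unfolding a_def using assms N by (intro permutes_swap_id) auto
  have aj: "a i = 1" "a j \<in> {1..N}" "a j \<noteq> 1" "a l \<in> {1..N}" "a l \<noteq> 1" "a l \<noteq> a j"
    using permutes_in_image[OF pa] permutes_inj[OF pa] assms
    by (auto simp: a_def inj_eq Transposition.transpose_def split: if_splits)
  have pb: "b permutes {1..N}" unfolding b_def using aj N by (intro permutes_swap_id) auto
  have bj: "b 1 = 1" "b (a j) = 2" "b (a l) \<in> {1..N}" "b (a l) \<noteq> 1" "b (a l) \<noteq> 2"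
    using permutes_in_image[OF pb, of "a l"] aj
    by (auto simp: b_def Transposition.transpose_def split: if_splits)
  have pc: "c permutes {1..N}" unfolding c_def using bj N by (intro permutes_swap_id) auto
  have cj: "c 1 = 1" "c 2 = 2" "c (b (a l)) = 3"
    using bj by (auto simp: c_def Transposition.transpose_def)
  have "(c \<circ> b \<circ> a) permutes {1..N}"
    using pa pb pc by (intro permutes_compose)
  then show ?thesis using aj bj cj by (intro exI[of _ "c \<circ> b \<circ> a"]) auto
qed

context lq_game
begin

lemma solves_block_derivative:
  assumes "solves N P" "i \<in> {1..N}" "j \<in> {1..N}" "l \<in> {1..N}" "t \<in> {0..T}"
  shows "((\<lambda>s. P i s j l) has_vector_derivative - rhs N (\<lambda>k. P k t) i j l) (at t within {0..T})"
  using assms by (simp add: riccati_solution_def)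

lemma solves_continuous:
  assumes "solves N P" "i \<in> {1..N}" "j \<in> {1..N}" "l \<in> {1..N}"
  shows "continuous_on {0..T} (\<lambda>t. P i t j l)"
  using solves_block_derivative[OF assms] by (rule continuous_on_vector_derivative)

lemma solves_Rk_continuous:
  assumes "solves N P" "k \<in> {1..N}"
  shows "continuous_on {0..T} (\<lambda>t. Wgt N (\<lambda>k. P k t) k)"
  unfolding Rk_eq[OF assms(2)]
  by (intro continuous_intros mm.continuous_on solves_continuous[OF assms(1)] assms(2))

lemma solves_Rk_invertible:
  assumes "solves N P" "k \<in> {1..N}" "t \<in> {0..T}"
  shows "invertible (Wgt N (\<lambda>k. P k t) k)"
  using assms by (intro pos_def_invertible) (simp add: riccati_solution_def)

lemma solves_coupling_continuous:
  assumes "solves N P"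
  shows "continuous_on {0..T} (\<lambda>t. Cpl N (\<lambda>k. P k t))"
  unfolding coupling_mat_def S0_eq Rk_inv_def
  by (intro continuous_intros mm.continuous_on continuous_on_matrix_inv solves_Rk_continuous[OF assms]
      solves_continuous[OF assms] solves_Rk_invertible[OF assms] compact_Icc)

lemma solves_bounded_below:
  assumes "solves N P"
  shows "k \<in> {1..N} \<Longrightarrow> \<exists>c>0. \<forall>t\<in>{0..T}. \<forall>v. c * norm v \<le> norm (Wgt N (\<lambda>k. P k t) k *v v)"
    and "\<exists>c>0. \<forall>t\<in>{0..T}. \<forall>v. c * norm v \<le> norm (Cpl N (\<lambda>k. P k t) *v v)"
proof -
  show "k \<in> {1..N} \<Longrightarrow> \<exists>c>0. \<forall>t\<in>{0..T}. \<forall>v. c * norm v \<le> norm (Wgt N (\<lambda>k. P k t) k *v v)"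
    using assms by (intro bounded_below_on_compact solves_Rk_continuous solves_Rk_invertible) auto
  show "\<exists>c>0. \<forall>t\<in>{0..T}. \<forall>v. c * norm v \<le> norm (Cpl N (\<lambda>k. P k t) *v v)"
    using assms by (intro bounded_below_on_compact solves_coupling_continuous) (auto simp: riccati_solution_def)
qed

lemma rhs_bounded_lipschitz:
  fixes S :: "(nat \<Rightarrow> ('n, 'n) barray) set"
  assumes P: "\<And>i j l. i \<in> {1..N} \<Longrightarrow> j \<in> {1..N} \<Longrightarrow> l \<in> {1..N} \<Longrightarrow>
      bounded_lipschitz S d (\<lambda>P. P i j l)"
    and R: "\<And>k. k \<in> {1..N} \<Longrightarrow> \<exists>c>0. \<forall>P\<in>S. \<forall>v. c * norm v \<le> norm (Wgt N P k *v v)"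
    and C: "\<exists>c>0. \<forall>P\<in>S. \<forall>v. c * norm v \<le> norm (Cpl N P *v v)"
    and i: "i \<in> {1..N}" and j: "j \<in> {1..N}" and l: "l \<in> {1..N}"
  shows "bounded_lipschitz S d (\<lambda>P. rhs N P i j l)"
proof -
  have W: "bounded_lipschitz S d (\<lambda>P. Wgt N P k)" if "k \<in> {1..N}" for k
    unfolding Rk_eq[OF that] using that by (intro blip P)
  have H: "bounded_lipschitz S d (\<lambda>P. Hk N P k)" if k: "k \<in> {1..N}" for k
  proof -
    obtain c where "c > 0" "\<And>P v. P \<in> S \<Longrightarrow> c * norm v \<le> norm (Wgt N P k *v v)" using R[OF k] by blast
    then show ?thesis unfolding Rk_inv_def by (intro blip_matrix_inv W k)
  qed
  have S0: "bounded_lipschitz S d (\<lambda>P. Sig N P k)" if "k \<in> {1..N}" for k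
    unfolding S0_eq using that by (intro blip P)
  have "bounded_lipschitz S d (Cpl N)"
    unfolding coupling_mat_def by (intro blip H S0)
  moreover obtain c where "c > 0" "\<And>P v. P \<in> S \<Longrightarrow> c * norm v \<le> norm (Cpl N P *v v)" using C by blast
  ultimately have Ci: "bounded_lipschitz S d (\<lambda>P. matrix_inv (Cpl N P))"
    by (intro blip_matrix_inv)
  have M: "bounded_lipschitz S d (\<lambda>P. Mean N P h l)" if "l \<in> {1..N}" for h l
    unfolding M0_eq using that by (intro blip H P Ci)
  have L: "bounded_lipschitz S d (\<lambda>P. Resp N P k h l)" if "k \<in> {1..N}" "l \<in> {1..N}" for k h l
    unfolding Lk_eq[OF that(1)] using that by (intro blip H P S0 M)
  show ?thesis
    unfolding riccati_rhs_eq[OF i j l] using i j l by (intro blip H P S0 M L; simp)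
qed

text \<open>
  Along two given solutions all blocks are bounded, and the two kinds of matrices to be inverted are
  bounded below by compactness of \<open>[0, T]\<close>. So the right-hand side is Lipschitz on the set of values
  of the two solutions, and Gronwall applies to the differences of the blocks.
\<close>

lemma riccati_solution_unique:
  assumes P: "solves N P" and P': "solves N P'"
    and i: "i \<in> {1..N}" and j: "j \<in> {1..N}" and l: "l \<in> {1..N}" and t: "t \<in> {0..T}"
  shows "P i t j l = P' i t j l"
proof -
  define I where "I = {1..N} \<times> {1..N} \<times> {1..N}"
  define d :: "(nat \<Rightarrow> ('n, 'n) barray) \<Rightarrow> (nat \<Rightarrow> ('n, 'n) barray) \<Rightarrow> real"
    where "d X Y = (\<Sum>(i, j, l)\<in>I. norm (X i j l - Y i j l))" for X Y
  define S where "S = (\<lambda>t k. P k t) ` {0..T} \<union> (\<lambda>t k. P' k t) ` {0..T}"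
  have I: "finite I" by (simp add: I_def)
  have entry: "bounded_lipschitz S d (\<lambda>X. X i j l)" if ijl: "i \<in> {1..N}" "j \<in> {1..N}" "l \<in> {1..N}" for i j l
  proof -
    have "bounded ((\<lambda>t. P i t j l) ` {0..T})" "bounded ((\<lambda>t. P' i t j l) ` {0..T})"
      using solves_continuous[OF P ijl] solves_continuous[OF P' ijl]
      by (auto intro: compact_imp_bounded compact_continuous_image)
    then obtain K K' where "\<forall>t\<in>{0..T}. norm (P i t j l) \<le> K" "\<forall>t\<in>{0..T}. norm (P' i t j l) \<le> K'"
      by (auto simp: bounded_iff)
    then have "\<forall>X\<in>S. norm (X i j l) \<le> max K K'" by (force simp: S_def)
    moreover have "norm (X i j l - Y i j l) \<le> 1 * d X Y" for X Y
    proof -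
      have "(case (i, j, l) of (i, j, l) \<Rightarrow> norm (X i j l - Y i j l)) \<le> d X Y"
        unfolding d_def using I ijl by (intro member_le_sum) (auto simp: I_def)
      then show ?thesis by simp
    qed
    ultimately show ?thesis unfolding bounded_lipschitz_def by blast
  qed
  have R: "\<exists>c>0. \<forall>X\<in>S. \<forall>v. c * norm v \<le> norm (Wgt N X k *v v)" if k: "k \<in> {1..N}" for k
    unfolding S_def by (intro bounded_below_Un) (use solves_bounded_below(1)[OF _ k] P P' in auto)
  have C: "\<exists>c>0. \<forall>X\<in>S. \<forall>v. c * norm v \<le> norm (Cpl N X *v v)"
    unfolding S_def by (intro bounded_below_Un) (use solves_bounded_below(2) P P' in auto)
  have "\<exists>L. \<forall>X\<in>S. \<forall>Y\<in>S. norm (rhs N X i j l - rhs N Y i j l) \<le> L * d X Y"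
    if "i \<in> {1..N}" "j \<in> {1..N}" "l \<in> {1..N}" for i j l
    using rhs_bounded_lipschitz[OF entry R C that] unfolding bounded_lipschitz_def by blast
  then have "\<exists>L. \<forall>a\<in>I. \<forall>X\<in>S. \<forall>Y\<in>S.
      (case a of (i, j, l) \<Rightarrow> norm (rhs N X i j l - rhs N Y i j l)) \<le> L a * d X Y"
    by (intro bchoice) (auto simp: I_def)
  then obtain L where L: "\<And>i j l X Y. (i, j, l) \<in> I \<Longrightarrow> X \<in> S \<Longrightarrow> Y \<in> S \<Longrightarrow>
      norm (rhs N X i j l - rhs N Y i j l) \<le> L (i, j, l) * d X Y"
    by fastforce
  define L' where "L' = (\<Sum>a\<in>I. \<bar>L a\<bar>)"
  have d0: "0 \<le> d X Y" for X Y unfolding d_def by (intro sum_nonneg) auto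
  define u where "u a s = (case a of (i, j, l) \<Rightarrow> P i s j l - P' i s j l)" for a s
  define u' where "u' a s = (case a of (i, j, l) \<Rightarrow>
      - rhs N (\<lambda>k. P k s) i j l - - rhs N (\<lambda>k. P' k s) i j l)" for a s
  have "u (i, j, l) t = 0"
  proof (rule gronwall_family_zero[where u = u and u' = u' and I = I and L = L' and T = T])
    show "finite I" by fact
    show "(u a has_vector_derivative u' a s) (at s within {0..T})" if "a \<in> I" "s \<in> {0..T}" for a s
    proof -
      obtain i j l where a: "a = (i, j, l)" by (metis prod_cases3)
      then have ijl: "i \<in> {1..N}" "j \<in> {1..N}" "l \<in> {1..N}" using that by (simp_all add: I_def)
      show ?thesis
        unfolding u_def u'_def a prod.case
        by (intro has_vector_derivative_diff solves_block_derivative P P' ijl that)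
    qed
    show "norm (u' a s) \<le> L' * (\<Sum>b\<in>I. norm (u b s))" if as: "a \<in> I" "s \<in> {0..T}" for a s
    proof -
      obtain i j l where a: "a = (i, j, l)" by (metis prod_cases3)
      have "norm (u' a s) = norm (rhs N (\<lambda>k. P k s) i j l - rhs N (\<lambda>k. P' k s) i j l)"
        by (simp add: u'_def a norm_minus_commute)
      also have "\<dots> \<le> L a * d (\<lambda>k. P k s) (\<lambda>k. P' k s)"
        unfolding a using as a by (intro L) (auto simp: S_def)
      also have "\<dots> \<le> L' * d (\<lambda>k. P k s) (\<lambda>k. P' k s)"
      proof (rule mult_right_mono[OF _ d0])
        have "\<bar>L a\<bar> \<le> L'" unfolding L'_def using I as by (intro member_le_sum) auto
        then show "L a \<le> L'" by linarith
      qed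
      also have "d (\<lambda>k. P k s) (\<lambda>k. P' k s) = (\<Sum>b\<in>I. norm (u b s))"
        unfolding d_def u_def by (intro sum.cong) (auto split: prod.splits)
      finally show ?thesis .
    qed
    show "0 \<le> L'" unfolding L'_def by (intro sum_nonneg) auto
    show "u a T = 0" if "a \<in> I" for a
      using that P P' by (auto simp: I_def u_def riccati_solution_def)
    show "t \<in> {0..T}" "(i, j, l) \<in> I" using t i j l by (auto simp: I_def)
  qed
  then show ?thesis by (simp add: u_def)
qed

context
  fixes N :: nat and \<sigma> :: "nat \<Rightarrow> nat"
  assumes \<sigma>: "\<sigma> permutes {1..N}"
begin

lemma perm_in: "k \<in> {1..N} \<Longrightarrow> \<sigma> k \<in> {1..N}"
  using permutes_in_image[OF \<sigma>] by blast

lemma perm_eq: "\<sigma> j = \<sigma> i \<longleftrightarrow> j = i"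
  using permutes_inj[OF \<sigma>] by (simp add: inj_eq)

lemma perm_sum: "(\<Sum>k\<in>{1..N}. f (\<sigma> k)) = (\<Sum>k\<in>{1..N}. f k)"
  using sum.permute[OF \<sigma>, of f] by (simp add: comp_def)

lemma perm_sum_others: "(\<Sum>k\<in>{1..N} - {i}. f (\<sigma> k)) = (\<Sum>k\<in>{1..N} - {\<sigma> i}. f k)"
proof (rule sum.reindex_bij_betw)
  have "\<sigma> ` ({1..N} - {i}) = {1..N} - {\<sigma> i}"
    using permutes_image[OF \<sigma>] permutes_inj[OF \<sigma>] by (simp add: image_set_diff)
  then show "bij_betw \<sigma> ({1..N} - {i}) ({1..N} - {\<sigma> i})"
    using permutes_inj_on[OF \<sigma>] by (auto simp: bij_betw_def)
qed

text \<open>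
  Only blocks in the index range are related, so that \<open>\<sigma> = id\<close> gives the fact that the right-hand
  side does not depend on the blocks outside the range.
\<close>

context
  fixes P P' :: "nat \<Rightarrow> ('n, 'n) barray"
  assumes P': "\<And>i j l. i \<in> {1..N} \<Longrightarrow> j \<in> {1..N} \<Longrightarrow> l \<in> {1..N} \<Longrightarrow> P' i j l = P (\<sigma> i) (\<sigma> j) (\<sigma> l)"
begin

lemma relabel_S0:
  assumes k: "k \<in> {1..N}"
  shows "Sig N P' k = Sig N P (\<sigma> k)"
proof -
  have "(\<Sum>h\<in>{1..N}. \<Sum>l\<in>{1..N}. P' k h l) = (\<Sum>h\<in>{1..N}. \<Sum>l\<in>{1..N}. P (\<sigma> k) (\<sigma> h) (\<sigma> l))"
    by (intro sum.cong refl) (simp only: P' k)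
  also have "\<dots> = (\<Sum>h\<in>{1..N}. \<Sum>l\<in>{1..N}. P (\<sigma> k) h l)"
    unfolding perm_sum[of "\<lambda>l. P (\<sigma> k) (\<sigma> h) l" for h] perm_sum[of "\<lambda>h. \<Sum>l\<in>{1..N}. P (\<sigma> k) h l"] ..
  finally show ?thesis unfolding S0_eq by simp
qed

lemma relabel_Rk:
  assumes "k \<in> {1..N}"
  shows "Wgt N P' k = Wgt N P (\<sigma> k)"
  unfolding Rk_eq[OF assms] Rk_eq[OF perm_in[OF assms]] by (simp only: P' assms)

lemma relabel_Rk_inv: "k \<in> {1..N} \<Longrightarrow> Hk N P' k = Hk N P (\<sigma> k)"
  by (simp add: Rk_inv_def relabel_Rk)

lemma relabel_coupling: "Cpl N P' = Cpl N P"
proof -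
  have "(\<Sum>k\<in>{1..N}. Hk N P' k ** Sig N P' k) = (\<Sum>k\<in>{1..N}. Hk N P (\<sigma> k) ** Sig N P (\<sigma> k))"
    by (intro sum.cong refl) (simp only: relabel_S0 relabel_Rk_inv)
  also have "\<dots> = (\<Sum>k\<in>{1..N}. Hk N P k ** Sig N P k)" by (rule perm_sum)
  finally show ?thesis by (simp only: coupling_mat_def)
qed

lemma relabel_M0:
  assumes "l \<in> {1..N}"
  shows "Mean N P' j l = Mean N P j (\<sigma> l)"
proof -
  have "(\<Sum>k\<in>{1..N}. Hk N P' k ** transpose B ** P' k k l)
      = (\<Sum>k\<in>{1..N}. Hk N P (\<sigma> k) ** transpose B ** P (\<sigma> k) (\<sigma> k) (\<sigma> l))"
    by (intro sum.cong refl) (simp only: relabel_Rk_inv P' assms)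
  also have "\<dots> = (\<Sum>k\<in>{1..N}. Hk N P k ** transpose B ** P k k (\<sigma> l))"
    by (rule perm_sum[of "\<lambda>k. Hk N P k ** transpose B ** P k k (\<sigma> l)"])
  finally show ?thesis by (simp only: M0_eq relabel_coupling)
qed

lemma relabel_Lk:
  "k \<in> {1..N} \<Longrightarrow> l \<in> {1..N} \<Longrightarrow> Resp N P' k j l = Resp N P (\<sigma> k) j (\<sigma> l)"
  by (simp only: Lk_eq perm_in relabel_S0 relabel_M0 P')

lemma relabel_rhs:
  assumes i: "i \<in> {1..N}" and j: "j \<in> {1..N}" and l: "l \<in> {1..N}"
  shows "rhs N P' i j l = rhs N P (\<sigma> i) (\<sigma> j) (\<sigma> l)"
proof -
  note eqs = relabel_Rk_inv relabel_Lk P' Diff_iff i j l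
  have 1: "(\<Sum>k\<in>{1..N}. P' i j k) = (\<Sum>k\<in>{1..N}. P (\<sigma> i) (\<sigma> j) k)"
    unfolding perm_sum[symmetric, of "\<lambda>k. P (\<sigma> i) (\<sigma> j) k"] by (intro sum.cong refl) (simp only: eqs)
  have 2: "(\<Sum>k\<in>{1..N}. P' i k l) = (\<Sum>k\<in>{1..N}. P (\<sigma> i) k (\<sigma> l))"
    unfolding perm_sum[symmetric, of "\<lambda>k. P (\<sigma> i) k (\<sigma> l)"] by (intro sum.cong refl) (simp only: eqs)
  have 6: "right_sum N P' i j l
      = right_sum N P (\<sigma> i) (\<sigma> j) (\<sigma> l)"
    unfolding perm_sum_others[symmetric] by (intro sum.cong refl) (simp only: eqs)
  have 7: "left_sum N P' i j l
      = left_sum N P (\<sigma> i) (\<sigma> j) (\<sigma> l)"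
    unfolding perm_sum_others[symmetric] by (intro sum.cong refl) (simp only: eqs)
  have 8: "noise_sum N P' i j l
      = noise_sum N P (\<sigma> i) (\<sigma> j) (\<sigma> l)"
    unfolding perm_sum_others[symmetric] by (intro sum.cong refl) (simp only: eqs)
  show ?thesis
    unfolding riccati_rhs_eq[OF i j l] riccati_rhs_eq[OF perm_in[OF i] perm_in[OF j] perm_in[OF l]]
      1 2 6 7 8 relabel_S0[OF i] relabel_M0[OF j] relabel_M0[OF l] relabel_Rk_inv[OF i] bigQ_eq perm_eq
    by (simp only: P' i j l)
qed

end

end

lemma riccati_rhs_cong:
  assumes "\<And>i j l. i \<in> {1..N} \<Longrightarrow> j \<in> {1..N} \<Longrightarrow> l \<in> {1..N} \<Longrightarrow> P' i j l = P i j l"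
    and "i \<in> {1..N}" "j \<in> {1..N}" "l \<in> {1..N}"
  shows "rhs N P' i j l = rhs N P i j l"
  using relabel_rhs[OF permutes_id, of N P' P] assms by (simp del: atLeastAtMost_iff)

lemma riccati_solution_relabel:
  assumes P: "solves N P" and \<sigma>: "\<sigma> permutes {1..N}"
  shows "solves N (\<lambda>i t j l. P (\<sigma> i) t (\<sigma> j) (\<sigma> l))"
proof -
  let ?P' = "\<lambda>t k j l. P (\<sigma> k) t (\<sigma> j) (\<sigma> l)"
  note in' = perm_in[OF \<sigma>]
  show ?thesis
    unfolding riccati_solution_def
  proof (intro conjI ballI)
    fix i t assume i: "i \<in> {1..N}" and t: "t \<in> {0..T}"
    have "bsymmetric N (P (\<sigma> i) t)" using P in'[OF i] t unfolding riccati_solution_def by blast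
    then show "bsymmetric N (\<lambda>j l. P (\<sigma> i) t (\<sigma> j) (\<sigma> l))"
      using in' unfolding bsymmetric_def btranspose_def by blast
    fix j l assume jl: "j \<in> {1..N}" "l \<in> {1..N}"
    show "((\<lambda>s. P (\<sigma> i) s (\<sigma> j) (\<sigma> l)) has_vector_derivative
        - rhs N (?P' t) i j l) (at t within {0..T})"
      unfolding relabel_rhs[OF \<sigma>, where P' = "?P' t" and P = "\<lambda>k. P k t", OF refl i jl]
      by (intro solves_block_derivative P in' i jl t)
  next
    fix i j l assume ijl: "i \<in> {1..N}" "j \<in> {1..N}" "l \<in> {1..N}"
    have "P (\<sigma> i) T (\<sigma> j) (\<sigma> l) = Qfc N (\<sigma> i) (\<sigma> j) (\<sigma> l)"
      using P ijl in' unfolding riccati_solution_def by blast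
    then show "P (\<sigma> i) T (\<sigma> j) (\<sigma> l) = Qfc N i j l"
      by (simp only: bigQf_eq perm_eq[OF \<sigma>])
  next
    fix i t assume i: "i \<in> {1..N}" and t: "t \<in> {0..T}"
    show "pos_def (Wgt N (?P' t) i)"
      "pos_def (Wgt N (?P' t) i + Sig N (?P' t) i)"
      unfolding relabel_Rk[OF \<sigma>, where P' = "?P' t" and P = "\<lambda>k. P k t", OF refl i]
        relabel_S0[OF \<sigma>, where P' = "?P' t" and P = "\<lambda>k. P k t", OF refl i]
      using P in'[OF i] t unfolding riccati_solution_def by blast+
  next
    fix t assume t: "t \<in> {0..T}"
    show "invertible (Cpl N (?P' t))"
      unfolding relabel_coupling[OF \<sigma>, where P' = "?P' t" and P = "\<lambda>k. P k t", OF refl] using P t unfolding riccati_solution_def by blast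
  qed
qed

text \<open>
  Transposition exchanges \<open>\<^bold>P\<^sub>i \<^bold>A\<close> with \<open>\<^bold>A\<^sup>T \<^bold>P\<^sub>i\<close> and \<open>left_sum\<close> with \<open>right_sum\<close>; every other summand is symmetric.
\<close>

lemma riccati_rhs_transpose:
  assumes sym: "\<And>i j l. i \<in> {1..N} \<Longrightarrow> j \<in> {1..N} \<Longrightarrow> l \<in> {1..N} \<Longrightarrow> transpose (P i j l) = P i l j"
    and inv: "\<And>k. k \<in> {1..N} \<Longrightarrow> invertible (Wgt N P k)"
    and i: "i \<in> {1..N}" and j: "j \<in> {1..N}" and l: "l \<in> {1..N}"
  shows "transpose (rhs N P i j l) = rhs N P i l j"
proof -
  have H: "transpose (Hk N P k) = Hk N P k" if k: "k \<in> {1..N}" for k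
  proof -
    have "transpose (Wgt N P k) = Wgt N P k"
      by (simp only: Rk_eq[OF k] transpose_simps transpose_transpose R_sym sym[OF k k k] matrix_mul_assoc)
    then show ?thesis unfolding Rk_inv_def transpose_matrix_inv[OF inv[OF k]] by simp
  qed
  have S: "transpose (Sig N P k) = Sig N P k" if k: "k \<in> {1..N}" for k
  proof -
    have "transpose (\<Sum>h\<in>{1..N}. \<Sum>l\<in>{1..N}. P k h l) = (\<Sum>h\<in>{1..N}. \<Sum>l\<in>{1..N}. P k l h)"
      unfolding linear_sum[OF linear_transpose] by (intro sum.cong refl) (simp only: sym k)
    also have "\<dots> = (\<Sum>h\<in>{1..N}. \<Sum>l\<in>{1..N}. P k h l)" by (rule sum.swap)
    finally show ?thesis
      by (simp only: S0_eq transpose_simps transpose_transpose matrix_mul_assoc)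
  qed
  have row: "transpose (\<Sum>k\<in>{1..N}. P i j k) = (\<Sum>k\<in>{1..N}. P i k j)"
    if "j \<in> {1..N}" for j
    unfolding linear_sum[OF linear_transpose] using that i by (intro sum.cong refl sym)
  have col: "transpose (\<Sum>k\<in>{1..N}. P i k j) = (\<Sum>k\<in>{1..N}. P i j k)"
    if "j \<in> {1..N}" for j
    unfolding linear_sum[OF linear_transpose] using that i by (intro sum.cong refl sym)
  have 6: "transpose (right_sum N P i j l)
      = left_sum N P i l j"
    unfolding linear_sum[OF linear_transpose]
    by (intro sum.cong refl) (simp only: transpose_simps Diff_iff sym i j H matrix_mul_assoc)
  have 7: "transpose (left_sum N P i j l)
      = right_sum N P i l j"
    unfolding linear_sum[OF linear_transpose]
    by (intro sum.cong refl)
      (simp only: transpose_simps transpose_transpose Diff_iff sym i l H matrix_mul_assoc)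
  have 8: "transpose (noise_sum N P i j l)
      = noise_sum N P i l j"
    unfolding linear_sum[OF linear_transpose]
    by (intro sum.cong refl)
      (simp only: transpose_simps transpose_transpose Diff_iff sym i H matrix_mul_assoc)
  show ?thesis
    unfolding riccati_rhs_eq[OF i j l] riccati_rhs_eq[OF i l j] bigQ_eq
    by (simp only: transpose_simps 6 7 8 row[OF j] col[OF l] transpose_transpose H[OF i] S[OF i]
        sym[OF i i l] sym[OF i j i] sym[OF i j l] Q_sym matrix_mul_assoc)
      (simp add: algebra_simps)
qed

text \<open>
  By uniqueness a solution coincides with its relabelings. Moving \<open>(i, j, l)\<close> to \<open>(1, 2, 3)\<close>, with
  spare indices where these are not distinct, identifies every block with one of four; this is
  where three players are needed.
\<close>

lemma riccati_solution_exchangeable: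
  assumes P: "solves N P" and N: "3 \<le> N" and t: "t \<in> {0..T}"
    and i: "i \<in> {1..N}" and j: "j \<in> {1..N}" and l: "l \<in> {1..N}"
  shows "P i t j l = exchangeable (P 1 t 1 1) (P 1 t 1 2) (P 1 t 2 2) (P 1 t 2 3) i j l"
proof -
  have inv: "P i t j l = P (\<sigma> i) t (\<sigma> j) (\<sigma> l)"
    if "\<sigma> permutes {1..N}" "i \<in> {1..N}" "j \<in> {1..N}" "l \<in> {1..N}" for \<sigma> i j l
    by (rule riccati_solution_unique[OF P riccati_solution_relabel[OF P that(1)] that(2-4) t])
  have sym: "P i t l i = transpose (P i t i l)" if "i \<in> {1..N}" "l \<in> {1..N}" for i l
  proof -
    have "bsymmetric N (P i t)" using P that t unfolding riccati_solution_def by blast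
    then show ?thesis using that unfolding bsymmetric_def btranspose_def by force
  qed
  have third: "\<exists>c\<in>{1..N}. c \<noteq> a \<and> c \<noteq> b" for a b
  proof -
    have "(1 \<noteq> a \<and> 1 \<noteq> b) \<or> (2 \<noteq> a \<and> 2 \<noteq> b) \<or> (3 \<noteq> a \<and> 3 \<noteq> b)" by presburger
    moreover have "1 \<in> {1..N}" "2 \<in> {1..N}" "3 \<in> {1..N}" using N by auto
    ultimately show ?thesis by blast
  qed
  have diag: "P i t i i = P 1 t 1 1"
  proof -
    obtain a where a: "a \<in> {1..N}" "a \<noteq> i" using third by metis
    obtain b where b: "b \<in> {1..N}" "b \<noteq> i" "b \<noteq> a" using third by metis
    obtain \<sigma> where \<sigma>: "\<sigma> permutes {1..N}" "\<sigma> i = 1" "\<sigma> a = 2" "\<sigma> b = 3"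
      using permutation_to_123[OF i a(1) b(1)] a b by metis
    show ?thesis using inv[OF \<sigma>(1) i i i] \<sigma> by simp
  qed
  have two: "P i t i l = P 1 t 1 2" "P i t l l = P 1 t 2 2" if l: "l \<in> {1..N}" "l \<noteq> i" for l
  proof -
    obtain b where b: "b \<in> {1..N}" "b \<noteq> i" "b \<noteq> l" using third by metis
    obtain \<sigma> where \<sigma>: "\<sigma> permutes {1..N}" "\<sigma> i = 1" "\<sigma> l = 2" "\<sigma> b = 3"
      using permutation_to_123[OF i l(1) b(1)] l b by metis
    show "P i t i l = P 1 t 1 2" "P i t l l = P 1 t 2 2"
      using inv[OF \<sigma>(1) i i l(1)] inv[OF \<sigma>(1) i l(1) l(1)] \<sigma> by simp_all
  qed
  have three: "P i t j l = P 1 t 2 3" if ne: "j \<noteq> i" "l \<noteq> i" "j \<noteq> l"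
  proof -
    obtain \<sigma> where \<sigma>: "\<sigma> permutes {1..N}" "\<sigma> i = 1" "\<sigma> j = 2" "\<sigma> l = 3"
      using permutation_to_123[OF i j l] ne by metis
    show ?thesis using inv[OF \<sigma>(1) i j l] \<sigma> by simp
  qed
  show ?thesis
    unfolding exchangeable_def using diag two j l three sym[OF i, of j] by auto
qed

text \<open>
  Block \<open>(3, 2)\<close> is the transpose of block \<open>(2, 3)\<close> by symmetry and equal to it by exchangeability.
\<close>

lemma riccati_solution_symmetric_blocks:
  assumes P: "solves N P" and N: "3 \<le> N" and t: "t \<in> {0..T}"
  shows "transpose (P 1 t 1 1) = P 1 t 1 1" "transpose (P 1 t 2 2) = P 1 t 2 2"
    "transpose (P 1 t 2 3) = P 1 t 2 3"
proof -
  have "1 \<in> {1..N}" "2 \<in> {1..N}" "3 \<in> {1..N}" using N by auto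
  moreover from this have "P 1 t 3 2 = P 1 t 2 3"
    using riccati_solution_exchangeable[OF P N t, of 1 3 2] by (simp add: exchangeable_def)
  moreover have "bsymmetric N (P 1 t)"
    using P t calculation(1) unfolding riccati_solution_def by blast
  ultimately show "transpose (P 1 t 1 1) = P 1 t 1 1" "transpose (P 1 t 2 2) = P 1 t 2 2"
    "transpose (P 1 t 2 3) = P 1 t 2 3"
    unfolding bsymmetric_def btranspose_def by metis+
qed

end

section \<open>The reduced vector field\<close>

type_synonym 'n blocks = "(real^'n^'n) \<times> (real^'n^'n) \<times> (real^'n^'n) \<times> (real^'n^'n)"

abbreviation x1 :: "'n::finite blocks \<Rightarrow> real^'n^'n" where "x1 x \<equiv> fst x"
abbreviation x2 :: "'n::finite blocks \<Rightarrow> real^'n^'n" where "x2 x \<equiv> fst (snd x)"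
abbreviation x3 :: "'n::finite blocks \<Rightarrow> real^'n^'n" where "x3 x \<equiv> fst (snd (snd x))"
abbreviation x4 :: "'n::finite blocks \<Rightarrow> real^'n^'n" where "x4 x \<equiv> snd (snd (snd x))"

definition sym_blocks :: "'n::finite blocks \<Rightarrow> bool"
  where "sym_blocks x \<longleftrightarrow> transpose (x1 x) = x1 x \<and> transpose (x3 x) = x3 x \<and> transpose (x4 x) = x4 x"

lemma norm_blocks_le: "norm (x :: 'n::finite blocks) \<le> norm (x1 x) + norm (x2 x) + norm (x3 x) + norm (x4 x)"
  using norm_Pair_le[of "x1 x" "snd x"] norm_Pair_le[of "x2 x" "snd (snd x)"]
    norm_Pair_le[of "x3 x" "x4 x"] by simp

lemma norm_block_le:
  fixes x :: "'n::finite blocks"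
  shows "norm (x1 x) \<le> norm x" "norm (x2 x) \<le> norm x" "norm (x3 x) \<le> norm x" "norm (x4 x) \<le> norm x"
proof -
  have 1: "norm (fst p) \<le> norm p" and 2: "norm (snd p) \<le> norm p"
    for p :: "'a::real_normed_vector \<times> 'b::real_normed_vector"
    by (metis norm_fst_le prod.collapse, metis norm_snd_le prod.collapse)
  show "norm (x1 x) \<le> norm x" "norm (x2 x) \<le> norm x" "norm (x3 x) \<le> norm x" "norm (x4 x) \<le> norm x"
    by (meson 1 2 order_trans)+
qed

lemma quadratic_form_norm_bound:
  fixes M :: "real^'k^'k"
  assumes "c * (v \<bullet> v) \<le> v \<bullet> (M *v v)"
  shows "c * norm v \<le> norm (M *v v)"
proof (cases "v = 0")
  case False
  have "c * norm v * norm v \<le> norm (M *v v) * norm v"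
    using assms norm_cauchy_schwarz[of v "M *v v"]
    by (simp add: power2_norm_eq_inner[symmetric] power2_eq_square mult_ac)
  then show ?thesis using False by simp
qed simp

context lq_game
begin

text \<open>
  The reduced system with parameter \<open>e\<close> is \<open>x' = - field e x\<close> with \<open>x T = terminal e\<close>. The array
  \<open>blift e x i\<close> is the matrix \<open>\<^bold>P\<^sub>i\<close> whose rescaled blocks are \<open>x\<close>.
\<close>

definition field :: "real \<Rightarrow> 'n blocks \<Rightarrow> 'n blocks"
  where "field e x = (F1 e (x1 x) (x2 x) (x3 x) (x4 x), F2 e (x1 x) (x2 x) (x3 x) (x4 x),
    F3 e (x1 x) (x2 x) (x3 x) (x4 x), F4 e (x1 x) (x2 x) (x3 x) (x4 x))"

definition terminal :: "real \<Rightarrow> 'n blocks"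
  where "terminal e =
    (transpose (mat 1 - e *\<^sub>R \<Gamma>\<^sub>f) ** Q\<^sub>f ** (mat 1 - e *\<^sub>R \<Gamma>\<^sub>f),
     - (transpose (mat 1 - e *\<^sub>R \<Gamma>\<^sub>f) ** Q\<^sub>f ** \<Gamma>\<^sub>f),
     transpose \<Gamma>\<^sub>f ** Q\<^sub>f ** \<Gamma>\<^sub>f, transpose \<Gamma>\<^sub>f ** Q\<^sub>f ** \<Gamma>\<^sub>f)"

definition blift :: "real \<Rightarrow> 'n blocks \<Rightarrow> nat \<Rightarrow> ('n, 'n) barray"
  where "blift e x = lift e (x1 x) (x2 x) (x3 x) (x4 x)"

definition bcpl :: "real \<Rightarrow> 'n blocks \<Rightarrow> real^'m^'m"
  where "bcpl e x = cpl e (x1 x) (x2 x) (x3 x) (x4 x)"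

definition bnoise0 :: "real \<Rightarrow> 'n blocks \<Rightarrow> real^'m^'m"
  where "bnoise0 e x = noise0 e (x1 x) (x2 x) (x3 x) (x4 x)"

lemma wgt_sym: "transpose x = x \<Longrightarrow> transpose (wgt x) = wgt x"
  by (simp add: wgt_def transpose_simps R_sym matrix_mul_assoc)

lemma bounded_linear_blift: "bounded_linear (\<lambda>x. blift e x i j l)"
proof -
  have "linear (\<lambda>x. blift e x i j l)"
    by (rule linearI)
      (auto simp: blift_def lift_def exchangeable_def transpose_simps algebra_simps)
  then show ?thesis by (simp add: linear_conv_bounded_linear)
qed

context
  fixes N :: nat and e :: real and x :: "'n blocks"
  assumes N: "3 \<le> N" and e: "e = 1 / real N" and sym: "sym_blocks x"
begin

lemmas block_syms = sym[unfolded sym_blocks_def, THEN conjunct1]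
  sym[unfolded sym_blocks_def, THEN conjunct2, THEN conjunct1]
  sym[unfolded sym_blocks_def, THEN conjunct2, THEN conjunct2]

lemma blift_transpose: "transpose (blift e x i j l) = blift e x i l j"
  unfolding blift_def by (rule lift_sym[OF N e block_syms])

lemma blift_Rk: "k \<in> {1..N} \<Longrightarrow> Wgt N (blift e x) k = wgt (x1 x)"
  unfolding blift_def by (rule lift_Rk[OF N e block_syms])

lemma blift_S0: "k \<in> {1..N} \<Longrightarrow> Sig N (blift e x) k = e\<^sup>2 *\<^sub>R bnoise0 e x"
  unfolding blift_def bnoise0_def by (rule lift_S0[OF N e block_syms])

lemma blift_coupling: "Cpl N (blift e x) = bcpl e x"
  unfolding blift_def bcpl_def by (rule lift_coupling[OF N e block_syms])

context
  assumes inv: "invertible (wgt (x1 x))"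
begin

text \<open>
  At exchangeable arrays the right-hand side of the Riccati equation is exchangeable again. Its
  blocks \<open>(l, i)\<close> are the transposes of the blocks \<open>(i, l)\<close>.
\<close>

lemma rhs_blift:
  assumes i: "i \<in> {1..N}" and j: "j \<in> {1..N}" and l: "l \<in> {1..N}"
  shows "rhs N (blift e x) i j l = blift e (field e x) i j l"
proof -
  have 12: "rhs N (blift e x) i i l = e *\<^sub>R x2 (field e x)" if "l \<in> {1..N}" "l \<noteq> i" for l
    unfolding blift_def using rhs_lift_12[OF N e block_syms i that] by (simp add: field_def)
  have 21: "rhs N (blift e x) i l i = e *\<^sub>R transpose (x2 (field e x))" if l: "l \<in> {1..N}" "l \<noteq> i" for l
  proof -
    have "rhs N (blift e x) i l i = transpose (rhs N (blift e x) i i l)"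
      by (rule riccati_rhs_transpose[symmetric]) (use blift_transpose blift_Rk inv i l in auto)
    then show ?thesis using 12[OF l] by (simp add: transpose_simps)
  qed
  consider "j = i" "l = i" | "j = i" "l \<noteq> i" | "j \<noteq> i" "l = i" | "j \<noteq> i" "l \<noteq> i" "j = l"
    | "j \<noteq> i" "l \<noteq> i" "j \<noteq> l" by blast
  then show ?thesis
  proof cases
    case 1
    then show ?thesis
      unfolding blift_def using rhs_lift_11[OF N e block_syms i] by (simp add: lift_blocks field_def)
  next
    case 2
    then show ?thesis using 12[OF l] by (simp add: blift_def lift_blocks)
  next
    case 3
    then show ?thesis using 21[OF j] by (simp add: blift_def lift_blocks)
  next
    case 4
    then show ?thesis
      unfolding blift_def using rhs_lift_22[OF N e block_syms i l] by (simp add: lift_blocks field_def)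
  next
    case 5
    then show ?thesis
      unfolding blift_def using rhs_lift_23[OF N e block_syms i j l] by (simp add: lift_blocks field_def)
  qed
qed

lemma sym_field: "sym_blocks (field e x)"
proof -
  have in': "1 \<in> {1..N}" "2 \<in> {1..N}" "3 \<in> {1..N}" using N by auto
  have "transpose (blift e (field e x) 1 j l) = blift e (field e x) 1 l j"
    if "j \<in> {1..N}" "l \<in> {1..N}" for j l
    unfolding rhs_blift[OF in'(1) that, symmetric] rhs_blift[OF in'(1) that(2,1), symmetric]
    by (rule riccati_rhs_transpose) (use blift_transpose blift_Rk inv in' that in auto)
  from this[OF in'(1,1)] this[OF in'(2,2)] this[OF in'(2,3)] show ?thesis
    using N unfolding sym_blocks_def e by (simp add: blift_def lift_def exchangeable_def transpose_simps)
qed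

end

end

lemma terminal_blift:
  assumes "0 < N" and "e = 1 / real N"
  shows "blift e (terminal e) i j l = Qfc N i j l"
  unfolding bigQf_eq assms(2)[symmetric] blift_def lift_def exchangeable_def terminal_def
  by (auto simp: transpose_simps mm_linear Qf_sym matrix_mul_assoc power2_eq_square scaleR_diff_right)

lemma sym_terminal: "sym_blocks (terminal e)"
  by (simp add: sym_blocks_def terminal_def transpose_simps Qf_sym matrix_mul_assoc)

text \<open>
  For \<open>0 < c\<close>, all ingredients of \<open>field\<close> are bounded on this set, except possibly the inverse of \<open>bcpl\<close>,
  which is controlled by taking \<open>\<delta>\<close> small.
\<close>

definition region :: "real \<Rightarrow> real \<Rightarrow> real \<Rightarrow> (real \<times> 'n blocks) set"
  where "region K c \<delta> = {(e, x). 0 \<le> e \<and> e \<le> \<delta> \<and> norm x \<le> K \<and>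
    (\<forall>v. c * (v \<bullet> v) \<le> v \<bullet> (wgt (x1 x) *v v))}"

lemma region_coords_bounded_lipschitz:
  assumes "\<delta> \<le> 1"
  shows "bounded_lipschitz (region K c \<delta>) dist fst" "bounded_lipschitz (region K c \<delta>) dist snd"
proof -
  have "norm (fst z) \<le> 1" "norm (snd z) \<le> K" if "z \<in> region K c \<delta>" for z
    using that assms by (auto simp: region_def)
  moreover have "norm (fst z - fst w) \<le> 1 * dist z w" "norm (snd z - snd w) \<le> 1 * dist z w"
    for z w :: "real \<times> 'n blocks"
    using dist_fst_le[of z w] dist_snd_le[of z w] by (simp_all add: dist_norm)
  ultimately show "bounded_lipschitz (region K c \<delta>) dist fst" "bounded_lipschitz (region K c \<delta>) dist snd"
    unfolding bounded_lipschitz_def by blast+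
qed

lemma region_invertible:
  assumes "0 < c" "(e, x) \<in> region K c \<delta>"
  shows "c * norm v \<le> norm (wgt (x1 x) *v v)" "invertible (wgt (x1 x))"
proof -
  show "c * norm v \<le> norm (wgt (x1 x) *v v)" for v
    using assms by (intro quadratic_form_norm_bound) (simp add: region_def)
  then show "invertible (wgt (x1 x))" using assms(1) by (rule invertible_bounded_below[rotated])
qed

lemma gain_noise0_bounded_lipschitz:
  assumes "0 < c" "\<delta> \<le> 1"
  shows "bounded_lipschitz (region K c \<delta>) dist (\<lambda>z. gain (x1 (snd z)))"
    and "bounded_lipschitz (region K c \<delta>) dist (\<lambda>z. bnoise0 (fst z) (snd z))"
proof -
  note 0 = region_coords_bounded_lipschitz[OF assms(2), of K c]
  have "bounded_lipschitz (region K c \<delta>) dist (\<lambda>z. wgt (x1 (snd z)))"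
    unfolding wgt_def by (rule 0 | rule blip)+
  then show "bounded_lipschitz (region K c \<delta>) dist (\<lambda>z. gain (x1 (snd z)))"
    unfolding gain_def using assms(1)
    by (rule blip_matrix_inv) (metis region_invertible(1) assms(1) prod.collapse)
  show "bounded_lipschitz (region K c \<delta>) dist (\<lambda>z. bnoise0 (fst z) (snd z))"
    unfolding bnoise0_def noise0_def own_row_def other_row_def by (rule 0 | rule blip)+
qed

text \<open>
  Both estimates express that \<open>\<^bold>B\<^sub>0\<^sup>T \<^bold>P\<^sub>k \<^bold>B\<^sub>0\<close> is of order \<open>e\<^sup>2\<close>: its sum over the players is a small
  perturbation of the identity in condition (iii), and a single one is a small perturbation of
  \<open>R\<^sub>k\<close> in condition (ii).
\<close>

lemma coupling_uniformly_invertible: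
  assumes c: "0 < c"
  shows "\<exists>\<delta>. 0 < \<delta> \<and> \<delta> \<le> 1 \<and> (\<forall>(e, x)\<in>region K c \<delta>. (\<forall>v. 1/2 * norm v \<le> norm (bcpl e x *v v)) \<and>
    (\<forall>v. e\<^sup>2 * \<bar>v \<bullet> (bnoise0 e x *v v)\<bar> \<le> c / 2 * (v \<bullet> v)))"
proof -
  note 0 = gain_noise0_bounded_lipschitz[OF c order.refl, of K]
  obtain C where C: "C > 0" "\<And>(X::real^'m^'m) v. norm (X *v v) \<le> norm X * norm v * C"
    using mv.pos_bounded by blast
  obtain K1 where K1: "\<forall>z\<in>region K c 1. norm (gain (x1 (snd z)) ** bnoise0 (fst z) (snd z)) \<le> K1"
    using blip_ops(1)[OF 0] unfolding bounded_lipschitz_def by blast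
  obtain K2 where K2: "\<forall>z\<in>region K c 1. norm (bnoise0 (fst z) (snd z)) \<le> K2"
    using 0(2) unfolding bounded_lipschitz_def by blast
  define \<delta> where "\<delta> = min 1 (min (1 / (2 * (\<bar>K1\<bar> + 1) * C)) (c / (2 * (\<bar>K2\<bar> + 1) * C)))"
  have pos: "0 < 2 * (\<bar>K1\<bar> + 1) * C" "0 < 2 * (\<bar>K2\<bar> + 1) * C" using C by auto
  have \<delta>: "0 < \<delta>" "\<delta> \<le> 1" "\<delta> * (2 * (\<bar>K1\<bar> + 1) * C) \<le> 1" "\<delta> * (2 * (\<bar>K2\<bar> + 1) * C) \<le> c"
  proof -
    show "0 < \<delta>" "\<delta> \<le> 1" using c pos unfolding \<delta>_def by auto
    have "\<delta> \<le> 1 / (2 * (\<bar>K1\<bar> + 1) * C)" "\<delta> \<le> c / (2 * (\<bar>K2\<bar> + 1) * C)"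
      unfolding \<delta>_def by auto
    then show "\<delta> * (2 * (\<bar>K1\<bar> + 1) * C) \<le> 1" "\<delta> * (2 * (\<bar>K2\<bar> + 1) * C) \<le> c"
      using pos by (simp_all only: pos_le_divide_eq)
  qed
  have "1/2 * norm v \<le> norm (bcpl e x *v v)" "e\<^sup>2 * \<bar>v \<bullet> (bnoise0 e x *v v)\<bar> \<le> c / 2 * (v \<bullet> v)"
    if ex: "(e, x) \<in> region K c \<delta>" for e x v
  proof -
    have e: "0 \<le> e" "e \<le> \<delta>" "e \<le> 1" and ex1: "(e, x) \<in> region K c 1"
      using ex \<delta> by (auto simp: region_def)
    let ?X = "gain (x1 x) ** bnoise0 e x"
    have "norm (e *\<^sub>R (?X *v v)) \<le> \<delta> * ((\<bar>K1\<bar> + 1) * norm v * C)"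
    proof -
      have "norm ?X \<le> \<bar>K1\<bar> + 1" using K1 ex1 by fastforce
      then have "norm ?X * norm v * C \<le> (\<bar>K1\<bar> + 1) * norm v * C"
        using C by (intro mult_right_mono) auto
      with C(2)[of ?X v] have "norm (?X *v v) \<le> (\<bar>K1\<bar> + 1) * norm v * C" by linarith
      then show ?thesis using e \<delta> by (simp del: mult_le_cancel_left) (intro mult_mono; simp)
    qed
    also have "\<dots> = \<delta> * (2 * (\<bar>K1\<bar> + 1) * C) * (1/2 * norm v)" by (simp add: field_simps)
    also have "\<dots> \<le> 1 * (1/2 * norm v)" using \<delta>(3) by (intro mult_right_mono) auto
    finally have small: "norm (e *\<^sub>R (?X *v v)) \<le> 1/2 * norm v" by simp
    have "norm v \<le> norm (v + e *\<^sub>R (?X *v v)) + norm (e *\<^sub>R (?X *v v))"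
      using norm_triangle_ineq4[of "v + e *\<^sub>R (?X *v v)" "e *\<^sub>R (?X *v v)"] by simp
    moreover have "bcpl e x *v v = v + e *\<^sub>R (?X *v v)"
      by (simp add: bcpl_def cpl_def bnoise0_def mv.add_left mv.scaleR_left)
    ultimately show "1/2 * norm v \<le> norm (bcpl e x *v v)" using small by simp
    let ?Y = "bnoise0 e x"
    have "\<bar>v \<bullet> (?Y *v v)\<bar> \<le> norm v * norm (?Y *v v)" by (rule Cauchy_Schwarz_ineq2)
    also have "\<dots> \<le> norm v * ((\<bar>K2\<bar> + 1) * norm v * C)"
    proof (intro mult_left_mono)
      have "norm ?Y \<le> \<bar>K2\<bar> + 1" using K2 ex1 by fastforce
      then have "norm ?Y * norm v * C \<le> (\<bar>K2\<bar> + 1) * norm v * C"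
        using C by (intro mult_right_mono) auto
      with C(2)[of ?Y v] show "norm (?Y *v v) \<le> (\<bar>K2\<bar> + 1) * norm v * C" by linarith
    qed simp
    finally have "\<bar>v \<bullet> (?Y *v v)\<bar> \<le> (\<bar>K2\<bar> + 1) * C * (v \<bullet> v)"
      by (simp add: power2_norm_eq_inner[symmetric] power2_eq_square mult_ac)
    moreover have "e\<^sup>2 \<le> \<delta>" using e power_le_one[of e 1] mult_mono[of e \<delta> e 1] by (simp add: power2_eq_square)
    ultimately have "e\<^sup>2 * \<bar>v \<bullet> (?Y *v v)\<bar> \<le> \<delta> * ((\<bar>K2\<bar> + 1) * C * (v \<bullet> v))"
      using \<delta>(1) by (intro mult_mono) auto
    also have "\<dots> = \<delta> * (2 * (\<bar>K2\<bar> + 1) * C) * (1/2 * (v \<bullet> v))" by (simp add: field_simps)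
    also have "\<dots> \<le> c * (1/2 * (v \<bullet> v))" using \<delta>(4) by (intro mult_right_mono) auto
    finally show "e\<^sup>2 * \<bar>v \<bullet> (?Y *v v)\<bar> \<le> c / 2 * (v \<bullet> v)" by simp
  qed
  then show ?thesis using \<delta> by (intro exI[of _ \<delta>]) auto
qed

lemma field_bounded_lipschitz:
  assumes c: "0 < c" and \<delta>: "\<delta> \<le> 1"
    and cpl: "\<And>e x v. (e, x) \<in> region K c \<delta> \<Longrightarrow> 1/2 * norm v \<le> norm (bcpl e x *v v)"
  shows "bounded_lipschitz (region K c \<delta>) dist (\<lambda>z. field (fst z) (snd z))"
proof -
  let ?lip = "bounded_lipschitz (region K c \<delta>) dist"
  let ?at = "\<lambda>f z. f (fst z) (x1 (snd z)) (x2 (snd z)) (x3 (snd z)) (x4 (snd z))"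
  note 0 = region_coords_bounded_lipschitz[OF \<delta>, of K c]
  note 1 = gain_noise0_bounded_lipschitz[OF c \<delta>, of K, unfolded bnoise0_def]
  have "?lip (\<lambda>z. bcpl (fst z) (snd z))"
    unfolding bcpl_def cpl_def by (rule 0 1 | rule blip)+
  then have "?lip (\<lambda>z. matrix_inv (bcpl (fst z) (snd z)))"
    by (rule blip_matrix_inv[of _ _ _ "1/2"]) (use cpl in auto)
  note Ci = this[unfolded bcpl_def]
  have 2: "?lip (?at mean_fb)"
    unfolding mean_fb_def own_row_def by (rule 0 1 Ci | rule blip)+
  have 3: "?lip (?at resp1)"
    "?lip (?at resp2)"
    unfolding resp1_def resp2_def power2_eq_square by (rule 0 1 2 | rule blip)+
  have 4: "?lip
      (\<lambda>z. noise1 (x1 (snd z)) (x3 (snd z)))"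
    "?lip (?at mean_cost)"
    "?lip (?at mean_cost')"
    unfolding noise1_def mean_cost_def mean_cost'_def by (rule 0 1 2 | rule blip)+
  have 5: "?lip (\<lambda>z. own_row (fst z) (x1 (snd z)) (x2 (snd z)))"
    "?lip (\<lambda>z. other_row (fst z) (x2 (snd z)) (x3 (snd z)) (x4 (snd z)))"
    unfolding own_row_def other_row_def by (rule 0 | rule blip)+
  have "?lip (?at F1)"
    unfolding F1_def power2_eq_square power3_eq_cube power4_eq_xxxx by (rule 0 1 3 4 5 | rule blip)+
  moreover have "?lip (?at F2)"
    unfolding F2_def power2_eq_square power3_eq_cube by (rule 0 1 3 4 5 | rule blip)+
  moreover have "?lip (?at F3)"
    unfolding F3_def power2_eq_square by (rule 0 1 3 4 5 | rule blip)+
  moreover have "?lip (?at F4)"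
    unfolding F4_def power2_eq_square by (rule 0 1 3 4 5 | rule blip)+
  ultimately show ?thesis unfolding field_def by (intro blip_Pair)
qed

end

section \<open>From the game to the limit system\<close>

context lq_game
begin

lemma terminal_lipschitz:
  "\<exists>C\<ge>0. \<forall>e\<in>{0..1}. \<forall>e'\<in>{0..1}. norm (terminal e - terminal e') \<le> C * \<bar>e - e'\<bar>"
proof -
  have 0: "bounded_lipschitz {0..1::real} dist (\<lambda>e. e)"
    unfolding bounded_lipschitz_def
    by (intro conjI exI[of _ 1]) (auto simp: dist_norm)
  have "bounded_lipschitz {0..1::real} dist terminal"
    unfolding terminal_def by (rule 0 | rule blip)+
  then obtain C where C: "\<And>e e'. e \<in> {0..1} \<Longrightarrow> e' \<in> {0..1} \<Longrightarrow> norm (terminal e - terminal e') \<le> C * dist e e'"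
    unfolding bounded_lipschitz_def by blast
  have "norm (terminal e - terminal e') \<le> max C 0 * \<bar>e - e'\<bar>" if "e \<in> {0..1}" "e' \<in> {0..1}" for e e'
    using C[OF that] mult_right_mono[of C "max C 0" "\<bar>e - e'\<bar>"] by (simp add: dist_real_def)
  then show ?thesis by (intro exI[of _ "max C 0"]) auto
qed

lemma field_lipschitz:
  assumes "0 < c" "\<delta> \<le> 1"
    and "\<And>e x v. (e, x) \<in> region K c \<delta> \<Longrightarrow> 1/2 * norm v \<le> norm (bcpl e x *v v)"
  shows "\<exists>L\<ge>0. \<forall>e x e' x'. (e, x) \<in> region K c \<delta> \<longrightarrow> (e', x') \<in> region K c \<delta> \<longrightarrow>
    norm (field e x - field e' x') \<le> L * (\<bar>e - e'\<bar> + norm (x - x'))"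
proof -
  obtain L where L: "\<And>z w. z \<in> region K c \<delta> \<Longrightarrow> w \<in> region K c \<delta> \<Longrightarrow>
      norm (field (fst z) (snd z) - field (fst w) (snd w)) \<le> L * dist z w"
    using field_bounded_lipschitz[OF assms] unfolding bounded_lipschitz_def by blast
  have "norm (field e x - field e' x') \<le> max L 0 * (\<bar>e - e'\<bar> + norm (x - x'))"
    if "(e, x) \<in> region K c \<delta>" "(e', x') \<in> region K c \<delta>" for e x e' x'
  proof -
    have "norm (field e x - field e' x') \<le> L * dist (e, x) (e', x')" using L[OF that] by simp
    also have "\<dots> \<le> max L 0 * dist (e, x) (e', x')" by (intro mult_right_mono) auto
    also have "dist (e, x) (e', x') \<le> \<bar>e - e'\<bar> + norm (x - x')"
      using norm_Pair_le[of "e - e'" "x - x'"] by (simp add: dist_norm)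
    finally show ?thesis by (simp add: mult_left_mono)
  qed
  then show ?thesis by (intro exI[of _ "max L 0"]) auto
qed

definition reduced :: "nat \<Rightarrow> (nat \<Rightarrow> real \<Rightarrow> ('n, 'n) barray) \<Rightarrow> real \<Rightarrow> 'n blocks"
  where "reduced N P t = (P 1 t 1 1, real N *\<^sub>R P 1 t 1 2,
    (real N)\<^sup>2 *\<^sub>R P 1 t 2 2, (real N)\<^sup>2 *\<^sub>R P 1 t 2 3)"

context
  fixes N P
  assumes P: "solves N P" and N: "3 \<le> N"
begin

lemma sym_reduced: "t \<in> {0..T} \<Longrightarrow> sym_blocks (reduced N P t)"
  using riccati_solution_symmetric_blocks[OF P N]
  by (simp add: sym_blocks_def reduced_def transpose_simps del: One_nat_def)

text \<open>
  The blocks of \<open>\<^bold>P\<^sub>1\<close> determine the whole solution by exchangeability.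
\<close>

lemma blift_reduced:
  assumes "t \<in> {0..T}" "i \<in> {1..N}" "j \<in> {1..N}" "l \<in> {1..N}"
  shows "P i t j l = blift (1 / real N) (reduced N P t) i j l"
proof -
  have "(1 / real N)\<^sup>2 *\<^sub>R ((real N)\<^sup>2 *\<^sub>R X) = X" "(1 / real N) *\<^sub>R (real N *\<^sub>R X) = X" for X :: "real^'n^'n"
    using N by (simp_all add: power_one_over)
  then show ?thesis
    using riccati_solution_exchangeable[OF P N assms] unfolding blift_def lift_def reduced_def
    by (simp only: fst_conv snd_conv)
qed

lemma wgt_reduced: "t \<in> {0..T} \<Longrightarrow> i \<in> {1..N} \<Longrightarrow> Wgt N (\<lambda>k. P k t) i = wgt (x1 (reduced N P t))"
  using blift_reduced[of t i i i] by (simp add: Rk_eq wgt_def blift_def lift_blocks)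

lemma reduced_solves:
  assumes t: "t \<in> {0..T}"
  shows "(reduced N P has_vector_derivative - field (1 / real N) (reduced N P t)) (at t within {0..T})"
proof -
  let ?e = "1 / real N"
  define x where "x = reduced N P t"
  have in': "1 \<in> {1..N}" "2 \<in> {1..N}" "3 \<in> {1..N}" using N by auto
  have inv: "invertible (wgt (x1 x))"
    using solves_Rk_invertible[OF P in'(1) t] wgt_reduced[OF t in'(1)] by (simp add: x_def)
  have d: "((\<lambda>s. P 1 s j l) has_vector_derivative - blift ?e (field ?e x) 1 j l) (at t within {0..T})"
    if "j \<in> {1..N}" "l \<in> {1..N}" for j l
  proof -
    have "rhs N (\<lambda>k. P k t) 1 j l = rhs N (blift ?e x) 1 j l"
      by (rule riccati_rhs_cong) (use blift_reduced[OF t, folded x_def] in' that in auto)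
    then show ?thesis
      using solves_block_derivative[OF P in'(1) that t] rhs_blift[OF N refl sym_reduced[OF t, folded x_def] inv in'(1) that]
      by simp
  qed
  have "((\<lambda>t. (P 1 t 1 1, real N *\<^sub>R P 1 t 1 2, (real N)\<^sup>2 *\<^sub>R P 1 t 2 2,
      (real N)\<^sup>2 *\<^sub>R P 1 t 2 3)) has_vector_derivative
      (- blift ?e (field ?e x) 1 1 1, real N *\<^sub>R - blift ?e (field ?e x) 1 1 2,
      (real N)\<^sup>2 *\<^sub>R - blift ?e (field ?e x) 1 2 2, (real N)\<^sup>2 *\<^sub>R - blift ?e (field ?e x) 1 2 3))
      (at t within {0..T})"
    by (intro has_vector_derivative_Pair bounded_linear.has_vector_derivative[OF bounded_linear_scaleR_right] d in')
  also have "(- blift ?e (field ?e x) 1 1 1, real N *\<^sub>R - blift ?e (field ?e x) 1 1 2,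
      (real N)\<^sup>2 *\<^sub>R - blift ?e (field ?e x) 1 2 2, (real N)\<^sup>2 *\<^sub>R - blift ?e (field ?e x) 1 2 3)
      = - field ?e x"
    using N by (simp add: blift_def lift_blocks prod_eq_iff power_one_over)
  also have "(\<lambda>t. (P 1 t 1 1, real N *\<^sub>R P 1 t 1 2, (real N)\<^sup>2 *\<^sub>R P 1 t 2 2,
      (real N)\<^sup>2 *\<^sub>R P 1 t 2 3)) = reduced N P"
    by (simp add: fun_eq_iff reduced_def)
  finally show ?thesis by (simp only: x_def)
qed

lemma reduced_terminal: "reduced N P T = terminal (1 / real N)"
proof -
  have in': "1 \<in> {1..N}" "2 \<in> {1..N}" "3 \<in> {1..N}" using N by auto
  have "P 1 T j l = blift (1 / real N) (terminal (1 / real N)) 1 j l" if "j \<in> {1..N}" "l \<in> {1..N}" for j l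
  proof -
    have "P 1 T j l = Qfc N 1 j l" using P in'(1) that unfolding riccati_solution_def by blast
    moreover have "blift (1 / real N) (terminal (1 / real N)) 1 j l = Qfc N 1 j l"
      using N by (intro terminal_blift) auto
    ultimately show ?thesis by simp
  qed
  then show ?thesis
    using N in' unfolding reduced_def by (simp add: blift_def lift_blocks prod_eq_iff power_one_over)
qed

end

lemma region_closed:
  assumes x: "\<And>n. (e n, x n) \<in> region K c \<delta>" and lim: "e \<longlonglongrightarrow> e'" "x \<longlonglongrightarrow> x'"
  shows "(e', x') \<in> region K c \<delta>"
proof -
  have b: "0 \<le> e n" "e n \<le> \<delta>" "norm (x n) \<le> K" "c * (v \<bullet> v) \<le> v \<bullet> (wgt (x1 (x n)) *v v)" for n v
    using x[of n] by (auto simp: region_def)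
  have "0 \<le> e'" "e' \<le> \<delta>" "norm x' \<le> K"
    using b lim tendsto_norm[OF lim(2)]
    by (auto intro: LIMSEQ_le_const LIMSEQ_le_const2)
  moreover have "c * (v \<bullet> v) \<le> v \<bullet> (wgt (x1 x') *v v)" for v
  proof (rule LIMSEQ_le_const)
    show "(\<lambda>n. v \<bullet> (wgt (x1 (x n)) *v v)) \<longlonglongrightarrow> v \<bullet> (wgt (x1 x') *v v)"
      unfolding wgt_def by (intro tendsto_intros mm.tendsto mv.tendsto lim)
    show "\<exists>N. \<forall>n\<ge>N. c * (v \<bullet> v) \<le> v \<bullet> (wgt (x1 (x n)) *v v)" using b by blast
  qed
  ultimately show ?thesis by (simp add: region_def)
qed

lemma sym_blocks_limit:
  fixes x :: "nat \<Rightarrow> 'n blocks"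
  assumes "\<And>n. sym_blocks (x n)" "x \<longlonglongrightarrow> y"
  shows "sym_blocks y"
proof -
  have *: "transpose (f y) = f y" if f: "bounded_linear f" and s: "\<And>n. transpose (f (x n)) = f (x n)"
    for f :: "'n blocks \<Rightarrow> real^'n^'n"
  proof (rule LIMSEQ_unique)
    show lim: "(\<lambda>n. f (x n)) \<longlonglongrightarrow> f y" by (rule bounded_linear.tendsto[OF f assms(2)])
    show "(\<lambda>n. f (x n)) \<longlonglongrightarrow> transpose (f y)"
      using bounded_linear.tendsto[OF bounded_linear_transpose lim] by (simp only: s)
  qed
  have "bounded_linear (x1 :: 'n blocks \<Rightarrow> _)" "bounded_linear (x3 :: 'n blocks \<Rightarrow> _)"
    "bounded_linear (x4 :: 'n blocks \<Rightarrow> _)"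
    by (rule bounded_linear_fst bounded_linear_fst_comp[OF bounded_linear_snd_comp[OF bounded_linear_snd]]
        bounded_linear_snd_comp[OF bounded_linear_snd_comp[OF bounded_linear_snd]])+
  from this[THEN *] show ?thesis
    using assms(1) unfolding sym_blocks_def by blast
qed

text \<open>
  Two solutions with parameters \<open>\<epsilon> n\<close> and \<open>\<epsilon> m\<close> satisfy a differential inequality with Lipschitz
  constant \<open>L\<close> and defect \<open>L * \<bar>\<epsilon> n - \<epsilon> m\<bar>\<close>, so by Gronwall they differ by at most a constant times
  \<open>\<bar>\<epsilon> n - \<epsilon> m\<bar>\<close>. The sequence therefore converges uniformly, its derivatives do as well, and the limit
  may be differentiated termwise.
\<close>

proposition reduced_limit:
  fixes x :: "nat \<Rightarrow> real \<Rightarrow> 'n blocks" and \<epsilon> :: "nat \<Rightarrow> real"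
  assumes c: "0 < c" and \<delta>: "\<delta> \<le> 1"
    and cpl: "\<And>e x v. (e, x) \<in> region K c \<delta> \<Longrightarrow> 1/2 * norm v \<le> norm (bcpl e x *v v)"
    and \<epsilon>: "\<epsilon> \<longlonglongrightarrow> 0"
    and reg: "\<And>n t. t \<in> {0..T} \<Longrightarrow> (\<epsilon> n, x n t) \<in> region K c \<delta>"
    and sym: "\<And>n t. t \<in> {0..T} \<Longrightarrow> sym_blocks (x n t)"
    and der: "\<And>n t. t \<in> {0..T} \<Longrightarrow>
      (x n has_vector_derivative - field (\<epsilon> n) (x n t)) (at t within {0..T})"
    and fin: "\<And>n. x n T = terminal (\<epsilon> n)"
  shows "\<exists>y. y T = terminal 0 \<and> (\<forall>t\<in>{0..T}. (0, y t) \<in> region K c \<delta> \<and> sym_blocks (y t) \<and>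
    (y has_vector_derivative - field 0 (y t)) (at t within {0..T}))"
proof -
  obtain L where L: "0 \<le> L" "\<And>e x e' x'. (e, x) \<in> region K c \<delta> \<Longrightarrow> (e', x') \<in> region K c \<delta> \<Longrightarrow>
      norm (field e x - field e' x') \<le> L * (\<bar>e - e'\<bar> + norm (x - x'))"
    using field_lipschitz[OF c \<delta> cpl] by blast
  obtain C where C: "0 \<le> C" "\<And>e e'. e \<in> {0..1} \<Longrightarrow> e' \<in> {0..1} \<Longrightarrow>
      norm (terminal e - terminal e') \<le> C * \<bar>e - e'\<bar>"
    using terminal_lipschitz by blast
  have Tin: "T \<in> {0..T}" using T_pos by simp
  have \<epsilon>1: "\<epsilon> n \<in> {0..1}" for n using reg[OF Tin, of n] \<delta> by (auto simp: region_def)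
  define D where "D = sqrt ((C\<^sup>2 + L\<^sup>2) * exp ((2 * L + 1) * T))"
  have D: "D \<ge> 0" by (simp add: D_def)
  have close: "norm (x n t - x m t) \<le> D * \<bar>\<epsilon> n - \<epsilon> m\<bar>" if t: "t \<in> {0..T}" for n m t
  proof -
    have "(norm (x n t - x m t))\<^sup>2 \<le> ((norm (x n T - x m T))\<^sup>2 + (L * \<bar>\<epsilon> n - \<epsilon> m\<bar>)\<^sup>2) * exp ((2 * L + 1) * T)"
    proof (rule gronwall_norm[OF _ _ L(1) t])
      fix s assume s: "s \<in> {0..T}"
      show "((\<lambda>t. x n t - x m t) has_vector_derivative - field (\<epsilon> n) (x n s) - - field (\<epsilon> m) (x m s))
          (at s within {0..T})"
        by (intro has_vector_derivative_diff der s)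
      show "norm (- field (\<epsilon> n) (x n s) - - field (\<epsilon> m) (x m s))
          \<le> L * norm (x n s - x m s) + L * \<bar>\<epsilon> n - \<epsilon> m\<bar>"
        using L(2)[OF reg[OF s, of n] reg[OF s, of m]] by (simp add: norm_minus_commute algebra_simps)
    qed
    also have "\<dots> \<le> ((C * \<bar>\<epsilon> n - \<epsilon> m\<bar>)\<^sup>2 + (L * \<bar>\<epsilon> n - \<epsilon> m\<bar>)\<^sup>2) * exp ((2 * L + 1) * T)"
      using C(2)[OF \<epsilon>1 \<epsilon>1, of n m] by (intro mult_right_mono add_mono power_mono order.refl) (auto simp: fin)
    also have "\<dots> = (D * \<bar>\<epsilon> n - \<epsilon> m\<bar>)\<^sup>2"
      by (simp add: D_def power_mult_distrib algebra_simps)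
    finally show ?thesis by (rule power2_le_imp_le) (use D in simp)
  qed
  have conv: "convergent (\<lambda>n. x n t)" if t: "t \<in> {0..T}" for t
  proof -
    have "Cauchy (\<lambda>n. x n t)"
      unfolding Cauchy_def
    proof (intro allI impI)
      fix r :: real assume r: "r > 0"
      then have "r / (D + 1) > 0" using D by simp
      then obtain M where M: "\<And>m n. m \<ge> M \<Longrightarrow> n \<ge> M \<Longrightarrow> dist (\<epsilon> m) (\<epsilon> n) < r / (D + 1)"
        using LIMSEQ_imp_Cauchy[OF \<epsilon>] unfolding Cauchy_def by metis
      have "dist (x m t) (x n t) < r" if "m \<ge> M" "n \<ge> M" for m n
      proof -
        have "norm (x m t - x n t) \<le> D * \<bar>\<epsilon> m - \<epsilon> n\<bar>" by (rule close[OF t])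
        also have "\<dots> \<le> D * (r / (D + 1))"
          using M[OF that] D by (intro mult_left_mono) (auto simp: dist_real_def)
        also have "\<dots> < r" using D r by (simp add: field_simps)
        finally show ?thesis by (simp add: dist_norm)
      qed
      then show "\<exists>M. \<forall>m\<ge>M. \<forall>n\<ge>M. dist (x m t) (x n t) < r" by blast
    qed
    then show ?thesis by (simp add: Cauchy_convergent_iff)
  qed
  define y where "y t = lim (\<lambda>n. x n t)" for t
  have lim: "(\<lambda>n. x n t) \<longlonglongrightarrow> y t" if "t \<in> {0..T}" for t
    using conv[OF that] unfolding y_def by (simp add: convergent_LIMSEQ_iff)
  have yreg: "(0, y t) \<in> region K c \<delta>" if "t \<in> {0..T}" for t
    by (rule region_closed[OF reg[OF that] \<epsilon> lim[OF that]])
  have dist_y: "norm (x n t - y t) \<le> D * \<epsilon> n" if t: "t \<in> {0..T}" for n t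
  proof (rule LIMSEQ_le)
    show "(\<lambda>m. norm (x n t - x m t)) \<longlonglongrightarrow> norm (x n t - y t)" by (intro tendsto_intros lim t)
    have "(\<lambda>m. D * \<bar>\<epsilon> n - \<epsilon> m\<bar>) \<longlonglongrightarrow> D * \<bar>\<epsilon> n - 0\<bar>" by (intro tendsto_intros \<epsilon>)
    then show "(\<lambda>m. D * \<bar>\<epsilon> n - \<epsilon> m\<bar>) \<longlonglongrightarrow> D * \<epsilon> n" using \<epsilon>1[of n] by simp
    show "\<exists>M. \<forall>m\<ge>M. norm (x n t - x m t) \<le> D * \<bar>\<epsilon> n - \<epsilon> m\<bar>" using close[OF t] by blast
  qed
  have diff: "norm (h *\<^sub>R - field (\<epsilon> n) (x n t) - h *\<^sub>R - field 0 (y t)) \<le> L * (\<epsilon> n + D * \<epsilon> n) * norm h"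
    if t: "t \<in> {0..T}" for n t and h :: real
  proof -
    have "h *\<^sub>R - field (\<epsilon> n) (x n t) - h *\<^sub>R - field 0 (y t)
        = h *\<^sub>R (field 0 (y t) - field (\<epsilon> n) (x n t))"
      by (simp add: scaleR_diff_right)
    then have eq: "norm (h *\<^sub>R - field (\<epsilon> n) (x n t) - h *\<^sub>R - field 0 (y t))
        = \<bar>h\<bar> * norm (field (\<epsilon> n) (x n t) - field 0 (y t))"
      by (simp only: norm_scaleR norm_minus_commute)
    have "norm (field (\<epsilon> n) (x n t) - field 0 (y t)) \<le> L * (\<bar>\<epsilon> n - 0\<bar> + norm (x n t - y t))"
      by (rule L(2)[OF reg[OF t] yreg[OF t]])
    also have "\<dots> \<le> L * (\<epsilon> n + D * \<epsilon> n)"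
      using L(1) dist_y[OF t, of n] \<epsilon>1[of n] by (intro mult_left_mono add_mono) auto
    finally have "\<bar>h\<bar> * norm (field (\<epsilon> n) (x n t) - field 0 (y t)) \<le> \<bar>h\<bar> * (L * (\<epsilon> n + D * \<epsilon> n))"
      by (rule mult_left_mono) simp
    then show ?thesis unfolding eq by (simp add: mult.commute)
  qed
  have nle: "\<forall>\<^sub>F n in sequentially. \<forall>t\<in>{0..T}. \<forall>h.
      norm (h *\<^sub>R - field (\<epsilon> n) (x n t) - h *\<^sub>R - field 0 (y t)) \<le> r * norm h"
    if r: "r > 0" for r
  proof -
    have "(\<lambda>n. L * (\<epsilon> n + D * \<epsilon> n)) \<longlonglongrightarrow> L * (0 + D * 0)" by (intro tendsto_intros \<epsilon>)
    then have "\<forall>\<^sub>F n in sequentially. L * (\<epsilon> n + D * \<epsilon> n) < r" using r by (intro order_tendstoD(2)) auto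
    then show ?thesis
    proof (rule eventually_mono)
      fix n assume n: "L * (\<epsilon> n + D * \<epsilon> n) < r"
      have "L * (\<epsilon> n + D * \<epsilon> n) * norm h \<le> r * norm h" for h :: real
        using n by (intro mult_right_mono) auto
      then show "\<forall>t\<in>{0..T}. \<forall>h. norm (h *\<^sub>R - field (\<epsilon> n) (x n t) - h *\<^sub>R - field 0 (y t)) \<le> r * norm h"
        using diff order_trans by blast
    qed
  qed
  have "\<exists>g. \<forall>t\<in>{0..T}. (\<lambda>n. x n t) \<longlonglongrightarrow> g t \<and>
      (g has_derivative (\<lambda>h. h *\<^sub>R - field 0 (y t))) (at t within {0..T})"
    by (rule has_derivative_sequence[where f = x and ?x0.0 = T and l = "y T"
        and f' = "\<lambda>n t h. h *\<^sub>R - field (\<epsilon> n) (x n t)" and g' = "\<lambda>t h. h *\<^sub>R - field 0 (y t)"])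
      (use der nle Tin lim[OF Tin] in \<open>auto simp: has_vector_derivative_def\<close>)
  then obtain g where g: "\<And>t. t \<in> {0..T} \<Longrightarrow> (\<lambda>n. x n t) \<longlonglongrightarrow> g t"
    "\<And>t. t \<in> {0..T} \<Longrightarrow> (g has_vector_derivative - field 0 (y t)) (at t within {0..T})"
    unfolding has_vector_derivative_def by blast
  have gy: "g t = y t" if "t \<in> {0..T}" for t using g(1)[OF that] lim[OF that] by (rule LIMSEQ_unique)
  have "(y has_vector_derivative - field 0 (y t)) (at t within {0..T})" if t: "t \<in> {0..T}" for t
    by (rule has_vector_derivative_transform[OF t gy[symmetric] g(2)[OF t]])
  moreover have "y T = terminal 0"
  proof (rule LIMSEQ_unique[OF lim[OF Tin]])
    have "(\<lambda>n. norm (terminal (\<epsilon> n) - terminal 0)) \<longlonglongrightarrow> 0"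
    proof (rule tendsto_sandwich[of "\<lambda>_. 0" _ _ "\<lambda>n. C * \<epsilon> n"])
      show "\<forall>\<^sub>F n in sequentially. norm (terminal (\<epsilon> n) - terminal 0) \<le> C * \<epsilon> n"
        using C(2)[OF \<epsilon>1, of 0] \<epsilon>1 by (intro always_eventually) (auto simp: abs_of_nonneg)
      show "(\<lambda>n. C * \<epsilon> n) \<longlonglongrightarrow> 0" using tendsto_mult[OF tendsto_const \<epsilon>, of C] by simp
    qed auto
    then have "(\<lambda>n. terminal (\<epsilon> n)) \<longlonglongrightarrow> terminal 0"
      using LIM_zero_cancel tendsto_norm_zero_iff by blast
    then show "(\<lambda>n. x n T) \<longlonglongrightarrow> terminal 0" by (simp only: fin)
  qed
  moreover have "sym_blocks (y t)" if "t \<in> {0..T}" for t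
    using sym[OF that] lim[OF that] by (rule sym_blocks_limit)
  ultimately show ?thesis using yreg by blast
qed

text \<open>
  The bounds in the definition of asymptotic solvability put the rescaled solutions into one region,
  as soon as \<open>1/N \<le> \<delta>\<close> and \<open>3 \<le> N\<close>.
\<close>

lemma solvable_imp_limit_solution:
  assumes "asymptotically_solvable T A G \<Gamma> \<Gamma>\<^sub>f B B\<^sub>0 B\<^sub>1 Q Q\<^sub>f R"
  shows "\<exists>c>0. \<exists>y. y T = terminal 0 \<and> (\<forall>t\<in>{0..T}. (\<forall>v. c * (v \<bullet> v) \<le> v \<bullet> (wgt (x1 (y t)) *v v)) \<and>
    sym_blocks (y t) \<and> (y has_vector_derivative - field 0 (y t)) (at t within {0..T}))"
proof -
  obtain N0 c P where c: "c > 0" and sol: "\<And>N. N \<ge> N0 \<Longrightarrow> solves N (P N)"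
    and bdd: "bdd_above {norm (P N 1 t 1 1) + real N * norm (P N 1 t 1 2)
                  + (real N)\<^sup>2 * norm (P N 1 t 2 2) + (real N)\<^sup>2 * norm (P N 1 t 2 3)
                  | N t. N \<ge> N0 \<and> t \<in> {0..T}}"
    and psd: "\<And>N t i. N \<ge> N0 \<Longrightarrow> t \<in> {0..T} \<Longrightarrow> i \<in> {1..N} \<Longrightarrow>
      pos_semidef (Wgt N (\<lambda>k. P N k t) i - c *\<^sub>R mat 1)"
    using assms unfolding asymptotically_solvable_def by blast
  obtain K where K: "\<And>N t. N \<ge> N0 \<Longrightarrow> t \<in> {0..T} \<Longrightarrow> norm (P N 1 t 1 1) + real N * norm (P N 1 t 1 2)
      + (real N)\<^sup>2 * norm (P N 1 t 2 2) + (real N)\<^sup>2 * norm (P N 1 t 2 3) \<le> K"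
    using bdd unfolding bdd_above_def by blast
  obtain \<delta> where \<delta>: "0 < \<delta>" "\<delta> \<le> 1"
    "\<And>e x v. (e, x) \<in> region K c \<delta> \<Longrightarrow> 1/2 * norm v \<le> norm (bcpl e x *v v)"
    using coupling_uniformly_invertible[OF c, of K] by blast
  define M where "M = N0 + 3 + nat \<lceil>1 / \<delta>\<rceil>"
  define \<epsilon> where "\<epsilon> n = 1 / real (n + M)" for n
  define x where "x n = reduced (n + M) (P (n + M))" for n
  have M: "n + M \<ge> N0" "3 \<le> n + M" for n by (simp_all add: M_def)
  have \<epsilon>\<delta>: "0 \<le> \<epsilon> n" "\<epsilon> n \<le> \<delta>" for n
  proof -
    show "0 \<le> \<epsilon> n" by (simp add: \<epsilon>_def)
    have "1 / \<delta> \<le> real (n + M)" unfolding M_def by linarith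
    then show "\<epsilon> n \<le> \<delta>" unfolding \<epsilon>_def using \<delta>(1) M(2)[of n] by (simp add: field_simps)
  qed
  have reg: "(\<epsilon> n, x n t) \<in> region K c \<delta>" if t: "t \<in> {0..T}" for n t
  proof -
    have "norm (x n t) \<le> K"
      using norm_blocks_le[of "x n t"] K[OF M(1)[of n] t] by (simp add: x_def reduced_def)
    moreover have "c * (v \<bullet> v) \<le> v \<bullet> (wgt (x1 (x n t)) *v v)" for v
    proof -
      have 1: "1 \<in> {1..n + M}" using M(2)[of n] by simp
      have "0 \<le> v \<bullet> ((wgt (x1 (x n t)) - c *\<^sub>R mat 1) *v v)"
        using psd[OF M(1) t 1] unfolding wgt_reduced[OF sol[OF M(1)] M(2) t 1] x_def pos_semidef_def by blast
      then show ?thesis by (simp add: mv.diff_left mv.scaleR_left inner_diff_right)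
    qed
    ultimately show ?thesis using \<epsilon>\<delta>[of n] by (simp add: region_def)
  qed
  have "\<epsilon> \<longlonglongrightarrow> 0" unfolding \<epsilon>_def
    using LIMSEQ_ignore_initial_segment[OF lim_1_over_n, of M] by simp
  moreover have "sym_blocks (x n t)" "(x n has_vector_derivative - field (\<epsilon> n) (x n t)) (at t within {0..T})"
    if "t \<in> {0..T}" for n t
    unfolding x_def \<epsilon>_def
    by (rule sym_reduced[OF sol[OF M(1)] M(2) that] reduced_solves[OF sol[OF M(1)] M(2) that])+
  moreover have "x n T = terminal (\<epsilon> n)" for n
    unfolding x_def \<epsilon>_def by (rule reduced_terminal[OF sol[OF M(1)] M(2)])
  ultimately obtain y where "y T = terminal 0"
    "\<forall>t\<in>{0..T}. (0, y t) \<in> region K c \<delta> \<and> sym_blocks (y t) \<and>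
      (y has_vector_derivative - field 0 (y t)) (at t within {0..T})"
    using reduced_limit[OF c \<delta>(2,3), where \<epsilon> = \<epsilon> and x = x] reg by blast
  then show ?thesis using c unfolding region_def by blast
qed

end

section \<open>Coercivity and symmetry along solutions\<close>

lemma quadratic_form_bounded_below_on_compact:
  fixes M :: "'t::topological_space \<Rightarrow> real^'m^'m"
  assumes "compact K" "continuous_on K M" "\<And>t. t \<in> K \<Longrightarrow> pos_def (M t)"
  shows "\<exists>c>0. \<forall>t\<in>K. \<forall>v. c * (v \<bullet> v) \<le> v \<bullet> (M t *v v)"
proof (cases "K = {}")
  case False
  let ?S = "sphere (0::real^'m) 1"
  have cont: "continuous_on (K \<times> ?S) (\<lambda>p. snd p \<bullet> (M (fst p) *v snd p))"
    by (intro continuous_on_inner mv.continuous_on continuous_on_compose2[OF assms(2)] continuous_intros)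
      auto
  have "axis undefined 1 \<in> ?S" by simp
  then have "K \<times> ?S \<noteq> {}" using False by blast
  then obtain t w where tw: "t \<in> K" "w \<in> ?S"
    and min: "\<And>s v. s \<in> K \<Longrightarrow> v \<in> ?S \<Longrightarrow> w \<bullet> (M t *v w) \<le> v \<bullet> (M s *v v)"
    using continuous_attains_inf[OF compact_Times[OF assms(1) compact_sphere] _ cont] by fastforce
  have "w \<noteq> 0" using tw by auto
  then have "0 < w \<bullet> (M t *v w)" using assms(3)[OF tw(1)] by (simp add: pos_def_def)
  moreover have "(w \<bullet> (M t *v w)) * (v \<bullet> v) \<le> v \<bullet> (M s *v v)" if "s \<in> K" for s v
  proof (cases "v = 0")
    case False
    define u where "u = (1 / norm v) *\<^sub>R v"
    have "w \<bullet> (M t *v w) \<le> u \<bullet> (M s *v u)"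
      using that False by (intro min) (auto simp: u_def)
    then have "(w \<bullet> (M t *v w)) * (v \<bullet> v) \<le> (u \<bullet> (M s *v u)) * (v \<bullet> v)"
      by (rule mult_right_mono) simp
    also have "\<dots> = v \<bullet> (M s *v v)"
      using False by (simp add: u_def mv.scaleR_right power2_norm_eq_inner[symmetric] power2_eq_square)
    finally show ?thesis .
  qed simp
  ultimately show ?thesis by blast
qed (auto intro: exI[of _ 1])

context lq_game
begin

lemma linear_blocks:
  "bounded_linear (x1 :: 'n blocks \<Rightarrow> _)" "bounded_linear (x2 :: 'n blocks \<Rightarrow> _)"
  "bounded_linear (x3 :: 'n blocks \<Rightarrow> _)" "bounded_linear (x4 :: 'n blocks \<Rightarrow> _)"
  by (rule bounded_linear_fst bounded_linear_fst_comp[OF bounded_linear_snd]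
      bounded_linear_fst_comp[OF bounded_linear_snd_comp[OF bounded_linear_snd]]
      bounded_linear_snd_comp[OF bounded_linear_snd_comp[OF bounded_linear_snd]])+

text \<open>
  Symmetry of the blocks as the kernel of a linear map: this makes the symmetric blocks a closed
  subspace and lets the map be applied to a differential equation.
\<close>

definition skew :: "'n blocks \<Rightarrow> 'n blocks"
  where "skew x = (x1 x - transpose (x1 x), 0, x3 x - transpose (x3 x), x4 x - transpose (x4 x))"

lemma sym_blocks_iff_skew: "sym_blocks x \<longleftrightarrow> skew x = 0"
  by (auto simp: sym_blocks_def skew_def prod_eq_iff)

lemma bounded_linear_skew: "bounded_linear skew"
  unfolding skew_def
  by (intro bounded_linear_Pair bounded_linear_sub bounded_linear_zero linear_blocks
      bounded_linear_compose[OF bounded_linear_transpose])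

text \<open>
  The skew part has derivative zero.
\<close>

lemma sym_blocks_propagates:
  fixes y y' :: "real \<Rightarrow> 'n blocks"
  assumes der: "\<And>t. t \<in> {0..T} \<Longrightarrow> (y has_vector_derivative y' t) (at t within {0..T})"
    and y': "\<And>t. t \<in> {0..T} \<Longrightarrow> sym_blocks (y' t)" and yT: "sym_blocks (y T)" and t: "t \<in> {0..T}"
  shows "sym_blocks (y t)"
proof -
  have "(norm (skew (y t)))\<^sup>2 \<le> ((norm (skew (y T)))\<^sup>2 + 0\<^sup>2) * exp ((2 * 0 + 1) * T)"
  proof (rule gronwall_norm[OF _ _ order.refl t])
    fix s assume s: "s \<in> {0..T}"
    show "((\<lambda>t. skew (y t)) has_vector_derivative skew (y' s)) (at s within {0..T})"
      by (rule bounded_linear.has_vector_derivative[OF bounded_linear_skew der[OF s]])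
    show "norm (skew (y' s)) \<le> 0 * norm (skew (y s)) + 0" using y'[OF s] by (simp add: sym_blocks_iff_skew)
  qed
  then show ?thesis using yT by (simp add: sym_blocks_iff_skew)
qed

section \<open>The system without perturbation\<close>

lemma matrix_inv_mat_1: "matrix_inv (mat 1 :: real^'k^'k) = mat 1"
  using matrix_inv_inverse(1)[of "mat 1 :: real^'k^'k"] invertible_def by fastforce

lemma F1_0: "F1 0 y1 y2 y3 y4 = y1 ** A + transpose A ** y1 + Q - y1 ** B ** gain y1 ** transpose B ** y1"
  by (simp add: F1_def)

lemma F2_0: "F2 0 y1 y2 y3 y4 = y2 ** A + (y1 + y2) ** G + transpose A ** y2 - Q ** \<Gamma>
    - y1 ** B ** gain y1 ** transpose B ** y2
    - y2 ** B ** gain y1 ** transpose B ** (y1 + y2)"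
  by (simp add: F2_def own_row_def resp1_def resp2_def matrix_mul_assoc matrix_add_ldistrib)

definition limit_fb :: "real^'n^'n \<Rightarrow> real^'n^'n \<Rightarrow> real^'n^'m"
  where "limit_fb y1 y2 = - (gain y1 ** transpose B ** (y1 + y2))"

lemma mean_fb_0: "mean_fb 0 y1 y2 y3 y4 = limit_fb y1 y2"
  by (simp add: limit_fb_def mean_fb_def cpl_def own_row_def matrix_inv_mat_1)

definition tail_field :: "real^'n^'n \<Rightarrow> real^'n^'n \<Rightarrow> (real^'n^'n) \<times> (real^'n^'n) \<Rightarrow> (real^'n^'n) \<times> (real^'n^'n)"
  where "tail_field y1 y2 z = (F3 0 y1 y2 (fst z) (snd z), F4 0 y1 y2 (fst z) (snd z))"

lemma F3_0: "F3 0 y1 y2 y3 y4 =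
    y3 ** A + (transpose y2 + y4) ** G + (transpose A ** y3 + transpose G ** transpose (transpose y2 + y4))
    + transpose \<Gamma> ** Q ** \<Gamma> - transpose y2 ** B ** gain y1 ** transpose B ** y2
    - (y3 ** (B ** gain y1 ** transpose B ** y1) + y4 ** (B ** gain y1 ** transpose B ** y2))
    - (transpose y1 ** B ** gain y1 ** transpose B ** y3 + transpose y2 ** B ** gain y1 ** transpose B ** y4)
    + transpose y1 ** B ** gain y1 ** transpose B\<^sub>1 ** y3 ** (B\<^sub>1 ** gain y1 ** transpose B ** y1)
    + transpose (limit_fb y1 y2) ** transpose B\<^sub>0 ** ((y1 + y2 + transpose y2) + y4) ** (B\<^sub>0 ** limit_fb y1 y2)"
  by (simp add: F3_def mean_cost_def mean_fb_0 noise0_def own_row_def other_row_def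
      resp1_def resp2_def noise1_def matrix_mul_assoc transpose_simps(1) add.assoc)

lemma F4_0: "F4 0 y1 y2 y3 y4 =
    y4 ** A + (transpose y2 + y4) ** G + (transpose A ** y4 + transpose G ** transpose (transpose y2 + y4))
    + transpose \<Gamma> ** Q ** \<Gamma> - transpose y2 ** B ** gain y1 ** transpose B ** y2
    - (y4 ** (B ** gain y1 ** transpose B ** y1) + y4 ** (B ** gain y1 ** transpose B ** y2))
    - (transpose y1 ** B ** gain y1 ** transpose B ** y4 + transpose y2 ** B ** gain y1 ** transpose B ** y4)
    + transpose (limit_fb y1 y2) ** transpose B\<^sub>0 ** ((y1 + y2 + transpose y2) + y4) ** (B\<^sub>0 ** limit_fb y1 y2)"
  by (simp add: F4_def mean_cost_def mean_fb_0 noise0_def own_row_def other_row_def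
      resp1_def resp2_def matrix_mul_assoc transpose_simps(1) add.assoc)

definition affine_map :: "('a::real_vector \<Rightarrow> 'b::real_vector) \<Rightarrow> bool"
  where "affine_map f \<longleftrightarrow> linear (\<lambda>x. f x - f 0)"

lemma affine_map_const: "affine_map (\<lambda>_. c)"
  by (simp add: affine_map_def linear_zero)

lemma affine_map_linear:
  assumes "linear f"
  shows "affine_map f"
  using assms linear_0[OF assms] by (simp add: affine_map_def)

lemma affine_map_add:
  assumes "affine_map f" "affine_map g"
  shows "affine_map (\<lambda>x. f x + g x)"
  using linear_compose_add[OF assms[unfolded affine_map_def]] by (simp add: affine_map_def algebra_simps)

lemma affine_map_diff:
  assumes "affine_map f" "affine_map g"
  shows "affine_map (\<lambda>x. f x - g x)"
  using linear_compose_sub[OF assms[unfolded affine_map_def]] by (simp add: affine_map_def algebra_simps)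

lemma affine_map_compose_linear:
  assumes "linear h" "affine_map f"
  shows "affine_map (\<lambda>x. h (f x))"
  using linear_compose[OF assms(2)[unfolded affine_map_def] assms(1)]
  by (simp add: affine_map_def o_def linear_diff[OF assms(1)])

lemma linear_mult: "linear (\<lambda>X::real^'b^'a. X ** M)" "linear (\<lambda>X::real^'c^'b. M' ** X)"
  by (intro linearI; simp add: mm_linear)+

lemmas affine_map_intros = affine_map_const affine_map_linear[OF bounded_linear.linear[OF bounded_linear_fst]] affine_map_linear[OF bounded_linear.linear[OF bounded_linear_snd]]
  affine_map_add affine_map_diff affine_map_compose_linear[OF linear_transpose]
  affine_map_compose_linear[OF linear_mult(1)] affine_map_compose_linear[OF linear_mult(2)]

lemma affine_map_Pair:
  assumes "affine_map f" "affine_map g"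
  shows "affine_map (\<lambda>x. (f x, g x))"
proof -
  have "linear (\<lambda>x. (f x - f 0, g x - g 0))"
    using assms unfolding affine_map_def linear_iff by auto
  then show ?thesis by (simp add: affine_map_def)
qed

lemma tail_field_affine: "affine_map (tail_field y1 y2)"
  unfolding tail_field_def F3_0 F4_0
  by (rule affine_map_Pair; (rule affine_map_intros)+)

lemma tail_field_sym:
  assumes "transpose y1 = y1" "transpose (gain y1) = gain y1"
    "transpose (fst z) = fst z" "transpose (snd z) = snd z"
  shows "transpose (fst (tail_field y1 y2 z)) = fst (tail_field y1 y2 z)"
    "transpose (snd (tail_field y1 y2 z)) = snd (tail_field y1 y2 z)"
  unfolding tail_field_def F3_0 F4_0
  by (simp_all add: transpose_simps matrix_mul_assoc assms Q_sym algebra_simps)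

lemma tail_field_continuous:
  assumes "continuous_on S y1" "continuous_on S y2" "continuous_on S (\<lambda>t. gain (y1 t))"
    "continuous_on S z"
  shows "continuous_on S (\<lambda>t. tail_field (y1 t) (y2 t) (z t))"
  unfolding tail_field_def F3_0 F4_0 limit_fb_def
  by (intro continuous_intros mm.continuous_on bounded_linear.continuous_on[OF bounded_linear_transpose] assms)


text \<open>
  The components \<open>F3\<close> and \<open>F4\<close> have symmetric values at symmetric arguments but do not commute with
  transposition in general, because \<open>other_row\<close> contains \<open>x4\<close> in the places of both \<open>\<Pi>\<^sub>4\<close> and its
  transpose. So symmetry of the solution is obtained by symmetrizing the argument of the vector field.
\<close>

definition symmetrize :: "(real^'n^'n) \<times> (real^'n^'n) \<Rightarrow> (real^'n^'n) \<times> (real^'n^'n)"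
  where "symmetrize z = ((1/2) *\<^sub>R (fst z + transpose (fst z)), (1/2) *\<^sub>R (snd z + transpose (snd z)))"

lemma bounded_linear_symmetrize: "bounded_linear symmetrize"
  unfolding symmetrize_def
  by (intro bounded_linear_Pair bounded_linear_add bounded_linear_fst bounded_linear_snd
      bounded_linear_compose[OF bounded_linear_transpose]
      bounded_linear_compose[OF bounded_linear_scaleR_right])

lemma symmetrize_symmetric:
  "transpose (fst (symmetrize z)) = fst (symmetrize z)" "transpose (snd (symmetrize z)) = snd (symmetrize z)"
  by (simp_all add: symmetrize_def transpose_simps add.commute)

lemma symmetrize_id:
  assumes "transpose (fst z) = fst z" "transpose (snd z) = snd z"
  shows "symmetrize z = z"
  by (simp add: symmetrize_def assms prod_eq_iff flip: scaleR_2)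

text \<open>
  If \<open>z\<close> solves the equation with \<open>symmetrize z\<close> inserted into the vector field, then its derivative
  is symmetric, and \<open>symmetrize z\<close> solves the original equation.
\<close>

lemma limit_tail_exists:
  assumes y1: "continuous_on {0..T} y1" and y2: "continuous_on {0..T} y2"
    and pd: "\<And>t. t \<in> {0..T} \<Longrightarrow> pos_def (wgt (y1 t))"
    and sym: "\<And>t. t \<in> {0..T} \<Longrightarrow> transpose (y1 t) = y1 t"
    and c: "transpose (fst c) = fst c" "transpose (snd c) = snd c"
  shows "\<exists>z. z T = c \<and> (\<forall>t\<in>{0..T}. transpose (fst (z t)) = fst (z t) \<and> transpose (snd (z t)) = snd (z t) \<and>
    (z has_vector_derivative - tail_field (y1 t) (y2 t) (z t)) (at t within {0..T}))"
proof -
  define h where "h t z = - tail_field (y1 t) (y2 t) (symmetrize z)" for t z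
  have W: "continuous_on {0..T} (\<lambda>t. wgt (y1 t))"
    unfolding wgt_def by (intro continuous_intros mm.continuous_on y1)
  have H: "continuous_on {0..T} (\<lambda>t. gain (y1 t))"
    unfolding gain_def by (intro continuous_on_matrix_inv W pos_def_invertible pd compact_Icc)
  have "continuous_on ({0..T} \<times> UNIV) (\<lambda>p. h (fst p) (snd p))"
    unfolding h_def
    by (intro continuous_on_minus tail_field_continuous
        bounded_linear.continuous_on[OF bounded_linear_symmetrize]
        continuous_on_compose2[OF y1] continuous_on_compose2[OF y2] continuous_on_compose2[OF H]
        continuous_intros) auto
  moreover have "linear (\<lambda>z. h t z - h t 0)" for t
  proof -
    interpret s: bounded_linear symmetrize by (rule bounded_linear_symmetrize)
    have "linear (\<lambda>z. tail_field (y1 t) (y2 t) (symmetrize z) - tail_field (y1 t) (y2 t) 0)"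
      using linear_compose[OF s.linear tail_field_affine[unfolded affine_map_def]] by (simp add: o_def)
    from linear_compose_neg[OF this] show ?thesis
      by (simp add: h_def s.zero)
  qed
  ultimately obtain z where z: "\<And>t. t \<in> {0..T} \<Longrightarrow> (z has_vector_derivative h t (z t)) (at t within {0..T})"
    "z T = c"
    using affine_terminal_value_problem[of T h c] T_pos by force
  define w where "w t = symmetrize (z t)" for t
  have "(w has_vector_derivative - tail_field (y1 t) (y2 t) (w t)) (at t within {0..T})" if t: "t \<in> {0..T}" for t
  proof -
    have g: "transpose (gain (y1 t)) = gain (y1 t)"
      using transpose_matrix_inv[OF pos_def_invertible[OF pd[OF t]]] by (simp add: gain_def wgt_sym sym[OF t])
    have "transpose (fst (h t (z t))) = fst (h t (z t))" "transpose (snd (h t (z t))) = snd (h t (z t))"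
      using tail_field_sym[OF sym[OF t] g symmetrize_symmetric] by (simp_all add: h_def transpose_simps)
    then have "symmetrize (h t (z t)) = h t (z t)" by (rule symmetrize_id)
    then show ?thesis
      using bounded_linear.has_vector_derivative[OF bounded_linear_symmetrize z(1)[OF t]]
      by (simp add: w_def[abs_def] h_def)
  qed
  moreover have "w T = c" by (simp add: w_def z(2) symmetrize_id c)
  moreover have "transpose (fst (w t)) = fst (w t)" "transpose (snd (w t)) = snd (w t)" for t
    by (simp_all add: w_def symmetrize_symmetric)
  ultimately show ?thesis by blast
qed

section \<open>Persistence under perturbation\<close>

lemma wgt_perturbation:
  "\<exists>C>0. \<forall>Y X v. \<bar>v \<bullet> (wgt (Y + X) *v v) - v \<bullet> (wgt Y *v v)\<bar> \<le> C * norm X * (v \<bullet> v)"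
proof -
  obtain C where C: "C > 0" "\<And>(X::real^'m^'m) v. norm (X *v v) \<le> norm X * norm v * C"
    using mv.pos_bounded by blast
  have "bounded_linear (\<lambda>X::real^'n^'n. transpose B\<^sub>1 ** X ** B\<^sub>1)"
    by (intro bounded_linear_compose[OF mm.bounded_linear_left] mm.bounded_linear_right)
  then obtain D where D: "D > 0" "\<And>X::real^'n^'n. norm (transpose B\<^sub>1 ** X ** B\<^sub>1) \<le> norm X * D"
    using bounded_linear.pos_bounded by blast
  have "\<bar>v \<bullet> (wgt (Y + X) *v v) - v \<bullet> (wgt Y *v v)\<bar> \<le> (D * C) * norm X * (v \<bullet> v)" for Y X v
  proof -
    let ?Z = "transpose B\<^sub>1 ** X ** B\<^sub>1"
    have "v \<bullet> (wgt (Y + X) *v v) - v \<bullet> (wgt Y *v v) = v \<bullet> (?Z *v v)"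
      by (simp add: wgt_def mm_linear mv.add_left inner_add_right)
    also have "\<bar>v \<bullet> (?Z *v v)\<bar> \<le> norm v * norm (?Z *v v)" by (rule Cauchy_Schwarz_ineq2)
    also have "\<dots> \<le> norm v * ((norm X * D) * norm v * C)"
    proof (intro mult_left_mono)
      have "norm ?Z * norm v * C \<le> (norm X * D) * norm v * C"
        using C(1) D(2)[of X] by (intro mult_right_mono) auto
      with C(2)[of ?Z v] show "norm (?Z *v v) \<le> (norm X * D) * norm v * C" by linarith
    qed simp
    finally show ?thesis
      by (simp add: power2_norm_eq_inner[symmetric] power2_eq_square mult_ac)
  qed
  then show ?thesis using C(1) D(1) by (intro exI[of _ "D * C"]) auto
qed

lemma field_lipschitz_continuous:
  assumes "0 \<le> L" and "\<And>e x e' x'. (e, x) \<in> region K c \<delta> \<Longrightarrow> (e', x') \<in> region K c \<delta> \<Longrightarrow>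
    norm (field e x - field e' x') \<le> L * (\<bar>e - e'\<bar> + norm (x - x'))"
    and g: "continuous_on S g" "\<And>p. p \<in> S \<Longrightarrow> (e, g p) \<in> region K c \<delta>"
  shows "continuous_on S (\<lambda>p. field e (g p))"
proof -
  have "continuous_on {x. (e, x) \<in> region K c \<delta>} (field e)"
    by (rule lipschitz_on_continuous_on[OF lipschitz_onI[where L = L]])
      (use assms(1) assms(2)[of e _ e] in \<open>auto simp: dist_norm\<close>)
  then show ?thesis by (rule continuous_on_compose2[OF _ g(1)]) (use g(2) in auto)
qed

text \<open>
  Let \<open>Z\<close> be the closed convex set of symmetric blocks of norm at most \<open>\<rho>\<close>, with \<open>\<rho>\<close> so small that the
  tube \<open>Y t + Z\<close> lies in a region. Composing with the nearest-point projection onto \<open>Z\<close>, which is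
  nonexpansive, makes the vector field globally Lipschitz without changing it in the tube. The
  solution \<open>y\<close> of the modified equation differs from \<open>Y\<close> by at most \<open>D * e\<close>, which is below \<open>\<rho>\<close> for
  small \<open>e\<close>; and \<open>y\<close> is symmetric since the modified vector field has symmetric values. Therefore \<open>y\<close>
  stays in the tube and solves the original equation.
\<close>

proposition reduced_persistence:
  fixes Y :: "real \<Rightarrow> 'n blocks"
  assumes c: "0 < c"
    and coercive: "\<And>t v. t \<in> {0..T} \<Longrightarrow> 2 * c * (v \<bullet> v) \<le> v \<bullet> (wgt (x1 (Y t)) *v v)"
    and sym: "\<And>t. t \<in> {0..T} \<Longrightarrow> sym_blocks (Y t)"
    and der: "\<And>t. t \<in> {0..T} \<Longrightarrow> (Y has_vector_derivative - field 0 (Y t)) (at t within {0..T})"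
    and fin: "Y T = terminal 0"
  shows "\<exists>K \<delta>. 0 < \<delta> \<and>
    (\<forall>(e, x)\<in>region K c \<delta>. (\<forall>v. 1/2 * norm v \<le> norm (bcpl e x *v v)) \<and>
      (\<forall>v. e\<^sup>2 * \<bar>v \<bullet> (bnoise0 e x *v v)\<bar> \<le> c / 2 * (v \<bullet> v))) \<and>
    (\<forall>N\<ge>3. 1 / real N \<le> \<delta> \<longrightarrow> (\<exists>y. y T = terminal (1 / real N) \<and>
      (\<forall>t\<in>{0..T}. (1 / real N, y t) \<in> region K c \<delta> \<and> sym_blocks (y t) \<and>
        (y has_vector_derivative - field (1 / real N) (y t)) (at t within {0..T}))))"
proof -
  have Tin: "T \<in> {0..T}" using T_pos by simp
  have Ycont: "continuous_on {0..T} Y" using der by (rule continuous_on_vector_derivative)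
  then have "bounded (Y ` {0..T})" by (intro compact_imp_bounded compact_continuous_image compact_Icc)
  then obtain K0 where "\<forall>x\<in>Y ` {0..T}. norm x \<le> K0" unfolding bounded_iff by blast
  then have K0: "norm (Y t) \<le> K0" if "t \<in> {0..T}" for t using that by blast
  obtain C where C: "C > 0" "\<And>Y X v. \<bar>v \<bullet> (wgt (Y + X) *v v) - v \<bullet> (wgt Y *v v)\<bar> \<le> C * norm X * (v \<bullet> v)"
    using wgt_perturbation by blast
  define \<rho> where "\<rho> = min 1 (c / C)"
  have \<rho>: "0 < \<rho>" "\<rho> \<le> 1" "C * \<rho> \<le> c"
  proof -
    show "0 < \<rho>" "\<rho> \<le> 1" using c C(1) by (auto simp: \<rho>_def)
    have "\<rho> \<le> c / C" by (simp add: \<rho>_def)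
    then show "C * \<rho> \<le> c" using C(1) by (simp add: pos_le_divide_eq mult.commute)
  qed
  \<comment> \<open>Since \<open>\<rho> \<le> 1\<close>, this bounds the whole tube.\<close>
  define K where "K = K0 + 1"
  obtain \<delta>0 where \<delta>0: "0 < \<delta>0" "\<delta>0 \<le> 1"
    and cpl: "\<And>e x v. (e, x) \<in> region K c \<delta>0 \<Longrightarrow> 1/2 * norm v \<le> norm (bcpl e x *v v)"
    and noise: "\<And>e x v. (e, x) \<in> region K c \<delta>0 \<Longrightarrow> e\<^sup>2 * \<bar>v \<bullet> (bnoise0 e x *v v)\<bar> \<le> c / 2 * (v \<bullet> v)"
    using coupling_uniformly_invertible[OF c, of K] by blast
  obtain L where L: "0 \<le> L" "\<And>e x e' x'. (e, x) \<in> region K c \<delta>0 \<Longrightarrow> (e', x') \<in> region K c \<delta>0 \<Longrightarrow>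
      norm (field e x - field e' x') \<le> L * (\<bar>e - e'\<bar> + norm (x - x'))"
    using field_lipschitz[OF c \<delta>0(2) cpl] by blast
  obtain C' where C': "0 \<le> C'" "\<And>e e'. e \<in> {0..1} \<Longrightarrow> e' \<in> {0..1} \<Longrightarrow>
      norm (terminal e - terminal e') \<le> C' * \<bar>e - e'\<bar>"
    using terminal_lipschitz by blast
  \<comment> \<open>The Gronwall factor for a terminal error \<open>C' * e\<close> and a defect \<open>L * e\<close>.\<close>
  define D where "D = sqrt ((C'\<^sup>2 + L\<^sup>2) * exp ((2 * L + 1) * T))"
  have D: "0 \<le> D" by (simp add: D_def)
  define \<delta> where "\<delta> = min \<delta>0 (\<rho> / (D + 1))"
  have \<delta>: "0 < \<delta>" "\<delta> \<le> \<delta>0" "D * \<delta> \<le> \<rho>"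
  proof -
    show "0 < \<delta>" "\<delta> \<le> \<delta>0" using \<delta>0 \<rho> D by (auto simp: \<delta>_def)
    have "\<delta> * (D + 1) \<le> \<rho>" using D by (simp add: \<delta>_def pos_le_divide_eq[symmetric])
    then show "D * \<delta> \<le> \<rho>" using \<open>0 < \<delta>\<close> by (simp add: algebra_simps)
  qed
  have mono: "(e, x) \<in> region K c \<delta>0" if "(e, x) \<in> region K c \<delta>" for e x
    using that \<delta>(2) by (auto simp: region_def)
  have tube: "(e, Y t + z) \<in> region K c \<delta>" if "0 \<le> e" "e \<le> \<delta>" "t \<in> {0..T}" "norm z \<le> \<rho>" for e t z
  proof -
    have "norm (Y t + z) \<le> K" using norm_triangle_ineq[of "Y t" z] K0[OF that(3)] that(4) \<rho>(2) by (simp add: K_def)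
    moreover have "c * (v \<bullet> v) \<le> v \<bullet> (wgt (x1 (Y t + z)) *v v)" for v
    proof -
      have "C * norm (x1 z) * (v \<bullet> v) \<le> c * (v \<bullet> v)"
      proof (rule mult_right_mono)
        have "norm (x1 z) \<le> \<rho>" using norm_block_le(1)[of z] that(4) by linarith
        then have "C * norm (x1 z) \<le> C * \<rho>" using C(1) by (intro mult_left_mono) auto
        then show "C * norm (x1 z) \<le> c" using \<rho>(3) by linarith
      qed simp
      with C(2)[of v "x1 (Y t)" "x1 z"] coercive[OF that(3), of v] show ?thesis by simp
    qed
    ultimately show ?thesis using that by (simp add: region_def)
  qed
  define Z where "Z = cball (0 :: 'n blocks) \<rho> \<inter> {z. skew z = 0}"
  interpret sk: bounded_linear skew by (rule bounded_linear_skew)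
  have Z: "convex Z" "closed Z" "0 \<in> Z"
  proof -
    have "subspace {z. skew z = 0}" by (rule linear_subspace_kernel[OF sk.linear])
    then show "convex Z" unfolding Z_def by (intro convex_Int convex_cball subspace_imp_convex)
    have "closed (skew -` {0})" by (intro closed_vimage closed_singleton) (rule sk.continuous_on[OF continuous_on_id])
    moreover have "skew -` {0} = {z. skew z = 0}" by auto
    ultimately show "closed Z" unfolding Z_def by auto
    show "0 \<in> Z" using \<rho> by (simp add: Z_def sk.zero)
  qed
  define pr where "pr = closest_point Z"
  have pr_in: "pr z \<in> Z" for z unfolding pr_def using Z by (intro closest_point_in_set) auto
  have pr_norm: "norm (pr z) \<le> \<rho>" "sym_blocks (pr z)" for z
    using pr_in[of z] by (auto simp: Z_def sym_blocks_iff_skew)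
  have pr_lip: "norm (pr z - pr w) \<le> norm (z - w)" for z w
    using closest_point_lipschitz[OF Z(1,2), of z w] Z(3) by (auto simp: pr_def dist_norm)
  have pr0: "pr z = z" if "z \<in> Z" for z using that by (simp add: pr_def closest_point_self)
  have pr_le: "norm (pr z) \<le> norm z" for z using pr_lip[of z 0] pr0[OF Z(3)] by simp
  have pr_cont: "continuous_on UNIV pr"
    unfolding pr_def using Z by (intro continuous_on_closest_point) auto
  have sym_add: "sym_blocks (x + z)" if "sym_blocks x" "sym_blocks z" for x z :: "'n blocks"
    using that by (simp add: sym_blocks_iff_skew sk.add)
  have exists: "\<exists>y. y T = terminal e \<and> (\<forall>t\<in>{0..T}. (e, y t) \<in> region K c \<delta> \<and> sym_blocks (y t) \<and>
        (y has_vector_derivative - field e (y t)) (at t within {0..T}))"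
    if N: "3 \<le> N" and e: "e = 1 / real N" "e \<le> \<delta>" for N e
  proof -
    have e0: "0 \<le> e" "e \<in> {0..1}" using e \<delta> \<delta>0 by auto
    define h where "h t y = - field e (Y t + pr (y - Y t))" for t y
    have reg: "(e, Y t + pr w) \<in> region K c \<delta>" if "t \<in> {0..T}" for t w
      by (rule tube[OF e0(1) e(2) that pr_norm(1)])
    have cont: "continuous_on ({0..T} \<times> UNIV) (\<lambda>p. h (fst p) (snd p))"
      unfolding h_def
    proof (intro continuous_on_minus field_lipschitz_continuous[OF L])
      show "continuous_on ({0..T} \<times> UNIV) (\<lambda>p. Y (fst p) + pr (snd p - Y (fst p)))"
        by (intro continuous_intros continuous_on_compose2[OF Ycont] continuous_on_compose2[OF pr_cont]) auto
      show "(e, Y (fst p) + pr (snd p - Y (fst p))) \<in> region K c \<delta>0" if "p \<in> {0..T} \<times> UNIV" for p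
        using that by (intro mono reg) auto
    qed
    have lip: "norm (h t y - h t y') \<le> L * norm (y - y')" if t: "t \<in> {0..T}" for t y y'
    proof -
      have "norm (h t y - h t y') \<le> L * (\<bar>e - e\<bar> + norm (Y t + pr (y - Y t) - (Y t + pr (y' - Y t))))"
        using L(2)[OF mono[OF reg[OF t]] mono[OF reg[OF t]], of "y - Y t" "y' - Y t"]
        by (simp add: h_def norm_minus_commute)
      also have "\<dots> \<le> L * norm (y - y')"
        using pr_lip[of "y - Y t" "y' - Y t"] L(1) by (intro mult_left_mono) auto
      finally show ?thesis .
    qed
    obtain y where y: "\<And>t. t \<in> {0..T} \<Longrightarrow> (y has_vector_derivative h t (y t)) (at t within {0..T})"
      "y T = terminal e"
      using lipschitz_terminal_value_problem[OF less_imp_le[OF T_pos] cont lip, of "terminal e"] by blast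
    have small: "norm (y t - Y t) \<le> \<rho>" if t: "t \<in> {0..T}" for t
    proof -
      have "(norm (y t - Y t))\<^sup>2 \<le> ((norm (y T - Y T))\<^sup>2 + (L * e)\<^sup>2) * exp ((2 * L + 1) * T)"
      proof (rule gronwall_norm[OF _ _ L(1) t])
        fix s assume s: "s \<in> {0..T}"
        show "((\<lambda>t. y t - Y t) has_vector_derivative h s (y s) - - field 0 (Y s)) (at s within {0..T})"
          by (intro has_vector_derivative_diff y der s)
        have 0: "(0, Y s) \<in> region K c \<delta>" using tube[of 0 s 0] s \<delta> \<rho> by simp
        have "norm (h s (y s) - - field 0 (Y s)) = norm (field e (Y s + pr (y s - Y s)) - field 0 (Y s))"
          by (simp add: h_def norm_minus_commute)
        also have "\<dots> \<le> L * (\<bar>e - 0\<bar> + norm (Y s + pr (y s - Y s) - Y s))"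
          by (rule L(2)[OF mono[OF reg[OF s]] mono[OF 0]])
        also have "\<dots> \<le> L * (e + norm (y s - Y s))"
          using pr_le[of "y s - Y s"] e0 L(1) by (intro mult_left_mono) auto
        finally show "norm (h s (y s) - - field 0 (Y s)) \<le> L * norm (y s - Y s) + L * e"
          by (simp add: algebra_simps)
      qed
      also have "\<dots> \<le> ((C' * e)\<^sup>2 + (L * e)\<^sup>2) * exp ((2 * L + 1) * T)"
        using C'(2)[OF e0(2), of 0] e0 by (intro mult_right_mono add_mono power_mono order.refl) (auto simp: y fin)
      also have "\<dots> = (D * e)\<^sup>2"
        by (simp add: D_def power_mult_distrib algebra_simps)
      finally have "norm (y t - Y t) \<le> D * e" by (rule power2_le_imp_le) (use D e0 in simp)
      also have "\<dots> \<le> D * \<delta>" using e(2) D by (rule mult_left_mono)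
      finally show ?thesis using \<delta>(3) by simp
    qed
    have symy: "sym_blocks (y t)" if t: "t \<in> {0..T}" for t
    proof (rule sym_blocks_propagates[OF y(1) _ _ t])
      fix s assume s: "s \<in> {0..T}"
      have "sym_blocks (Y s + pr (y s - Y s))" by (rule sym_add[OF sym[OF s] pr_norm(2)])
      moreover have "invertible (wgt (x1 (Y s + pr (y s - Y s))))" by (rule region_invertible(2)[OF c reg[OF s]])
      ultimately have "sym_blocks (field e (Y s + pr (y s - Y s)))" by (rule sym_field[OF N e(1)])
      then show "sym_blocks (h s (y s))" by (simp add: h_def sym_blocks_iff_skew sk.neg)
    qed (simp_all add: y sym_terminal)
    have hy: "h t (y t) = - field e (y t)" if t: "t \<in> {0..T}" for t
    proof -
      have "skew (y t - Y t) = 0"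
        using symy[OF t] sym[OF t] by (simp add: sym_blocks_iff_skew sk.diff)
      then have "pr (y t - Y t) = y t - Y t" using small[OF t] by (intro pr0) (simp add: Z_def)
      then show ?thesis by (simp add: h_def)
    qed
    have "(e, y t) \<in> region K c \<delta>" if t: "t \<in> {0..T}" for t
      using tube[OF e0(1) e(2) t small[OF t]] by simp
    moreover have "(y has_vector_derivative - field e (y t)) (at t within {0..T})" if "t \<in> {0..T}" for t
      using y(1)[OF that] hy[OF that] by simp
    ultimately show ?thesis using y(2) symy by blast
  qed
  have "\<forall>(e, x)\<in>region K c \<delta>. (\<forall>v. 1/2 * norm v \<le> norm (bcpl e x *v v)) \<and>
      (\<forall>v. e\<^sup>2 * \<bar>v \<bullet> (bnoise0 e x *v v)\<bar> \<le> c / 2 * (v \<bullet> v))"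
    using cpl[OF mono] noise[OF mono] by auto
  moreover have "\<forall>N\<ge>3. 1 / real N \<le> \<delta> \<longrightarrow> (\<exists>y. y T = terminal (1 / real N) \<and>
      (\<forall>t\<in>{0..T}. (1 / real N, y t) \<in> region K c \<delta> \<and> sym_blocks (y t) \<and>
        (y has_vector_derivative - field (1 / real N) (y t)) (at t within {0..T})))"
    using exists[OF _ refl] by blast
  ultimately show ?thesis using \<delta>(1) by blast
qed

end

section \<open>Asymptotic solvability from a limit solution\<close>

context lq_game
begin

lemma noise0_sym: "sym_blocks x \<Longrightarrow> transpose (bnoise0 e x) = bnoise0 e x"
  by (simp add: sym_blocks_def bnoise0_def noise0_def own_row_def other_row_def transpose_simps
      matrix_mul_assoc algebra_simps)

text \<open>
  Membership in the region gives condition (i), the bound on the coupling matrix gives (iii), and the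
  bound on the noise term, which is half of the margin in (i), gives (ii).
\<close>

lemma blift_solves:
  assumes N: "3 \<le> N" and e: "e = 1 / real N" and c: "0 < c"
    and reg: "\<And>t. t \<in> {0..T} \<Longrightarrow> (e, y t) \<in> region K c \<delta>"
    and cpl: "\<And>t v. t \<in> {0..T} \<Longrightarrow> 1/2 * norm v \<le> norm (bcpl e (y t) *v v)"
    and noise: "\<And>t v. t \<in> {0..T} \<Longrightarrow> e\<^sup>2 * \<bar>v \<bullet> (bnoise0 e (y t) *v v)\<bar> \<le> c / 2 * (v \<bullet> v)"
    and sym: "\<And>t. t \<in> {0..T} \<Longrightarrow> sym_blocks (y t)"
    and der: "\<And>t. t \<in> {0..T} \<Longrightarrow> (y has_vector_derivative - field e (y t)) (at t within {0..T})"
    and fin: "y T = terminal e"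
  shows "solves N (\<lambda>i t. blift e (y t) i)"
  unfolding riccati_solution_def
proof (intro conjI ballI)
  fix i assume i: "i \<in> {1..N}"
  fix t assume t: "t \<in> {0..T}"
  have inv: "invertible (wgt (x1 (y t)))" by (rule region_invertible(2)[OF c reg[OF t]])
  have coercive: "c * (v \<bullet> v) \<le> v \<bullet> (wgt (x1 (y t)) *v v)" for v
    using reg[OF t] by (simp add: region_def)
  have wsym: "transpose (wgt (x1 (y t))) = wgt (x1 (y t))"
    using sym[OF t] by (intro wgt_sym) (simp add: sym_blocks_def)
  show "bsymmetric N (blift e (y t) i)"
    using blift_transpose[OF N e sym[OF t]] by (simp add: bsymmetric_def btranspose_def)
  show "pos_def (Wgt N (\<lambda>k. blift e (y t) k) i)"
    unfolding blift_Rk[OF N e sym[OF t] i] pos_def_def symmetric_mat_def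
  proof (intro conjI allI impI wsym)
    fix v :: "real^'m" assume "v \<noteq> 0"
    then have "0 < c * (v \<bullet> v)" using c by simp
    then show "0 < v \<bullet> (wgt (x1 (y t)) *v v)" using coercive[of v] by linarith
  qed
  show "pos_def (Wgt N (\<lambda>k. blift e (y t) k) i + Sig N (\<lambda>k. blift e (y t) k) i)"
    unfolding blift_Rk[OF N e sym[OF t] i] blift_S0[OF N e sym[OF t] i] pos_def_def symmetric_mat_def
  proof (intro conjI allI impI)
    show "transpose (wgt (x1 (y t)) + e\<^sup>2 *\<^sub>R bnoise0 e (y t)) = wgt (x1 (y t)) + e\<^sup>2 *\<^sub>R bnoise0 e (y t)"
      by (simp add: transpose_simps wsym noise0_sym[OF sym[OF t]])
    fix v :: "real^'m" assume "v \<noteq> 0"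
    then have "0 < c / 2 * (v \<bullet> v)" using c by simp
    moreover have "v \<bullet> ((wgt (x1 (y t)) + e\<^sup>2 *\<^sub>R bnoise0 e (y t)) *v v)
        = v \<bullet> (wgt (x1 (y t)) *v v) + e\<^sup>2 * (v \<bullet> (bnoise0 e (y t) *v v))"
      by (simp add: mv.add_left mv.scaleR_left inner_add_right)
    moreover have "- (e\<^sup>2 * (v \<bullet> (bnoise0 e (y t) *v v))) \<le> e\<^sup>2 * \<bar>v \<bullet> (bnoise0 e (y t) *v v)\<bar>"
      unfolding mult_minus_right[symmetric] by (intro mult_left_mono) auto
    ultimately show "0 < v \<bullet> ((wgt (x1 (y t)) + e\<^sup>2 *\<^sub>R bnoise0 e (y t)) *v v)"
      using noise[OF t, of v] coercive[of v] by (simp add: field_simps)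
  qed
  fix j l assume jl: "j \<in> {1..N}" "l \<in> {1..N}"
  have "rhs N (\<lambda>k. blift e (y t) k) i j l = blift e (field e (y t)) i j l"
    by (rule rhs_blift[OF N e sym[OF t] inv i jl])
  moreover have "((\<lambda>s. blift e (y s) i j l) has_vector_derivative blift e (- field e (y t)) i j l) (at t within {0..T})"
    by (rule bounded_linear.has_vector_derivative[OF bounded_linear_blift der[OF t]])
  moreover have "blift e (- field e (y t)) i j l = - blift e (field e (y t)) i j l"
    by (rule linear_neg[OF bounded_linear.linear[OF bounded_linear_blift]])
  ultimately show "((\<lambda>s. blift e (y s) i j l) has_vector_derivative
      - rhs N (\<lambda>k. blift e (y t) k) i j l) (at t within {0..T})" by simp
next
  fix i j l
  show "blift e (y T) i j l = Qfc N i j l" using N e by (simp add: fin terminal_blift)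
next
  fix t assume t: "t \<in> {0..T}"
  show "invertible (Cpl N (\<lambda>k. blift e (y t) k))"
    unfolding blift_coupling[OF N e sym[OF t]]
    by (rule invertible_bounded_below[of "1/2"]) (use cpl[OF t] in auto)
qed

lemma limit_solution_imp_solvable:
  assumes c: "0 < c"
    and coercive: "\<And>t v. t \<in> {0..T} \<Longrightarrow> 2 * c * (v \<bullet> v) \<le> v \<bullet> (wgt (x1 (Y t)) *v v)"
    and sym: "\<And>t. t \<in> {0..T} \<Longrightarrow> sym_blocks (Y t)"
    and der: "\<And>t. t \<in> {0..T} \<Longrightarrow> (Y has_vector_derivative - field 0 (Y t)) (at t within {0..T})"
    and fin: "Y T = terminal 0"
  shows "asymptotically_solvable T A G \<Gamma> \<Gamma>\<^sub>f B B\<^sub>0 B\<^sub>1 Q Q\<^sub>f R"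
proof -
  obtain K \<delta> where \<delta>: "0 < \<delta>"
    and cpl: "\<And>e x v. (e, x) \<in> region K c \<delta> \<Longrightarrow> 1/2 * norm v \<le> norm (bcpl e x *v v)"
    and noise: "\<And>e x v. (e, x) \<in> region K c \<delta> \<Longrightarrow> e\<^sup>2 * \<bar>v \<bullet> (bnoise0 e x *v v)\<bar> \<le> c / 2 * (v \<bullet> v)"
    and exist: "\<forall>N\<ge>3. 1 / real N \<le> \<delta> \<longrightarrow> (\<exists>y. y T = terminal (1 / real N) \<and>
      (\<forall>t\<in>{0..T}. (1 / real N, y t) \<in> region K c \<delta> \<and> sym_blocks (y t) \<and>
        (y has_vector_derivative - field (1 / real N) (y t)) (at t within {0..T})))"
    using reduced_persistence[OF c coercive sym der fin] by blast
  define N0 where "N0 = 3 + nat \<lceil>1 / \<delta>\<rceil>"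
  have N3: "3 \<le> N" and small: "1 / real N \<le> \<delta>" if "N \<ge> N0" for N
  proof -
    show "3 \<le> N" using that by (simp add: N0_def)
    have "1 / \<delta> \<le> real N0" unfolding N0_def by linarith
    then have "1 / \<delta> \<le> real N" using that by linarith
    then show "1 / real N \<le> \<delta>" using \<delta> \<open>3 \<le> N\<close> by (simp add: field_simps)
  qed
  have "\<forall>N. \<exists>y. N0 \<le> N \<longrightarrow> y T = terminal (1 / real N) \<and>
      (\<forall>t\<in>{0..T}. (1 / real N, y t) \<in> region K c \<delta> \<and> sym_blocks (y t) \<and>
        (y has_vector_derivative - field (1 / real N) (y t)) (at t within {0..T}))"
    using exist N3 small by blast
  then obtain y where y: "\<And>N. N0 \<le> N \<Longrightarrow> y N T = terminal (1 / real N)"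
    "\<And>N t. N0 \<le> N \<Longrightarrow> t \<in> {0..T} \<Longrightarrow> (1 / real N, y N t) \<in> region K c \<delta>"
    "\<And>N t. N0 \<le> N \<Longrightarrow> t \<in> {0..T} \<Longrightarrow> sym_blocks (y N t)"
    "\<And>N t. N0 \<le> N \<Longrightarrow> t \<in> {0..T} \<Longrightarrow>
      (y N has_vector_derivative - field (1 / real N) (y N t)) (at t within {0..T})"
    unfolding choice_iff by blast
  define P where "P N i t = blift (1 / real N) (y N t) i" for N i t
  have sol: "solves N (P N)" if N: "N0 \<le> N" for N
    unfolding P_def[abs_def]
    by (rule blift_solves[OF N3[OF N] refl c y(2)[OF N] cpl[OF y(2)[OF N]] noise[OF y(2)[OF N]]
        y(3)[OF N] y(4)[OF N] y(1)[OF N]])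
  have bound: "norm (P N 1 t 1 1) + real N * norm (P N 1 t 1 2)
      + (real N)\<^sup>2 * norm (P N 1 t 2 2) + (real N)\<^sup>2 * norm (P N 1 t 2 3) \<le> 4 * K"
    if N: "N0 \<le> N" and t: "t \<in> {0..T}" for N t
  proof -
    have "norm (P N 1 t 1 1) = norm (x1 (y N t))" "real N * norm (P N 1 t 1 2) = norm (x2 (y N t))"
      "(real N)\<^sup>2 * norm (P N 1 t 2 2) = norm (x3 (y N t))"
      "(real N)\<^sup>2 * norm (P N 1 t 2 3) = norm (x4 (y N t))"
      using N3[OF N] by (simp_all add: P_def blift_def lift_def exchangeable_def power_one_over)
    moreover have "norm (y N t) \<le> K" using y(2)[OF N t] by (simp add: region_def)
    ultimately show ?thesis using norm_block_le[of "y N t"] by linarith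
  qed
  have psd: "pos_semidef (Wgt N (\<lambda>k. P N k t) i - c *\<^sub>R mat 1)"
    if N: "N0 \<le> N" and t: "t \<in> {0..T}" and i: "i \<in> {1..N}" for N t i
  proof -
    have "Wgt N (\<lambda>k. P N k t) i = wgt (x1 (y N t))"
      unfolding P_def by (rule blift_Rk[OF N3[OF N] refl y(3)[OF N t] i])
    moreover have "transpose (wgt (x1 (y N t))) = wgt (x1 (y N t))"
      using y(3)[OF N t] by (intro wgt_sym) (simp add: sym_blocks_def)
    moreover have "c * (v \<bullet> v) \<le> v \<bullet> (wgt (x1 (y N t)) *v v)" for v
      using y(2)[OF N t] by (simp add: region_def)
    ultimately show ?thesis
      by (simp add: pos_semidef_def symmetric_mat_def transpose_simps mv.diff_left mv.scaleR_left inner_diff_right)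
  qed
  show ?thesis
    unfolding asymptotically_solvable_def
  proof (intro exI conjI allI impI ballI)
    show "0 < N0" by (simp add: N0_def)
    show "bdd_above {norm (P N 1 t 1 1) + real N * norm (P N 1 t 1 2)
                  + (real N)\<^sup>2 * norm (P N 1 t 2 2) + (real N)\<^sup>2 * norm (P N 1 t 2 3)
                  | N t. N \<ge> N0 \<and> t \<in> {0..T}}"
      using bound by (intro bdd_aboveI[of _ "4 * K"]) blast
    fix N assume N: "N0 \<le> N"
    show "solves N (P N)" by (rule sol[OF N])
    fix t assume t: "t \<in> {0..T}"
    show "invertible (Cpl N (\<lambda>k. P N k t))" using sol[OF N] t by (simp add: riccati_solution_def)
    fix i assume "i \<in> {1..N}"
    then show "pos_semidef (Wgt N (\<lambda>k. P N k t) i - c *\<^sub>R mat 1)" by (rule psd[OF N t])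
  qed (fact c)
qed

end

theorem theorem4p1:
  fixes T :: real
    and A G \<Gamma> \<Gamma>\<^sub>f :: "real^'n^'n"
    and B B\<^sub>0 B\<^sub>1 :: "real^'m^'n"
    and Q Q\<^sub>f :: "real^'n^'n"
    and R :: "real^'m^'m"
  assumes "0 < T"
    and "symmetric_mat Q" and "symmetric_mat Q\<^sub>f" and "symmetric_mat R"
  shows "asymptotically_solvable T A G \<Gamma> \<Gamma>\<^sub>f B B\<^sub>0 B\<^sub>1 Q Q\<^sub>f R \<longleftrightarrow>
    (\<exists>\<Lambda>\<^sub>1 \<Lambda>\<^sub>2 :: real \<Rightarrow> real^'n^'n.
       (\<forall>t\<in>{0..T}.
          symmetric_mat (\<Lambda>\<^sub>1 t) \<and>
          pos_def (R + transpose B\<^sub>1 ** \<Lambda>\<^sub>1 t ** B\<^sub>1) \<and>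
          (let H = matrix_inv (R + transpose B\<^sub>1 ** \<Lambda>\<^sub>1 t ** B\<^sub>1) in
            (\<Lambda>\<^sub>1 has_vector_derivative
               (\<Lambda>\<^sub>1 t ** B ** H ** transpose B ** \<Lambda>\<^sub>1 t
                - \<Lambda>\<^sub>1 t ** A - transpose A ** \<Lambda>\<^sub>1 t - Q)) (at t within {0..T}) \<and>
            (\<Lambda>\<^sub>2 has_vector_derivative
               (- (\<Lambda>\<^sub>1 t ** G) - \<Lambda>\<^sub>2 t ** (A + G) - transpose A ** \<Lambda>\<^sub>2 t
                + \<Lambda>\<^sub>1 t ** B ** H ** transpose B ** \<Lambda>\<^sub>2 t
                + \<Lambda>\<^sub>2 t ** B ** H ** transpose B ** \<Lambda>\<^sub>1 t
                + \<Lambda>\<^sub>2 t ** B ** H ** transpose B ** \<Lambda>\<^sub>2 t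
                + Q ** \<Gamma>)) (at t within {0..T}))) \<and>
       \<Lambda>\<^sub>1 T = Q\<^sub>f \<and>
       \<Lambda>\<^sub>2 T = - (Q\<^sub>f ** \<Gamma>\<^sub>f))"
  (is "_ \<longleftrightarrow> (\<exists>\<Lambda>\<^sub>1 \<Lambda>\<^sub>2. ?limit \<Lambda>\<^sub>1 \<Lambda>\<^sub>2)")
proof -
  interpret lq_game T A G \<Gamma> \<Gamma>\<^sub>f B B\<^sub>0 B\<^sub>1 Q Q\<^sub>f R
    using assms by unfold_locales (simp_all add: symmetric_mat_def)
  define \<phi>1 where "\<phi>1 y1 = y1 ** B ** gain y1 ** transpose B ** y1 - y1 ** A - transpose A ** y1 - Q" for y1
  define \<phi>2 where "\<phi>2 y1 y2 = - (y1 ** G) - y2 ** (A + G) - transpose A ** y2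
      + y1 ** B ** gain y1 ** transpose B ** y2 + y2 ** B ** gain y1 ** transpose B ** y1
      + y2 ** B ** gain y1 ** transpose B ** y2 + Q ** \<Gamma>" for y1 y2
  have limit_iff: "?limit \<Lambda>1 \<Lambda>2 \<longleftrightarrow> (\<forall>t\<in>{0..T}. transpose (\<Lambda>1 t) = \<Lambda>1 t \<and> pos_def (wgt (\<Lambda>1 t)) \<and>
      (\<Lambda>1 has_vector_derivative \<phi>1 (\<Lambda>1 t)) (at t within {0..T}) \<and>
      (\<Lambda>2 has_vector_derivative \<phi>2 (\<Lambda>1 t) (\<Lambda>2 t)) (at t within {0..T})) \<and>
      \<Lambda>1 T = Q\<^sub>f \<and> \<Lambda>2 T = - (Q\<^sub>f ** \<Gamma>\<^sub>f)" for \<Lambda>1 \<Lambda>2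
    unfolding Let_def symmetric_mat_def \<phi>1_def \<phi>2_def gain_def wgt_def ..
  \<comment> \<open>At \<open>e = 0\<close> the first two components do not involve the last two.\<close>
  have field0: "- field 0 (y1, y2, z) = (\<phi>1 y1, \<phi>2 y1 y2, - tail_field y1 y2 z)" for y1 y2 z
    by (simp add: field_def F1_0 F2_0 \<phi>1_def \<phi>2_def tail_field_def mm_linear algebra_simps)
  show ?thesis
  proof
    assume "asymptotically_solvable T A G \<Gamma> \<Gamma>\<^sub>f B B\<^sub>0 B\<^sub>1 Q Q\<^sub>f R"
    then obtain c y where c: "c > 0" and yT: "y T = terminal 0"
      and y: "\<And>t v. t \<in> {0..T} \<Longrightarrow> c * (v \<bullet> v) \<le> v \<bullet> (wgt (x1 (y t)) *v v)"
      "\<And>t. t \<in> {0..T} \<Longrightarrow> sym_blocks (y t)"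
      "\<And>t. t \<in> {0..T} \<Longrightarrow> (y has_vector_derivative - field 0 (y t)) (at t within {0..T})"
      using solvable_imp_limit_solution by blast
    have "?limit (\<lambda>t. x1 (y t)) (\<lambda>t. x2 (y t))"
    proof (rule iffD2[OF limit_iff[of "\<lambda>t. x1 (y t)" "\<lambda>t. x2 (y t)"]], intro conjI ballI)
      show "x1 (y T) = Q\<^sub>f" "x2 (y T) = - (Q\<^sub>f ** \<Gamma>\<^sub>f)" by (simp_all add: yT terminal_def)
      fix t assume t: "t \<in> {0..T}"
      show s: "transpose (x1 (y t)) = x1 (y t)" using y(2)[OF t] by (simp add: sym_blocks_def)
      show "pos_def (wgt (x1 (y t)))"
        unfolding pos_def_def symmetric_mat_def
      proof (intro conjI allI impI wgt_sym s)
        fix v :: "real^'m" assume "v \<noteq> 0"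
        then have "0 < c * (v \<bullet> v)" using c by simp
        then show "0 < v \<bullet> (wgt (x1 (y t)) *v v)" using y(1)[OF t, of v] by linarith
      qed
      have f: "- field 0 (y t) = (\<phi>1 (x1 (y t)), \<phi>2 (x1 (y t)) (x2 (y t)), - tail_field (x1 (y t)) (x2 (y t)) (snd (snd (y t))))"
        using field0[of "x1 (y t)" "x2 (y t)" "snd (snd (y t))"] by simp
      show "((\<lambda>t. x1 (y t)) has_vector_derivative \<phi>1 (x1 (y t))) (at t within {0..T})"
        using bounded_linear.has_vector_derivative[OF linear_blocks(1) y(3)[OF t]] unfolding f by simp
      show "((\<lambda>t. x2 (y t)) has_vector_derivative \<phi>2 (x1 (y t)) (x2 (y t))) (at t within {0..T})"
        using bounded_linear.has_vector_derivative[OF linear_blocks(2) y(3)[OF t]] unfolding f by simp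
    qed
    then show "\<exists>\<Lambda>\<^sub>1 \<Lambda>\<^sub>2. ?limit \<Lambda>\<^sub>1 \<Lambda>\<^sub>2"
      by (intro exI[of _ "\<lambda>t. x1 (y t)"] exI[of _ "\<lambda>t. x2 (y t)"])
  next
    assume "\<exists>\<Lambda>\<^sub>1 \<Lambda>\<^sub>2. ?limit \<Lambda>\<^sub>1 \<Lambda>\<^sub>2"
    then obtain \<Lambda>1 \<Lambda>2 where
      sym: "\<And>t. t \<in> {0..T} \<Longrightarrow> transpose (\<Lambda>1 t) = \<Lambda>1 t"
      and pd: "\<And>t. t \<in> {0..T} \<Longrightarrow> pos_def (wgt (\<Lambda>1 t))"
      and d1: "\<And>t. t \<in> {0..T} \<Longrightarrow> (\<Lambda>1 has_vector_derivative \<phi>1 (\<Lambda>1 t)) (at t within {0..T})"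
      and d2: "\<And>t. t \<in> {0..T} \<Longrightarrow> (\<Lambda>2 has_vector_derivative \<phi>2 (\<Lambda>1 t) (\<Lambda>2 t)) (at t within {0..T})"
      and fin: "\<Lambda>1 T = Q\<^sub>f" "\<Lambda>2 T = - (Q\<^sub>f ** \<Gamma>\<^sub>f)"
      unfolding limit_iff by blast
    have cont: "continuous_on {0..T} \<Lambda>1" "continuous_on {0..T} \<Lambda>2"
      by (rule continuous_on_vector_derivative, erule d1, rule continuous_on_vector_derivative, erule d2)
    have W: "continuous_on {0..T} (\<lambda>t. wgt (\<Lambda>1 t))"
      unfolding wgt_def by (intro continuous_intros mm.continuous_on cont)
    obtain c where c: "c > 0" "\<And>t v. t \<in> {0..T} \<Longrightarrow> c * (v \<bullet> v) \<le> v \<bullet> (wgt (\<Lambda>1 t) *v v)"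
      using quadratic_form_bounded_below_on_compact[OF compact_Icc W pd] by blast
    let ?z = "(transpose \<Gamma>\<^sub>f ** Q\<^sub>f ** \<Gamma>\<^sub>f, transpose \<Gamma>\<^sub>f ** Q\<^sub>f ** \<Gamma>\<^sub>f)"
    have "transpose (transpose \<Gamma>\<^sub>f ** Q\<^sub>f ** \<Gamma>\<^sub>f) = transpose \<Gamma>\<^sub>f ** Q\<^sub>f ** \<Gamma>\<^sub>f"
      by (simp add: transpose_simps Qf_sym matrix_mul_assoc)
    then obtain z where zT: "z T = ?z"
      and z: "\<And>t. t \<in> {0..T} \<Longrightarrow> transpose (fst (z t)) = fst (z t) \<and> transpose (snd (z t)) = snd (z t)"
      "\<And>t. t \<in> {0..T} \<Longrightarrow> (z has_vector_derivative - tail_field (\<Lambda>1 t) (\<Lambda>2 t) (z t)) (at t within {0..T})"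
      using limit_tail_exists[OF cont pd sym, of ?z] by auto
    show "asymptotically_solvable T A G \<Gamma> \<Gamma>\<^sub>f B B\<^sub>0 B\<^sub>1 Q Q\<^sub>f R"
    proof (rule limit_solution_imp_solvable[of "c / 2" "\<lambda>t. (\<Lambda>1 t, \<Lambda>2 t, z t)"])
      show "0 < c / 2" using c by simp
      show "(\<Lambda>1 T, \<Lambda>2 T, z T) = terminal 0" by (simp add: terminal_def fin zT)
      fix t assume t: "t \<in> {0..T}"
      show "2 * (c / 2) * (v \<bullet> v) \<le> v \<bullet> (wgt (x1 (\<Lambda>1 t, \<Lambda>2 t, z t)) *v v)" for v
        using c(2)[OF t] by simp
      show "sym_blocks (\<Lambda>1 t, \<Lambda>2 t, z t)" using sym[OF t] z(1)[OF t] by (simp add: sym_blocks_def)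
      show "((\<lambda>t. (\<Lambda>1 t, \<Lambda>2 t, z t)) has_vector_derivative - field 0 (\<Lambda>1 t, \<Lambda>2 t, z t)) (at t within {0..T})"
        unfolding field0 by (intro has_vector_derivative_Pair d1 d2 z(2) t)
    qed
  qed
qed

end
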